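(* Let $n\ge 2$, let $1<\rho<n$, and let $\Omega:\mathbb{S}^{n-1}\to\mathbb{R}$ satisfy $\Omega\in L^1(\mathbb{S}^{n-1})$, $\int_{\mathbb{S}^{n-1}}\Omega\,d\sigma=0$ and $\Omega\in L^\rho(\mathbb{S}^{n-1})$. Put $\overline{\rho}=\frac{\rho n}{\rho n+\rho-n}$ and let $\mathfrak{s}$ be a real number with $1<\overline{\rho}\le \mathfrak{s}<n$. Let $1\le\delta<+\infty$ and let $\omega$ be an $A_\delta$-weight on $\mathbb{R}^n$ satisfying the $\mathbf{d}$-lower Ahlfors condition $$c_0\, r^{\mathbf{d}}\le \omega(B(x,r))\quad\text{for all } r>0,\ x\in\mathbb{R}^n,$$ for some constant $c_0>0$ and some $1<\mathbf{d}<+\infty$ with $\mathbf{d}>\mathfrak{s}\delta$. Let $\mathfrak{q}$ be a real number with $1<\mathfrak{s}\delta\le\mathfrak{q}<\mathbf{d}$. If $f:\mathbb{R}^n\to\mathbb{R}$ is a regular function such that $\nabla f$ belongs to the weighted Morrey space $\mathcal{M}^{\mathfrak{s}\delta,\mathfrak{q}}(\omega)$, then we have the pointwise estimate $$T^*_\Omega(f)(x)\le C\,\|\Omega\|_{L^\rho(\mathbb{S}^{n-1})}\,[\omega]_{A_\delta}^{\frac{1}{\mathfrak{s}\delta}}\,\Big(\mathscr{M}_\omega(|\nabla f|^{\mathfrak{s}\delta})(x)\Big)^{\frac{1}{\mathfrak{s}\delta}\left(1-\frac{\mathfrak{q}}{\mathbf{d}}\right)}\,\|\nabla f\|_{\mathcal{M}^{\mathfrak{s}\delta,\mathfrak{q}}(\omega)}^{\frac{\mathfrak{q}}{\mathbf{d}}},$$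 where $C>0$ is a constant independent of $f$, $x$ and $\Omega$.
   Context: "Regular function" is used in the informal sense of a sufficiently smooth function; no more specific class is prescribed in the statement. $\sigma$ is the surface measure on the unit sphere $\mathbb{S}^{n-1}$; $B(x,r)$ is the open ball of center $x$ and radius $r$. Maximal rough singular integral operator: $$T^*_{\Omega}(f)(x)=\sup_{t>0}\left|\int_{\{|y|>t\}}\frac{\Omega(y/|y|)}{|y|^n}f(x-y)\,dy\right|.$$ A weight is a locally integrable function $\omega:\mathbb{R}^n\to(0,+\infty)$; for measurable $A\subset\mathbb{R}^n$, $\omega(A)=\int_A\omega(x)\,dx$. For $1<\delta<+\infty$, $\omega\in A_\delta$ means $$[\omega]_{A_\delta}=\sup_B\left(\frac{1}{|B|}\int_B\omega(x)\,dx\right)\left(\frac{1}{|B|}\int_B\omega(x)^{-\frac{1}{\delta-1}}dx\right)^{\delta-1}<+\infty,$$ and $\omega\in A_1$ means $$[\omega]_{A_1}=\sup_B\left(\frac{1}{|B|}\int_B\omega(x)\,dx\right)\|\omega^{-1}\|_{L^\infty(B)}<+\infty,$$ the suprema being over all balls $B\subset\mathbb{R}^n$. Weighted maximal function: $$\mathscr{M}_\omega(g)(x)=\sup_{B\ni x}\frac{1}{\omega(B)}\int_B|g(y)|\,\omega(y)\,dy,$$ the supremum being over all open balls $B$ containing $x$. Weighted Morrey space: for $1\le p\le q<+\infty$, $\mathcal{M}^{p,q}(\omega)$ is the set of measurable functions $g$ with $$\|g\|_{\mathcal{M}^{p,q}(\omega)}=\sup_{x\in\mathbb{R}^n,\ r>0}\left(\frac{1}{\omega(B(x,r))^{1-\frac{p}{q}}}\int_{B(x,r)}|g(y)|^p\,\omega(y)\,dy\right)^{\frac1p}<+\infty;$$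 for the vector-valued function $\nabla f$, $|\nabla f|$ is the Euclidean norm. *)

theory Defs
  imports "HOL-Probability.Essential_Supremum"
begin

text \<open>Powers of extended nonnegative reals; used for exponents \<open>p > 0\<close>, or \<open>p = 0\<close> and
  \<open>0 < u < \<infinity>\<close>.\<close>

definition ennpowr :: "ennreal \<Rightarrow> real \<Rightarrow> ennreal"  (infixr "epowr" 80) where
  "u epowr p = (if u = \<infinity> then \<infinity> else ennreal (enn2real u powr p))"

definition gradient :: "('a::euclidean_space \<Rightarrow> real) \<Rightarrow> 'a \<Rightarrow> 'a" where
  "gradient f x = (THE D. GDERIV f x :> D)"

text \<open>``Regular'' functions are taken to be the continuously differentiable ones; every smoother
  class is contained in this one.\<close>

definition C1_function :: "('a::euclidean_space \<Rightarrow> real) \<Rightarrow> bool" where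
  "C1_function f \<longleftrightarrow> (\<forall>x. f differentiable (at x)) \<and> continuous_on UNIV (gradient f)"

lemma gradient_eqI:
  assumes "GDERIV f x :> D"
  shows "gradient f x = D"
  unfolding gradient_def
proof (rule the_equality)
  fix D' assume "GDERIV f x :> D'"
  with assms have "(\<lambda>h. h \<bullet> D') = (\<lambda>h. h \<bullet> D)"
    unfolding gderiv_def by (blast intro: has_derivative_unique)
  then show "D' = D"
    by (metis vector_eq_ldot)
qed (fact assms)

lemma GDERIV_gradient:
  assumes "f differentiable (at x)"
  shows "GDERIV f x :> gradient f x"
proof -
  obtain f' where f': "(f has_derivative f') (at x)"
    using assms unfolding differentiable_def by blast
  then interpret bounded_linear f'
    by (rule has_derivative_bounded_linear)
  have "f' h = h \<bullet> (\<Sum>b\<in>Basis. f' b *\<^sub>R b)" for h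
  proof -
    have "f' h = f' (\<Sum>b\<in>Basis. (h \<bullet> b) *\<^sub>R b)"
      by (simp add: euclidean_representation)
    also have "\<dots> = (\<Sum>b\<in>Basis. (h \<bullet> b) *\<^sub>R f' b)"
      by (simp add: sum scaleR)
    finally show ?thesis
      by (simp add: inner_sum_right mult.commute)
  qed
  then have "f' = (\<lambda>h. h \<bullet> (\<Sum>b\<in>Basis. f' b *\<^sub>R b))"
    by blast
  with f' have "GDERIV f x :> (\<Sum>b\<in>Basis. f' b *\<^sub>R b)"
    unfolding gderiv_def by simp
  then show ?thesis
    using gradient_eqI by metis
qed

text \<open>Surface measure on the unit sphere via polar coordinates:
  \<open>\<sigma>(A) = n |{y. 0 < |y| < 1, y/|y| \<in> A}|\<close> for Borel \<open>A\<close>, completed.\<close>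

definition sphere_measure :: "'a::euclidean_space measure" where
  "sphere_measure = completion (distr
     (scale_measure (of_nat DIM('a)) (restrict_space lborel (ball 0 1 - {0})))
     (restrict_space borel (sphere 0 1)) (\<lambda>y. y /\<^sub>R norm y))"

lemma space_sphere_measure: "space (sphere_measure :: 'a::euclidean_space measure) = sphere 0 1"
  by (simp add: sphere_measure_def space_restrict_space)

lemma emeasure_sphere_measure:
  fixes A :: "'a::euclidean_space set"
  assumes "A \<in> sets borel" "A \<subseteq> sphere 0 1"
  shows "emeasure sphere_measure A =
    of_nat DIM('a) * emeasure lborel {y \<in> ball 0 1 - {0}. y /\<^sub>R norm y \<in> A}"
proof -
  let ?N = "restrict_space lborel (ball 0 1 - {0}) :: 'a measure"
  let ?M = "scale_measure (of_nat DIM('a)) ?N"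
  have [measurable]: "A \<in> sets borel" by fact
  have "(\<lambda>y::'a. y /\<^sub>R norm y) \<in> borel_measurable ?N"
    by (rule measurable_restrict_space1) measurable
  then have m: "(\<lambda>y::'a. y /\<^sub>R norm y) \<in> measurable ?M (restrict_space borel (sphere 0 1))"
    by (intro measurable_restrict_space2) (auto simp: space_scale_measure space_restrict_space measurable_def)
  have A: "A \<in> sets (restrict_space borel (sphere 0 1))"
    using assms by (auto simp: sets_restrict_space)
  have "emeasure sphere_measure A = emeasure ?M ((\<lambda>y. y /\<^sub>R norm y) -` A \<inter> space ?M)"
    unfolding sphere_measure_def using A m by (simp add: emeasure_distr)
  also have "(\<lambda>y. y /\<^sub>R norm y) -` A \<inter> space ?M = {y \<in> ball 0 1 - {0}. y /\<^sub>R norm y \<in> A}"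
    by (auto simp: space_scale_measure space_restrict_space)
  also have "emeasure ?M \<dots> = of_nat DIM('a) * emeasure ?N {y \<in> ball 0 1 - {0}. y /\<^sub>R norm y \<in> A}"
    by simp
  also have "emeasure ?N {y \<in> ball 0 1 - {0}. y /\<^sub>R norm y \<in> A} =
      emeasure lborel {y \<in> ball 0 1 - {0}. y /\<^sub>R norm y \<in> A}"
    by (rule emeasure_restrict_space) auto
  finally show ?thesis .
qed

definition Lp_space :: "'b measure \<Rightarrow> real \<Rightarrow> ('b \<Rightarrow> real) set" where
  "Lp_space M p = {g \<in> borel_measurable M. integrable M (\<lambda>x. \<bar>g x\<bar> powr p)}"

definition Lp_norm :: "'b measure \<Rightarrow> real \<Rightarrow> ('b \<Rightarrow> real) \<Rightarrow> real" where
  "Lp_norm M p g = (LINT x|M. \<bar>g x\<bar> powr p) powr (1 / p)"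

definition rough_kernel :: "('a::euclidean_space \<Rightarrow> real) \<Rightarrow> 'a \<Rightarrow> real" where
  "rough_kernel \<Omega> y = \<Omega> (y /\<^sub>R norm y) / norm y ^ DIM('a)"

text \<open>The integral over \<open>{|y| > t}\<close> is read as the limit of the integrals over \<open>{t < |y| < R}\<close>
  as \<open>R \<rightarrow> \<infinity>\<close>. This agrees with the Lebesgue integral whenever the latter exists
  (see \<open>truncated_abs_eq\<close> below), but it also covers functions, such as nonzero constants, for which the
  integrand is not absolutely integrable at infinity; there the library's Lebesgue integral would
  be \<open>0\<close> by convention. Taking the upper limit of absolute values avoids presupposing
  convergence.\<close>

definition truncated_abs :: "('a::euclidean_space \<Rightarrow> real) \<Rightarrow> ('a \<Rightarrow> real) \<Rightarrow> 'a \<Rightarrow> real \<Rightarrow> ennreal" where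
  "truncated_abs \<Omega> f x t = Limsup at_top (\<lambda>R.
     ennreal \<bar>LINT y:{y. t < norm y \<and> norm y < R}|lebesgue. rough_kernel \<Omega> y * f (x - y)\<bar>)"

definition maximal_rough :: "('a::euclidean_space \<Rightarrow> real) \<Rightarrow> ('a \<Rightarrow> real) \<Rightarrow> 'a \<Rightarrow> ennreal" where
  "maximal_rough \<Omega> f x = (SUP t\<in>{0<..}. truncated_abs \<Omega> f x t)"

lemma truncated_abs_eq:
  fixes x :: "'a::euclidean_space"
  assumes "set_integrable lebesgue {y. t < norm y} (\<lambda>y. rough_kernel \<Omega> y * f (x - y))"
  shows "truncated_abs \<Omega> f x t =
    ennreal \<bar>LINT y:{y. t < norm y}|lebesgue. rough_kernel \<Omega> y * f (x - y)\<bar>"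
proof -
  define h where "h y = rough_kernel \<Omega> y * f (x - y)" for y
  define g where "g y = indicator {y. t < norm y} y *\<^sub>R h y" for y
  have g: "integrable lebesgue g"
    using assms unfolding set_integrable_def g_def h_def by simp
  have eq: "indicator {y. t < norm y \<and> norm y < R} y *\<^sub>R h y = indicator (ball 0 R) y *\<^sub>R g y" for R y
    by (auto simp: g_def indicator_def)
  have "((\<lambda>R. LINT y|lebesgue. indicator (ball 0 R) y *\<^sub>R g y) \<longlongrightarrow> (LINT y|lebesgue. g y)) at_top"
  proof (rule integral_dominated_convergence_at_top)
    show "integrable lebesgue (\<lambda>y. norm (g y))"
      using g by simp
    show "g \<in> borel_measurable lebesgue"
      using g by simp
    show "(\<lambda>y. indicator (ball 0 R) y *\<^sub>R g y) \<in> borel_measurable lebesgue" for R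
      using g by (intro borel_measurable_scaleR borel_measurable_indicator) auto
    show "\<forall>\<^sub>F R in at_top. AE y in lebesgue. norm (indicator (ball 0 R) y *\<^sub>R g y) \<le> norm (g y)"
      by (intro always_eventually allI AE_I2) (auto simp: indicator_def)
    show "AE y in lebesgue. ((\<lambda>R. indicator (ball 0 R) y *\<^sub>R g y) \<longlongrightarrow> g y) at_top"
    proof (intro AE_I2 tendsto_eventually)
      fix y :: 'a
      show "\<forall>\<^sub>F R in at_top. indicator (ball 0 R) y *\<^sub>R g y = g y"
        using eventually_gt_at_top[of "norm y"] by eventually_elim (auto simp: indicator_def)
    qed
  qed
  then have "((\<lambda>R. ennreal \<bar>LINT y|lebesgue. indicator (ball 0 R) y *\<^sub>R g y\<bar>)
      \<longlongrightarrow> ennreal \<bar>LINT y|lebesgue. g y\<bar>) at_top"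
    by (intro tendsto_ennrealI tendsto_rabs)
  then show ?thesis
    unfolding truncated_abs_def set_lebesgue_integral_def h_def[symmetric] eq g_def[symmetric]
    by (intro lim_imp_Limsup) auto
qed

definition weight :: "('a::euclidean_space \<Rightarrow> real) \<Rightarrow> bool" where
  "weight \<omega> \<longleftrightarrow> \<omega> \<in> borel_measurable lebesgue \<and> (\<forall>x. 0 < \<omega> x) \<and>
     (\<forall>K. compact K \<longrightarrow> set_integrable lebesgue K \<omega>)"

definition wmeasure :: "('a::euclidean_space \<Rightarrow> real) \<Rightarrow> 'a set \<Rightarrow> ennreal" where
  "wmeasure \<omega> A = (\<integral>\<^sup>+y\<in>A. ennreal (\<omega> y) \<partial>lebesgue)"

definition ball_average :: "('a::euclidean_space \<Rightarrow> real) \<Rightarrow> 'a \<Rightarrow> real \<Rightarrow> ennreal" where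
  "ball_average g z r = (\<integral>\<^sup>+y\<in>ball z r. ennreal (g y) \<partial>lebesgue) / emeasure lebesgue (ball z r)"

definition Muckenhoupt_const :: "real \<Rightarrow> ('a::euclidean_space \<Rightarrow> real) \<Rightarrow> ennreal" where
  "Muckenhoupt_const \<delta> \<omega> = (SUP (z, r)\<in>UNIV \<times> {0<..}.
     ball_average \<omega> z r *
     (if \<delta> = 1 then esssup (lebesgue_on (ball z r)) (\<lambda>y. ennreal (inverse (\<omega> y)))
      else ball_average (\<lambda>y. \<omega> y powr (- 1 / (\<delta> - 1))) z r epowr (\<delta> - 1)))"

definition Muckenhoupt :: "real \<Rightarrow> ('a::euclidean_space \<Rightarrow> real) set" where
  "Muckenhoupt \<delta> = {\<omega>. weight \<omega> \<and> Muckenhoupt_const \<delta> \<omega> < \<infinity>}"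

definition weighted_maximal :: "('a::euclidean_space \<Rightarrow> real) \<Rightarrow> ('a \<Rightarrow> real) \<Rightarrow> 'a \<Rightarrow> ennreal" where
  "weighted_maximal \<omega> g x = (SUP (z, r)\<in>{(z, r). x \<in> ball z r}.
     (\<integral>\<^sup>+y\<in>ball z r. ennreal (\<bar>g y\<bar> * \<omega> y) \<partial>lebesgue) / wmeasure \<omega> (ball z r))"

definition Morrey_norm ::
    "real \<Rightarrow> real \<Rightarrow> ('a::euclidean_space \<Rightarrow> real) \<Rightarrow> ('a \<Rightarrow> 'b::real_normed_vector) \<Rightarrow> ennreal" where
  "Morrey_norm p q \<omega> g = (SUP (z, r)\<in>UNIV \<times> {0<..}.
     ((\<integral>\<^sup>+y\<in>ball z r. ennreal (norm (g y) powr p * \<omega> y) \<partial>lebesgue)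
       / wmeasure \<omega> (ball z r) epowr (1 - p / q)) epowr (1 / p))"

definition Morrey_space ::
    "real \<Rightarrow> real \<Rightarrow> ('a::euclidean_space \<Rightarrow> real) \<Rightarrow> ('a \<Rightarrow> 'b::real_normed_vector) set" where
  "Morrey_space p q \<omega> = {g \<in> borel_measurable lebesgue. Morrey_norm p q \<omega> g < \<infinity>}"

end

theory Submission
  imports Defs
begin

text \<open>
  Cut the truncated integral into dyadic annuli \<open>a \<le> |y| < 2a\<close>. On each annulus the kernel has
  mean zero, so \<open>f(x - y)\<close> may be replaced by its oscillation \<open>f(x - y) - f(x - z)\<close>, averaged over
  \<open>|z| < 2a\<close> and written as an integral of \<open>\<nabla>f\<close> along the segment from \<open>y\<close> to \<open>z\<close>. Hoelder's inequality
  between \<open>L\<^sup>\<rho>\<close> and \<open>L\<^sup>p\<close>, \<open>1/\<rho> + 1/p = 1 + 1/n\<close>, is critical for the Sobolev embedding of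
  \<open>\<real>\<^sup>n\<close>. But \<open>\<Omega>\<close> only depends on the direction, so one can average over dilations
  first; this makes the estimate effectively \<open>(n-1)\<close>-dimensional, where the exponents are subcritical
  and no Hardy-Littlewood-Sobolev inequality is needed. The \<open>A\<^sub>\<delta>\<close> condition turns the unweighted
  \<open>L\<^sup>p\<close> average of \<open>\<nabla>f\<close> into a weighted one, which is at most \<open>M\<close> (a power of the maximal function) and
  decays like \<open>a\<close> to the power \<open>-d/q\<close> by the Morrey and Ahlfors conditions. Summing
  \<open>min (a M) (a\<^sup>-\<^sup>\<gamma> N)\<close>, \<open>\<gamma> = d/q - 1\<close>, over dyadic \<open>a\<close> gives the interpolated bound.
\<close>

subsection \<open>Averages of homogeneous functions along segments\<close>

text \<open>Hoelder's inequality is never invoked as such. Where it is needed, the factors are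
  normalised, the product is rewritten with powers whose exponents add up to 1, and it is bounded
  pointwise by a sum, so that only integrals of single factors remain. The normalising constants
  have to be positive; hence the estimates are proved for strict upper bounds of the data, and a
  limit recovers the values 0. A second obstacle is measurability: \<open>\<Omega>\<close> is
  measurable only for the completed surface measure, while the interchanges of integrals take place
  over Borel products. So \<open>\<Omega>\<close> is replaced at the outset by a Borel function that
  is constant along rays. Finally, the minimum over the two bounds is available at every scale
  because a single number, the weighted average of a power of the gradient over one ball, is
  controlled both by the maximal function and by the Morrey norm.\<close>

lemma sets_borel_ball [measurable]: "ball (c::'a::metric_space) r \<in> sets borel"
  by simp

lemma nn_integral_lborel_affine:
  fixes f :: "'a::euclidean_space \<Rightarrow> ennreal"
  assumes [measurable]: "f \<in> borel_measurable borel" and c: "c \<noteq> 0"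
  shows "(\<integral>\<^sup>+x. f x \<partial>lborel) = ennreal (\<bar>c\<bar> ^ DIM('a)) * (\<integral>\<^sup>+x. f (t + c *\<^sub>R x) \<partial>lborel)"
  by (subst lborel_affine[OF c, of t])
     (simp add: nn_integral_density nn_integral_distr nn_integral_cmult)

lemma nn_integral_lborel_affine':
  fixes f :: "'a::euclidean_space \<Rightarrow> ennreal"
  assumes [measurable]: "f \<in> borel_measurable borel" and c: "c > 0"
  shows "(\<integral>\<^sup>+x. f (t + c *\<^sub>R x) \<partial>lborel) = ennreal (1 / c ^ DIM('a)) * (\<integral>\<^sup>+x. f x \<partial>lborel)"
proof -
  have "(\<integral>\<^sup>+x. f x \<partial>lborel) = ennreal (c ^ DIM('a)) * (\<integral>\<^sup>+x. f (t + c *\<^sub>R x) \<partial>lborel)"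
    using nn_integral_lborel_affine[of f c t] c by simp
  then show ?thesis
    using c by (simp add: mult.assoc[symmetric] ennreal_mult[symmetric])
qed

text \<open>As \<open>s\<close> varies, the point moves along a ray with speed at least 1/4, so it
  stays in a ball of diameter \<open>4 * t\<close> only for a time of order \<open>t\<close>. The
  symmetric interval around an arbitrary instant \<open>s0\<close> costs a harmless factor 2. This
  linear dependence on \<open>t\<close> is the source of the power of \<open>t\<close> gained for
  homogeneous kernels.\<close>

lemma emeasure_ray_near_point:
  fixes w y :: "'a::euclidean_space"
  assumes "0 < t" "t \<le> 1/2" "1/2 \<le> norm y"
  shows "emeasure lborel {s::real. norm (w - (1 - t) *\<^sub>R s *\<^sub>R y) < 2 * t} \<le> ennreal (32 * t)"
proof (cases "{s::real. norm (w - (1 - t) *\<^sub>R s *\<^sub>R y) < 2 * t} = {}")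
  case False
  then obtain s0 where s0: "norm (w - (1 - t) *\<^sub>R s0 *\<^sub>R y) < 2 * t" by blast
  have "{s::real. norm (w - (1 - t) *\<^sub>R s *\<^sub>R y) < 2 * t} \<subseteq> {s0 - 16 * t..s0 + 16 * t}"
  proof
    fix s assume "s \<in> {s. norm (w - (1 - t) *\<^sub>R s *\<^sub>R y) < 2 * t}"
    then have "norm ((w - (1 - t) *\<^sub>R s0 *\<^sub>R y) - (w - (1 - t) *\<^sub>R s *\<^sub>R y)) < 4 * t"
      using s0 norm_triangle_ineq4[of "w - (1 - t) *\<^sub>R s0 *\<^sub>R y" "w - (1 - t) *\<^sub>R s *\<^sub>R y"] by simp
    also have "(w - (1 - t) *\<^sub>R s0 *\<^sub>R y) - (w - (1 - t) *\<^sub>R s *\<^sub>R y) = ((1 - t) * (s - s0)) *\<^sub>R y"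
      by (simp add: algebra_simps)
    finally have *: "\<bar>s - s0\<bar> * ((1 - t) * norm y) < 4 * t"
      using assms by (simp add: abs_mult mult_ac)
    have "1/2 * (1/2) \<le> (1 - t) * norm y"
      using assms by (intro mult_mono) auto
    then have "\<bar>s - s0\<bar> * (1/4) \<le> \<bar>s - s0\<bar> * ((1 - t) * norm y)"
      by (intro mult_left_mono) auto
    from le_less_trans[OF this *] have "\<bar>s - s0\<bar> < 16 * t" by simp
    then show "s \<in> {s0 - 16 * t..s0 + 16 * t}" by (auto simp: abs_if split: if_splits)
  qed
  then have "emeasure lborel {s::real. norm (w - (1 - t) *\<^sub>R s *\<^sub>R y) < 2 * t}
      \<le> emeasure lborel {s0 - 16 * t..s0 + 16 * t}"
    by (intro emeasure_mono) auto
  also have "\<dots> = ennreal (32 * t)"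
    using assms by simp
  finally show ?thesis .
qed (use assms in simp)

text \<open>For fixed \<open>y\<close> the substitution \<open>w = (1 - t) y + t z\<close> has
  Jacobian \<open>t^n\<close>; forgetting the restriction to the ball then decouples the two
  integrals. Adequate as long as \<open>t\<close> stays away from 0.\<close>

lemma nn_integral_average_le:
  fixes K G :: "'a::euclidean_space \<Rightarrow> ennreal"
  assumes [measurable]: "K \<in> borel_measurable borel" "G \<in> borel_measurable borel"
    and t: "0 < t"
  shows "(\<integral>\<^sup>+y. K y * (\<integral>\<^sup>+z. indicator (ball 0 2) z * G ((1 - t) *\<^sub>R y + t *\<^sub>R z) \<partial>lborel) \<partial>lborel)
    \<le> ennreal (1 / t ^ DIM('a)) * (\<integral>\<^sup>+y. K y \<partial>lborel) * (\<integral>\<^sup>+w. G w \<partial>lborel)"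
proof -
  have "(\<integral>\<^sup>+z. indicator (ball 0 2) z * G ((1 - t) *\<^sub>R y + t *\<^sub>R z) \<partial>lborel)
      \<le> ennreal (1 / t ^ DIM('a)) * (\<integral>\<^sup>+w. G w \<partial>lborel)" for y
  proof -
    have "(\<integral>\<^sup>+z. indicator (ball 0 2) z * G ((1 - t) *\<^sub>R y + t *\<^sub>R z) \<partial>lborel)
        \<le> (\<integral>\<^sup>+z. G ((1 - t) *\<^sub>R y + t *\<^sub>R z) \<partial>lborel)"
      by (intro nn_integral_mono) (auto simp: indicator_def)
    also have "\<dots> = ennreal (1 / t ^ DIM('a)) * (\<integral>\<^sup>+w. G w \<partial>lborel)"
      using t by (intro nn_integral_lborel_affine') auto
    finally show ?thesis .
  qed
  then have "(\<integral>\<^sup>+y. K y * (\<integral>\<^sup>+z. indicator (ball 0 2) z * G ((1 - t) *\<^sub>R y + t *\<^sub>R z) \<partial>lborel) \<partial>lborel)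
    \<le> (\<integral>\<^sup>+y. K y * (ennreal (1 / t ^ DIM('a)) * (\<integral>\<^sup>+w. G w \<partial>lborel)) \<partial>lborel)"
    by (intro nn_integral_mono mult_left_mono) auto
  also have "\<dots> = ennreal (1 / t ^ DIM('a)) * (\<integral>\<^sup>+y. K y \<partial>lborel) * (\<integral>\<^sup>+w. G w \<partial>lborel)"
    by (simp add: nn_integral_multc mult_ac)
  finally show ?thesis .
qed

text \<open>Replacing \<open>y\<close> by \<open>s y\<close> leaves \<open>K\<close> unchanged,
  costs a Jacobian of at most \<open>2^n\<close> and moves the dilation into \<open>\<Phi>\<close>.
  Averaging over \<open>s\<close> in [1, 2], an interval of length 1, then smooths
  \<open>\<Phi>\<close> along rays. The inner radius drops to 1/2 because \<open>s\<close> may be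
  2.\<close>

lemma nn_integral_homogeneous_average_le:
  fixes K \<Phi> :: "'a::euclidean_space \<Rightarrow> ennreal"
  assumes [measurable]: "K \<in> borel_measurable borel" "\<Phi> \<in> borel_measurable borel"
    and hom: "\<And>c y. 0 < c \<Longrightarrow> K (c *\<^sub>R y) = K y"
  shows "(\<integral>\<^sup>+y. indicator {y. 1 \<le> norm y \<and> norm y < 2} y * K y * \<Phi> y \<partial>lborel)
    \<le> ennreal (2 ^ DIM('a)) * (\<integral>\<^sup>+y. indicator {y. 1/2 \<le> norm y \<and> norm y < 2} y * K y *
        (\<integral>\<^sup>+s. indicator {1..2} s * \<Phi> (s *\<^sub>R y) \<partial>lborel) \<partial>lborel)"
    (is "?I \<le> _")
proof -
  have *: "?I \<le> ennreal (2 ^ DIM('a)) *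
      (\<integral>\<^sup>+y. indicator {y. 1/2 \<le> norm y \<and> norm y < 2} y * K y * \<Phi> (s *\<^sub>R y) \<partial>lborel)"
    if s: "s \<in> {1..2}" for s
  proof -
    have "?I = ennreal (\<bar>s\<bar> ^ DIM('a)) * (\<integral>\<^sup>+y. indicator {y. 1 \<le> norm y \<and> norm y < 2} (0 + s *\<^sub>R y)
        * K (0 + s *\<^sub>R y) * \<Phi> (0 + s *\<^sub>R y) \<partial>lborel)"
      using s by (intro nn_integral_lborel_affine) auto
    also have "\<dots> \<le> ennreal (2 ^ DIM('a)) * (\<integral>\<^sup>+y. indicator {y. 1/2 \<le> norm y \<and> norm y < 2} y * K y * \<Phi> (s *\<^sub>R y) \<partial>lborel)"
    proof (intro mult_mono nn_integral_mono ennreal_leI power_mono)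
      fix y :: 'a
      have "1/2 \<le> norm y" "norm y < 2" if "1 \<le> norm (s *\<^sub>R y)" "norm (s *\<^sub>R y) < 2"
      proof -
        from that s have "1 \<le> s * norm y" "s * norm y < 2" by auto
        moreover have "s * norm y \<le> 2 * norm y" "1 * norm y \<le> s * norm y"
          using s by (intro mult_right_mono; simp)+
        ultimately show "1/2 \<le> norm y" "norm y < 2" by linarith+
      qed
      then show "indicator {y. 1 \<le> norm y \<and> norm y < 2} (0 + s *\<^sub>R y) \<le> (indicator {y. 1/2 \<le> norm y \<and> norm y < 2} y :: ennreal)"
        by (auto simp: indicator_def)
    qed (use s hom in auto)
    finally show ?thesis .
  qed
  have "?I = (\<integral>\<^sup>+s. ?I * indicator {1..2::real} s \<partial>lborel)"
    by (subst nn_integral_cmult) auto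
  also have "\<dots> \<le> (\<integral>\<^sup>+s. ennreal (2 ^ DIM('a)) *
      (\<integral>\<^sup>+y. indicator {y. 1/2 \<le> norm y \<and> norm y < 2} y * K y * \<Phi> (s *\<^sub>R y) \<partial>lborel) * indicator {1..2::real} s \<partial>lborel)"
    using * by (intro nn_integral_mono) (auto simp: indicator_def)
  also have "\<dots> = ennreal (2 ^ DIM('a)) * (\<integral>\<^sup>+s. 
      (\<integral>\<^sup>+y. indicator {1..2::real} s * (indicator {y. 1/2 \<le> norm y \<and> norm y < 2} y * K y * \<Phi> (s *\<^sub>R y)) \<partial>lborel) \<partial>lborel)"
    by (simp add: nn_integral_cmult[symmetric] mult_ac)
  also have "(\<integral>\<^sup>+s. 
      (\<integral>\<^sup>+y. indicator {1..2::real} s * (indicator {y. 1/2 \<le> norm y \<and> norm y < 2} y * K y * \<Phi> (s *\<^sub>R y)) \<partial>lborel) \<partial>lborel)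
    = (\<integral>\<^sup>+y. 
      (\<integral>\<^sup>+s. indicator {1..2::real} s * (indicator {y. 1/2 \<le> norm y \<and> norm y < 2} y * K y * \<Phi> (s *\<^sub>R y)) \<partial>lborel) \<partial>lborel)"
    by (intro lborel_pair.Fubini') measurable
  also have "\<dots> = (\<integral>\<^sup>+y. indicator {y. 1/2 \<le> norm y \<and> norm y < 2} y * K y *
        (\<integral>\<^sup>+s. indicator {1..2} s * \<Phi> (s *\<^sub>R y) \<partial>lborel) \<partial>lborel)"
  proof (intro nn_integral_cong)
    fix y
    show "(\<integral>\<^sup>+s. indicator {1..2::real} s * (indicator {y. 1/2 \<le> norm y \<and> norm y < 2} y * K y * \<Phi> (s *\<^sub>R y)) \<partial>lborel)
      = indicator {y. 1/2 \<le> norm y \<and> norm y < 2} y * K y * (\<integral>\<^sup>+s. indicator {1..2} s * \<Phi> (s *\<^sub>R y) \<partial>lborel)"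
      by (subst nn_integral_cmult[symmetric]) (auto simp: mult_ac)
  qed
  finally show ?thesis .
qed

text \<open>For general \<open>K\<close> the factor would be \<open>t\<^sup>-\<^sup>n\<close>; homogeneity of \<open>K\<close> gains one power of \<open>t\<close>.\<close>

lemma nn_integral_homogeneous_kernel_le:
  fixes K G :: "'a::euclidean_space \<Rightarrow> ennreal"
  assumes [measurable]: "K \<in> borel_measurable borel" "G \<in> borel_measurable borel"
    and hom: "\<And>c y. 0 < c \<Longrightarrow> K (c *\<^sub>R y) = K y" and t: "0 < t" "t \<le> 1"
  shows "(\<integral>\<^sup>+y. indicator {y. 1 \<le> norm y \<and> norm y < 2} y * K y *
      (\<integral>\<^sup>+z. indicator (ball 0 2) z * G ((1 - t) *\<^sub>R y + t *\<^sub>R z) \<partial>lborel) \<partial>lborel)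
    \<le> ennreal (32 * 2 ^ DIM('a) * t / t ^ DIM('a)) * (\<integral>\<^sup>+y. indicator (ball 0 2) y * K y \<partial>lborel) * (\<integral>\<^sup>+w. G w \<partial>lborel)"
    (is "?I \<le> _")
proof (cases "t \<le> 1/2")
  \<comment> \<open>Away from \<open>t = 0\<close> nothing has to be gained:
    \<open>32 * 2 ^ n * t\<close> is at least 1 here, so the bound without homogeneity
    suffices.\<close>
  case False
  have "?I \<le> ennreal (1 / t ^ DIM('a)) * (\<integral>\<^sup>+y. indicator {y. 1 \<le> norm y \<and> norm y < 2} y * K y \<partial>lborel) * (\<integral>\<^sup>+w. G w \<partial>lborel)"
    using t by (intro nn_integral_average_le) auto
  also have "\<dots> \<le> ennreal (32 * 2 ^ DIM('a) * t / t ^ DIM('a)) * (\<integral>\<^sup>+y. indicator (ball 0 2) y * K y \<partial>lborel) * (\<integral>\<^sup>+w. G w \<partial>lborel)"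
  proof (intro mult_right_mono mult_mono ennreal_leI nn_integral_mono divide_right_mono)
    have "1 * (1/2) \<le> (2::real) ^ DIM('a) * t"
      using False by (intro mult_mono) auto
    then show "1 \<le> 32 * 2 ^ DIM('a) * t" using t by linarith
  qed (use t in \<open>auto simp: indicator_def\<close>)
  finally show ?thesis .
next
  case True
  define \<Phi> where "\<Phi> y = (\<integral>\<^sup>+z. indicator (ball 0 2) z * G ((1 - t) *\<^sub>R y + t *\<^sub>R z) \<partial>lborel)" for y
  have [measurable]: "\<Phi> \<in> borel_measurable borel"
  proof -
    have "\<Phi> \<in> borel_measurable lborel"
      unfolding \<Phi>_def indicator_def mem_ball dist_norm by measurable
    then show ?thesis by simp
  qed
  have \<Phi>: "(\<integral>\<^sup>+s. indicator {1..2} s * \<Phi> (s *\<^sub>R y) \<partial>lborel) \<le> ennreal (32 * t / t ^ DIM('a)) * (\<integral>\<^sup>+w. G w \<partial>lborel)"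
    if y: "1/2 \<le> norm y" for y
  proof -
    \<comment> \<open>In the variable \<open>w\<close> the condition \<open>|z| < 2\<close> says
      that \<open>w\<close> lies within \<open>2 * t\<close> of the ray point
      \<open>(1 - t) s y\<close>, so \<open>s\<close> enters only through the centre of that
      ball.\<close>
    have eq: "\<Phi> (s *\<^sub>R y) = ennreal (1 / t ^ DIM('a)) * (\<integral>\<^sup>+w. indicator {w. norm (w - (1 - t) *\<^sub>R s *\<^sub>R y) < 2 * t} w * G w \<partial>lborel)" for s
    proof -
      have "(\<integral>\<^sup>+z. indicator {w. norm (w - (1 - t) *\<^sub>R s *\<^sub>R y) < 2 * t} ((1 - t) *\<^sub>R s *\<^sub>R y + t *\<^sub>R z) * G ((1 - t) *\<^sub>R s *\<^sub>R y + t *\<^sub>R z) \<partial>lborel)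
        = ennreal (1 / t ^ DIM('a)) * (\<integral>\<^sup>+w. indicator {w. norm (w - (1 - t) *\<^sub>R s *\<^sub>R y) < 2 * t} w * G w \<partial>lborel)"
        using t by (intro nn_integral_lborel_affine') auto
      moreover have "indicator {w. norm (w - (1 - t) *\<^sub>R s *\<^sub>R y) < 2 * t} ((1 - t) *\<^sub>R s *\<^sub>R y + t *\<^sub>R z) = (indicator (ball 0 2) z :: ennreal)" for z
        using t by (auto simp: indicator_def)
      ultimately show ?thesis unfolding \<Phi>_def by simp
    qed
    have "(\<integral>\<^sup>+s. indicator {1..2} s * \<Phi> (s *\<^sub>R y) \<partial>lborel) \<le> (\<integral>\<^sup>+s. \<Phi> (s *\<^sub>R y) \<partial>lborel)"
      by (intro nn_integral_mono) (auto simp: indicator_def)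
    also have "\<dots> = ennreal (1 / t ^ DIM('a)) * (\<integral>\<^sup>+s. (\<integral>\<^sup>+w. indicator {w. norm (w - (1 - t) *\<^sub>R s *\<^sub>R y) < 2 * t} w * G w \<partial>lborel) \<partial>lborel)"
      unfolding eq by (subst nn_integral_cmult) (auto simp: indicator_def)
    \<comment> \<open>Integrating over \<open>s\<close> first leaves the length of the set of
      dilations that bring the ray point close to \<open>w\<close>.\<close>
    also have "(\<integral>\<^sup>+s. (\<integral>\<^sup>+w. indicator {w. norm (w - (1 - t) *\<^sub>R s *\<^sub>R y) < 2 * t} w * G w \<partial>lborel) \<partial>lborel)
      = (\<integral>\<^sup>+w. (\<integral>\<^sup>+s. indicator {w. norm (w - (1 - t) *\<^sub>R s *\<^sub>R y) < 2 * t} w * G w \<partial>lborel) \<partial>lborel)"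
      unfolding indicator_def by (intro lborel_pair.Fubini') measurable
    also have "\<dots> = (\<integral>\<^sup>+w. emeasure lborel {s. norm (w - (1 - t) *\<^sub>R s *\<^sub>R y) < 2 * t} * G w \<partial>lborel)"
    proof (intro nn_integral_cong)
      fix w
      have "(\<integral>\<^sup>+s. indicator {w. norm (w - (1 - t) *\<^sub>R s *\<^sub>R y) < 2 * t} w * G w \<partial>lborel)
        = (\<integral>\<^sup>+s. G w * indicator {s. norm (w - (1 - t) *\<^sub>R s *\<^sub>R y) < 2 * t} s \<partial>lborel)"
        by (intro nn_integral_cong) (auto simp: indicator_def)
      also have "\<dots> = emeasure lborel {s. norm (w - (1 - t) *\<^sub>R s *\<^sub>R y) < 2 * t} * G w"
        by (subst nn_integral_cmult_indicator) (auto simp: mult.commute)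
      finally show "(\<integral>\<^sup>+s. indicator {w. norm (w - (1 - t) *\<^sub>R s *\<^sub>R y) < 2 * t} w * G w \<partial>lborel) = \<dots>" .
    qed
    also have "\<dots> \<le> (\<integral>\<^sup>+w. ennreal (32 * t) * G w \<partial>lborel)"
      using t True y by (intro nn_integral_mono mult_right_mono emeasure_ray_near_point) auto
    also have "\<dots> = ennreal (32 * t) * (\<integral>\<^sup>+w. G w \<partial>lborel)"
      by (simp add: nn_integral_cmult)
    finally show ?thesis
      using t by (simp add: mult.assoc[symmetric] ennreal_mult[symmetric] mult_left_mono)
  qed
  have "?I = (\<integral>\<^sup>+y. indicator {y. 1 \<le> norm y \<and> norm y < 2} y * K y * \<Phi> y \<partial>lborel)"
    unfolding \<Phi>_def ..
  also have "\<dots> \<le> ennreal (2 ^ DIM('a)) * (\<integral>\<^sup>+y. indicator {y. 1/2 \<le> norm y \<and> norm y < 2} y * K y *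
        (\<integral>\<^sup>+s. indicator {1..2} s * \<Phi> (s *\<^sub>R y) \<partial>lborel) \<partial>lborel)"
    by (intro nn_integral_homogeneous_average_le hom) auto
  also have "\<dots> \<le> ennreal (2 ^ DIM('a)) * (\<integral>\<^sup>+y. indicator (ball 0 2) y * K y *
        (ennreal (32 * t / t ^ DIM('a)) * (\<integral>\<^sup>+w. G w \<partial>lborel)) \<partial>lborel)"
    using \<Phi> by (intro mult_left_mono nn_integral_mono) (auto simp: indicator_def intro!: mult_left_mono)
  also have "\<dots> = ennreal (32 * 2 ^ DIM('a) * t / t ^ DIM('a)) * (\<integral>\<^sup>+y. indicator (ball 0 2) y * K y \<partial>lborel) * (\<integral>\<^sup>+w. G w \<partial>lborel)"
  proof -
    have "ennreal (32 * 2 ^ DIM('a) * t / t ^ DIM('a)) = ennreal (2 ^ DIM('a)) * ennreal (32 * t / t ^ DIM('a))"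
      using t by (subst ennreal_mult[symmetric]) (auto simp: mult_ac)
    then show ?thesis by (subst nn_integral_multc) (measurable, simp add: mult_ac)
  qed
  finally show ?thesis .
qed

text \<open>Everything is symmetric under exchanging \<open>y\<close> with \<open>z\<close> and
  \<open>t\<close> with \<open>1 - t\<close>. One of \<open>t\<close> and \<open>1 - t\<close> is at
  least 1/2, and substituting in the matching variable costs at most \<open>2^n\<close>, uniformly
  in \<open>t\<close>.\<close>

lemma nn_integral_ball_average_le:
  fixes G :: "'a::euclidean_space \<Rightarrow> ennreal"
  assumes [measurable]: "G \<in> borel_measurable borel" and t: "0 < t" "t < 1"
  shows "(\<integral>\<^sup>+y. indicator (ball 0 2) y * (\<integral>\<^sup>+z. indicator (ball 0 2) z * G ((1 - t) *\<^sub>R y + t *\<^sub>R z) \<partial>lborel) \<partial>lborel)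
    \<le> ennreal (2 ^ DIM('a)) * emeasure lborel (ball 0 2 :: 'a set) * (\<integral>\<^sup>+w. G w \<partial>lborel)"
    (is "?I \<le> _")
proof -
  have *: "(\<integral>\<^sup>+y. indicator (ball 0 2) y * (\<integral>\<^sup>+z. indicator (ball 0 2) z * G ((1 - t) *\<^sub>R y + t *\<^sub>R z) \<partial>lborel) \<partial>lborel)
    \<le> ennreal (2 ^ DIM('a)) * emeasure lborel (ball 0 2 :: 'a set) * (\<integral>\<^sup>+w. G w \<partial>lborel)"
    if t: "1/2 \<le> t" for t
  proof -
    have "(\<integral>\<^sup>+y. indicator (ball 0 2) y * (\<integral>\<^sup>+z. indicator (ball 0 2) z * G ((1 - t) *\<^sub>R y + t *\<^sub>R z) \<partial>lborel) \<partial>lborel)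
     \<le> ennreal (1 / t ^ DIM('a)) * (\<integral>\<^sup>+y. indicator (ball 0 2) (y::'a) \<partial>lborel) * (\<integral>\<^sup>+w. G w \<partial>lborel)"
      using t by (intro nn_integral_average_le) (auto intro!: borel_measurable_indicator)
    also have "\<dots> \<le> ennreal (2 ^ DIM('a)) * emeasure lborel (ball 0 2 :: 'a set) * (\<integral>\<^sup>+w. G w \<partial>lborel)"
    proof -
      have "1 / t ^ DIM('a) \<le> 2 ^ DIM('a)"
        using t power_mono[of "1/t" 2 "DIM('a)"] by (simp add: power_divide field_simps)
      then show ?thesis by (intro mult_mono ennreal_leI) auto
    qed
    finally show ?thesis .
  qed
  show ?thesis
  proof (cases "1/2 \<le> t")
    case False
    have "?I = (\<integral>\<^sup>+y. (\<integral>\<^sup>+z. indicator (ball 0 2) y * (indicator (ball 0 2) z * G ((1 - t) *\<^sub>R y + t *\<^sub>R z)) \<partial>lborel) \<partial>lborel)"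
      by (subst nn_integral_cmult) (auto intro!: borel_measurable_times_ennreal borel_measurable_indicator)
    also have "\<dots> = (\<integral>\<^sup>+z. (\<integral>\<^sup>+y. indicator (ball 0 2) y * (indicator (ball 0 2) z * G ((1 - t) *\<^sub>R y + t *\<^sub>R z)) \<partial>lborel) \<partial>lborel)"
      by (intro lborel_pair.Fubini') measurable
    also have "\<dots> = (\<integral>\<^sup>+z. (\<integral>\<^sup>+y. indicator (ball 0 2) z * (indicator (ball 0 2) y * G ((1 - (1 - t)) *\<^sub>R z + (1 - t) *\<^sub>R y)) \<partial>lborel) \<partial>lborel)"
      by (simp add: mult_ac add.commute)
    also have "\<dots> = (\<integral>\<^sup>+z. indicator (ball 0 2) z * (\<integral>\<^sup>+y. indicator (ball 0 2) y * G ((1 - (1 - t)) *\<^sub>R z + (1 - t) *\<^sub>R y) \<partial>lborel) \<partial>lborel)"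
      by (subst nn_integral_cmult) (auto intro!: borel_measurable_times_ennreal borel_measurable_indicator)
    also have "\<dots> \<le> ennreal (2 ^ DIM('a)) * emeasure lborel (ball 0 2 :: 'a set) * (\<integral>\<^sup>+w. G w \<partial>lborel)"
      using False by (intro *) auto
    finally show ?thesis .
  qed (use * in auto)
qed

text \<open>A Young inequality with a crude constant: every base is at most the sum, and the
  exponents add up to 1.\<close>

lemma powr_product_le_add3:
  fixes u v w \<alpha> \<beta> \<gamma> :: real
  assumes "0 \<le> u" "0 \<le> v" "0 \<le> w" "0 \<le> \<alpha>" "0 \<le> \<beta>" "0 \<le> \<gamma>" "\<alpha> + \<beta> + \<gamma> = 1"
  shows "u powr \<alpha> * v powr \<beta> * w powr \<gamma> \<le> u + v + w"
proof -
  let ?m = "u + v + w"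
  have "u powr \<alpha> * v powr \<beta> * w powr \<gamma> \<le> ?m powr \<alpha> * ?m powr \<beta> * ?m powr \<gamma>"
    using assms by (intro mult_mono powr_mono2) auto
  also have "\<dots> = ?m"
    using assms by (simp add: powr_add[symmetric] powr_one)
  finally show ?thesis .
qed

lemma nn_integral_powr_0_1:
  fixes a :: real
  assumes "-1 < a"
  shows "(\<integral>\<^sup>+t. indicator {0..1} t * ennreal (t powr a) \<partial>lborel) = ennreal (1 / (a + 1))"
proof -
  have "((\<lambda>t. t powr a) has_integral (1 powr (a + 1) / (a + 1))) {0..1::real}"
    using assms by (intro has_integral_powr_from_0) auto
  from nn_integral_has_integral_lebesgue'[OF _ this] show ?thesis
    by (simp add: mult.commute)
qed

lemma nn_integral_iterated_add:
  fixes a :: "'a \<Rightarrow> ennreal" and b :: "'b \<Rightarrow> ennreal"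
  assumes [measurable]: "a \<in> borel_measurable M" "b \<in> borel_measurable N"
    "case_prod F \<in> borel_measurable (M \<Otimes>\<^sub>M N)" "case_prod F' \<in> borel_measurable (M \<Otimes>\<^sub>M N)"
    and "sigma_finite_measure N"
  shows "(\<integral>\<^sup>+y. a y * (\<integral>\<^sup>+z. b z * (F y z + F' y z) \<partial>N) \<partial>M)
    = (\<integral>\<^sup>+y. a y * (\<integral>\<^sup>+z. b z * F y z \<partial>N) \<partial>M) + (\<integral>\<^sup>+y. a y * (\<integral>\<^sup>+z. b z * F' y z \<partial>N) \<partial>M)"
proof -
  interpret sigma_finite_measure N by fact
  have "(\<integral>\<^sup>+y. a y * (\<integral>\<^sup>+z. b z * (F y z + F' y z) \<partial>N) \<partial>M)
    = (\<integral>\<^sup>+y. a y * (\<integral>\<^sup>+z. b z * F y z \<partial>N) + a y * (\<integral>\<^sup>+z. b z * F' y z \<partial>N) \<partial>M)"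
  proof (intro nn_integral_cong)
    fix y assume [measurable]: "y \<in> space M"
    have "(\<integral>\<^sup>+z. b z * (F y z + F' y z) \<partial>N) = (\<integral>\<^sup>+z. b z * F y z \<partial>N) + (\<integral>\<^sup>+z. b z * F' y z \<partial>N)"
      unfolding distrib_left by (intro nn_integral_add) measurable
    then show "a y * (\<integral>\<^sup>+z. b z * (F y z + F' y z) \<partial>N) =
      a y * (\<integral>\<^sup>+z. b z * F y z \<partial>N) + a y * (\<integral>\<^sup>+z. b z * F' y z \<partial>N)"
      by (simp add: distrib_left)
  qed
  also have "\<dots> = (\<integral>\<^sup>+y. a y * (\<integral>\<^sup>+z. b z * F y z \<partial>N) \<partial>M) + (\<integral>\<^sup>+y. a y * (\<integral>\<^sup>+z. b z * F' y z \<partial>N) \<partial>M)"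
    by (intro nn_integral_add) measurable
  finally show ?thesis .
qed

lemma nn_integral_iterated_cmult:
  fixes a :: "'a \<Rightarrow> ennreal" and b :: "'b \<Rightarrow> ennreal"
  assumes [measurable]: "a \<in> borel_measurable M" "b \<in> borel_measurable N"
    "case_prod F \<in> borel_measurable (M \<Otimes>\<^sub>M N)" "f \<in> borel_measurable M"
    and "sigma_finite_measure N"
  shows "(\<integral>\<^sup>+y. a y * (\<integral>\<^sup>+z. b z * (c * (f y * F y z)) \<partial>N) \<partial>M)
    = c * (\<integral>\<^sup>+y. a y * f y * (\<integral>\<^sup>+z. b z * F y z \<partial>N) \<partial>M)"
proof -
  interpret sigma_finite_measure N by fact
  have "(\<integral>\<^sup>+y. a y * (\<integral>\<^sup>+z. b z * (c * (f y * F y z)) \<partial>N) \<partial>M)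
    = (\<integral>\<^sup>+y. c * (a y * f y * (\<integral>\<^sup>+z. b z * F y z \<partial>N)) \<partial>M)"
  proof (intro nn_integral_cong)
    fix y assume [measurable]: "y \<in> space M"
    have "(\<integral>\<^sup>+z. b z * (c * (f y * F y z)) \<partial>N) = (\<integral>\<^sup>+z. (c * f y) * (b z * F y z) \<partial>N)"
      by (simp add: mult_ac)
    also have "\<dots> = (c * f y) * (\<integral>\<^sup>+z. b z * F y z \<partial>N)"
      by (intro nn_integral_cmult) measurable
    finally show "a y * (\<integral>\<^sup>+z. b z * (c * (f y * F y z)) \<partial>N) = c * (a y * f y * (\<integral>\<^sup>+z. b z * F y z \<partial>N))"
      by (simp add: mult_ac)
  qed
  also have "\<dots> = c * (\<integral>\<^sup>+y. a y * f y * (\<integral>\<^sup>+z. b z * F y z \<partial>N) \<partial>M)"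
    by (intro nn_integral_cmult) measurable
  finally show ?thesis .
qed

text \<open>The exponent \<open>1/n - 1\<close> of \<open>t\<close> is integrable on \<open>(0, 1)\<close>; without the homogeneity of \<open>H\<close> it would be
  the critical \<open>-1\<close>. The integrand \<open>H g\<close> is split as \<open>u\<^sup>\<alpha> v\<^sup>\<beta> v'\<^sup>\<gamma>\<close> with \<open>\<alpha> + \<beta> + \<gamma> = 1\<close>, where
  \<open>u\<close>, \<open>v\<close>, \<open>v'\<close> are the normalised \<open>H\<^sup>\<rho> g\<^sup>p\<close>, \<open>H\<^sup>\<rho>\<close>, \<open>g\<^sup>p\<close>.\<close>

lemma nn_integral_kernel_le:
  fixes H g :: "'a::euclidean_space \<Rightarrow> real" and \<rho> p :: real
  assumes [measurable]: "H \<in> borel_measurable borel" "g \<in> borel_measurable borel"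
    and nonneg: "\<And>y. 0 \<le> H y" "\<And>y. 0 \<le> g y"
    and hom: "\<And>c y. 0 < c \<Longrightarrow> H (c *\<^sub>R y) = H y"
    and \<rho>: "1 < \<rho>" and p: "1 < p" and exps: "1 / \<rho> + 1 / p = 1 + 1 / DIM('a)"
    and t: "0 < t" "t < 1"
    and X: "0 < X" "(\<integral>\<^sup>+y. indicator (ball 0 2) y * ennreal (H y powr \<rho>) \<partial>lborel) \<le> ennreal X"
    and Y: "0 < Y" "(\<integral>\<^sup>+w. ennreal (g w powr p) \<partial>lborel) \<le> ennreal Y"
  shows "(\<integral>\<^sup>+y. indicator {y. 1 \<le> norm y \<and> norm y < 2} y *
      (\<integral>\<^sup>+z. indicator (ball 0 2) z * ennreal (H y * g ((1 - t) *\<^sub>R y + t *\<^sub>R z)) \<partial>lborel) \<partial>lborel)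
    \<le> ennreal ((32 * 2 ^ DIM('a) + (1 + 2 ^ DIM('a)) * measure lborel (ball 0 2 :: 'a set))
        * (t powr (1 / DIM('a) - 1) * X powr (1 / \<rho>) * Y powr (1 / p)))"
proof -
  define n where "n = DIM('a)"
  have n: "0 < n" by (simp add: n_def)
  define A where "A = {y :: 'a. 1 \<le> norm y \<and> norm y < 2}"
  have [measurable]: "A \<in> sets borel" unfolding A_def by measurable
  define B where "B = measure lborel (ball 0 2 :: 'a set)"
  have B: "emeasure lborel (ball 0 2 :: 'a set) = ennreal B" "0 \<le> B"
    using emeasure_bounded_finite[OF bounded_ball, of "0::'a" 2] unfolding B_def by (auto intro!: emeasure_eq_ennreal_measure)
  \<comment> \<open>\<open>u\<close> is the only one of the three functions in which
    \<open>H\<close> and \<open>g\<close> are coupled. Its integral would be of size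
    \<open>t powr (1 - n)\<close>, which the factor \<open>t ^ n / t\<close> in its definition
    compensates. As \<open>u\<close> enters with exponent \<open>1 / n\<close>, the power left for
    \<open>D\<close> to restore is \<open>t powr (1 / n - 1)\<close>.\<close>
  define D where "D = t powr (1 / n - 1) * X powr (1 / \<rho>) * Y powr (1 / p)"
  have D: "0 \<le> D" unfolding D_def by simp
  define u where "u y w = t ^ n / t * (H y powr \<rho> * g w powr p) / (X * Y)" for y w
  define v where "v y = H y powr \<rho> / X" for y
  define v' where "v' w = g w powr p / Y" for w
  have [measurable]: "v \<in> borel_measurable borel" "v' \<in> borel_measurable borel"
    unfolding v_def v'_def by measurable
  have nn: "0 \<le> u y w" "0 \<le> v y" "0 \<le> v' y" for y w
    using X Y t nonneg unfolding u_def v_def v'_def by auto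
  have ptw: "H y * g w \<le> D * (u y w + v y + v' w)" for y w
  \<comment> \<open>The exponents are compared through logarithms, so both values must be positive;
    otherwise the left-hand side is 0.\<close>
  proof (cases "H y = 0 \<or> g w = 0")
    case True
    then show ?thesis using D nn(1)[of y w] nn(2)[of y] nn(3)[of w] by auto
  next
    case False
    then have pos: "0 < H y" "0 < g w" using nonneg[of y] nonneg(2)[of w] by auto
    define a where "a = 1 / real n"
    define b where "b = 1 / \<rho>"
    define c where "c = 1 / p"
    have abc: "b + c = 1 + a" using exps unfolding a_def b_def c_def n_def .
    have r: "\<rho> * b = 1" "p * c = 1" using \<rho> p unfolding b_def c_def by auto
    have ln_exp: "ln (u y w) = (n - 1) * ln t + \<rho> * ln (H y) + p * ln (g w) - ln X - ln Y"
      "ln (v y) = \<rho> * ln (H y) - ln X" "ln (v' w) = p * ln (g w) - ln Y"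
      using X Y t pos n unfolding u_def v_def v'_def
      by (auto simp: ln_mult ln_div ln_powr ln_realpow algebra_simps of_nat_diff)
    have pos': "0 < u y w" "0 < v y" "0 < v' w"
      using X Y t pos unfolding u_def v_def v'_def by auto
    have na: "real n * a = 1" using n by (simp add: a_def)
    have n1: "real (n - 1) * a = 1 - a" using n na by (simp add: of_nat_diff algebra_simps)
    \<comment> \<open>By \<open>exps\<close> the exponents \<open>1/n\<close>,
      \<open>1 - 1/p\<close>, \<open>1 - 1/\<rho>\<close> of \<open>u\<close>, \<open>v\<close>,
      \<open>v'\<close> add up to 1. \<open>H\<close> then gets the exponent
      \<open>\<rho> * (1/n + 1 - 1/p) = 1\<close> and \<open>g\<close> gets
      \<open>p * (1/n + 1 - 1/\<rho>) = 1\<close>, while the powers of \<open>t\<close>,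
      \<open>X\<close> and \<open>Y\<close> cancel against \<open>D\<close>.\<close>
    have "ln (H y * g w) = ln (D * (u y w powr a * v y powr (1 - c) * v' w powr (1 - b)))"
    proof -
      have "ln (D * (u y w powr a * v y powr (1 - c) * v' w powr (1 - b))) =
        (a - 1) * ln t + b * ln X + c * ln Y + a * ((n - 1) * ln t + \<rho> * ln (H y) + p * ln (g w) - ln X - ln Y)
         + (1 - c) * (\<rho> * ln (H y) - ln X) + (1 - b) * (p * ln (g w) - ln Y)"
        using pos' X Y t unfolding D_def ln_exp[symmetric] a_def[symmetric] b_def[symmetric] c_def[symmetric]
        by (simp add: ln_mult ln_powr)
      also have "\<dots> = (real (n - 1) * a + a - 1) * ln t + (\<rho> * (1 + a - c)) * ln (H y) + (p * (1 + a - b)) * ln (g w)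
          + (b + c - 1 - a) * ln X + (b + c - 1 - a) * ln Y"
        by (simp add: algebra_simps)
      also have "\<dots> = ln (H y) + ln (g w)"
      proof -
        have bc: "1 + a - c = b" "1 + a - b = c" using abc by auto
        have "\<rho> * (1 + a - c) = 1" "p * (1 + a - b) = 1" "real (n - 1) * a + a - 1 = 0" "b + c - 1 - a = 0"
          unfolding bc using r n1 abc by simp_all
        then show ?thesis by simp
      qed
      finally show ?thesis using pos by (simp add: ln_mult)
    qed
    then have "H y * g w = D * (u y w powr a * v y powr (1 - c) * v' w powr (1 - b))"
      using pos pos' X Y t unfolding D_def by (subst (asm) ln_inj_iff) auto
    also have "\<dots> \<le> D * (u y w + v y + v' w)"
    proof (intro mult_left_mono powr_product_le_add3 D)
      show "a + (1 - c) + (1 - b) = 1" using abc by simp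
      show "0 \<le> 1 - c" "0 \<le> 1 - b" using \<rho> p unfolding b_def c_def by auto
    qed (use nn in \<open>auto simp: a_def\<close>)
    finally show ?thesis .
  qed
  let ?w = "\<lambda>y z. (1 - t) *\<^sub>R y + t *\<^sub>R z"
  let ?U = "\<integral>\<^sup>+y. indicator A y * (\<integral>\<^sup>+z. indicator (ball 0 2) z * ennreal (u y (?w y z)) \<partial>lborel) \<partial>lborel"
  let ?V = "\<integral>\<^sup>+y. indicator A y * (\<integral>\<^sup>+z. indicator (ball 0 2) (z::'a) * ennreal (v y) \<partial>lborel) \<partial>lborel"
  let ?W = "\<integral>\<^sup>+y. indicator A y * (\<integral>\<^sup>+z. indicator (ball 0 2) z * ennreal (v' (?w y z)) \<partial>lborel) \<partial>lborel"
  have "(\<integral>\<^sup>+y. indicator A y * (\<integral>\<^sup>+z. indicator (ball 0 2) z * ennreal (H y * g (?w y z)) \<partial>lborel) \<partial>lborel)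
     \<le> (\<integral>\<^sup>+y. indicator A y * (\<integral>\<^sup>+z. indicator (ball 0 2) z * ennreal (D * (u y (?w y z) + v y + v' (?w y z))) \<partial>lborel) \<partial>lborel)"
    by (intro nn_integral_mono mult_left_mono ennreal_leI ptw) auto
  also have "\<dots> = (\<integral>\<^sup>+y. indicator A y * (\<integral>\<^sup>+z. indicator (ball 0 2) z *
      (ennreal D * (1 * (ennreal (u y (?w y z)) + (ennreal (v y) + ennreal (v' (?w y z)))))) \<partial>lborel) \<partial>lborel)"
    using D nn by (simp add: ennreal_mult ennreal_plus[symmetric] add.assoc del: ennreal_plus)
  also have "\<dots> = ennreal D * (\<integral>\<^sup>+y. indicator A y * (\<integral>\<^sup>+z. indicator (ball 0 2) z *
      (ennreal (u y (?w y z)) + (ennreal (v y) + ennreal (v' (?w y z)))) \<partial>lborel) \<partial>lborel)"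
    unfolding u_def by (subst nn_integral_iterated_cmult) (simp_all add: lborel.sigma_finite_measure_axioms)
  also have "\<dots> = ennreal D * (?U + (?V + ?W))"
    unfolding u_def by (subst nn_integral_iterated_add; simp add: lborel.sigma_finite_measure_axioms)+
  \<comment> \<open>Only the coupled term \<open>?U\<close> needs homogeneity. In \<open>?V\<close>
    the inner integrand is constant in \<open>z\<close>, and \<open>?W\<close> no longer contains
    \<open>H\<close>, so the symmetric ball average bounds it uniformly in \<open>t\<close>.\<close>
  also have "\<dots> \<le> ennreal D * (ennreal (32 * 2 ^ n) + (ennreal B + ennreal (2 ^ n * B)))"
  proof (intro mult_left_mono add_mono)
    define K where "K y = ennreal (H y powr \<rho>)" for y
    define G where "G w = ennreal (g w powr p)" for w
    have [measurable]: "K \<in> borel_measurable borel" "G \<in> borel_measurable borel"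
      unfolding K_def G_def by measurable
    let ?c = "t ^ n / t / (X * Y)"
    have "?U = (\<integral>\<^sup>+y. indicator A y * (\<integral>\<^sup>+z. indicator (ball 0 2) z * (ennreal ?c * (K y * G (?w y z))) \<partial>lborel) \<partial>lborel)"
      using t X Y unfolding u_def K_def G_def by (simp add: ennreal_mult[symmetric])
    also have "\<dots> = ennreal ?c * (\<integral>\<^sup>+y. indicator A y * K y * (\<integral>\<^sup>+z. indicator (ball 0 2) z * G (?w y z) \<partial>lborel) \<partial>lborel)"
      by (subst nn_integral_iterated_cmult) (simp_all add: lborel.sigma_finite_measure_axioms)
    also have "\<dots> \<le> ennreal ?c * (ennreal (32 * 2 ^ n * t / t ^ n) * ennreal X * ennreal Y)"
    proof (intro mult_left_mono)
      have "(\<integral>\<^sup>+y. indicator A y * K y * (\<integral>\<^sup>+z. indicator (ball 0 2) z * G (?w y z) \<partial>lborel) \<partial>lborel)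
        \<le> ennreal (32 * 2 ^ n * t / t ^ n) * (\<integral>\<^sup>+y. indicator (ball 0 2) y * K y \<partial>lborel) * (\<integral>\<^sup>+w. G w \<partial>lborel)"
        unfolding A_def n_def using t hom by (intro nn_integral_homogeneous_kernel_le) (auto simp: K_def)
      also have "\<dots> \<le> ennreal (32 * 2 ^ n * t / t ^ n) * ennreal X * ennreal Y"
        using X Y by (intro mult_mono) (auto simp: K_def G_def)
      finally show "(\<integral>\<^sup>+y. indicator A y * K y * (\<integral>\<^sup>+z. indicator (ball 0 2) z * G (?w y z) \<partial>lborel) \<partial>lborel) \<le> \<dots>" .
    qed auto
    also have "\<dots> = ennreal (32 * 2 ^ n)"
      using t X Y by (simp add: ennreal_mult[symmetric])
    finally show "?U \<le> ennreal (32 * 2 ^ n)" .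

    have "?V = (\<integral>\<^sup>+y. indicator A y * (\<integral>\<^sup>+z. indicator (ball 0 2) (z::'a) * (ennreal (1 / X) * (K y * 1)) \<partial>lborel) \<partial>(lborel::'a measure))"
      using X unfolding v_def K_def by (simp add: ennreal_mult[symmetric])
    also have "\<dots> = ennreal (1 / X) * (\<integral>\<^sup>+y. indicator A y * K y * (\<integral>\<^sup>+z. indicator (ball 0 2) (z::'a) * 1 \<partial>lborel) \<partial>lborel)"
      by (subst nn_integral_iterated_cmult) (simp_all add: lborel.sigma_finite_measure_axioms)
    also have "\<dots> = ennreal (1 / X) * ((\<integral>\<^sup>+y. indicator A y * K y \<partial>lborel) * ennreal B)"
      by (simp add: B nn_integral_multc)
    also have "\<dots> \<le> ennreal (1 / X) * (ennreal X * ennreal B)"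
    proof (intro mult_left_mono mult_right_mono)
      have "(\<integral>\<^sup>+y. indicator A y * K y \<partial>lborel) \<le> (\<integral>\<^sup>+y. indicator (ball 0 2) y * K y \<partial>lborel)"
        by (intro nn_integral_mono) (auto simp: A_def indicator_def)
      then show "(\<integral>\<^sup>+y. indicator A y * K y \<partial>lborel) \<le> ennreal X"
        using X by (auto simp: K_def)
    qed auto
    also have "\<dots> = ennreal B"
      using X B by (simp add: ennreal_mult[symmetric])
    finally show "?V \<le> ennreal B" .

    have "?W = (\<integral>\<^sup>+y. indicator A y * (\<integral>\<^sup>+z. indicator (ball 0 2) z * (ennreal (1 / Y) * (1 * G (?w y z))) \<partial>lborel) \<partial>lborel)"
      using Y unfolding v'_def G_def by (simp add: ennreal_mult[symmetric])
    also have "\<dots> = ennreal (1 / Y) * (\<integral>\<^sup>+y. indicator A y * (\<integral>\<^sup>+z. indicator (ball 0 2) z * G (?w y z) \<partial>lborel) \<partial>lborel)"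
      by (subst nn_integral_iterated_cmult) (simp_all add: lborel.sigma_finite_measure_axioms)
    also have "\<dots> \<le> ennreal (1 / Y) * (ennreal (2 ^ n) * ennreal B * ennreal Y)"
    proof (intro mult_left_mono)
      have "(\<integral>\<^sup>+y. indicator A y * (\<integral>\<^sup>+z. indicator (ball 0 2) z * G (?w y z) \<partial>lborel) \<partial>lborel)
        \<le> (\<integral>\<^sup>+y. indicator (ball 0 2) y * (\<integral>\<^sup>+z. indicator (ball 0 2) z * G (?w y z) \<partial>lborel) \<partial>lborel)"
        by (intro nn_integral_mono mult_right_mono) (auto simp: A_def indicator_def)
      also have "\<dots> \<le> ennreal (2 ^ n) * emeasure lborel (ball 0 2 :: 'a set) * (\<integral>\<^sup>+w. G w \<partial>lborel)"
        unfolding n_def using t by (intro nn_integral_ball_average_le) auto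
      also have "\<dots> \<le> ennreal (2 ^ n) * ennreal B * ennreal Y"
        using Y by (intro mult_mono) (auto simp: B G_def)
      finally show "(\<integral>\<^sup>+y. indicator A y * (\<integral>\<^sup>+z. indicator (ball 0 2) z * G (?w y z) \<partial>lborel) \<partial>lborel) \<le> \<dots>" .
    qed auto
    also have "\<dots> = ennreal (2 ^ n * B)"
      using Y B by (simp add: ennreal_mult[symmetric])
    finally show "?W \<le> ennreal (2 ^ n * B)" .
  qed auto
  also have "\<dots> = ennreal ((32 * 2 ^ n + (1 + 2 ^ n) * B) * D)"
    using D B by (simp add: ennreal_plus[symmetric] ennreal_mult[symmetric] algebra_simps del: ennreal_plus)
  finally show ?thesis unfolding A_def B_def D_def n_def .
qed

text \<open>Fundamental theorem of calculus along the segment, then Cauchy-Schwarz. The bound is an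
  extended nonnegative integral so that Tonelli applies to it without integrability
  conditions.\<close>

lemma ennreal_diff_le_segment_integral:
  fixes h :: "'a::euclidean_space \<Rightarrow> real"
  assumes h: "\<And>x. GDERIV h x :> D x" and D: "continuous_on UNIV D"
  shows "ennreal \<bar>h z - h y\<bar> \<le> (\<integral>\<^sup>+t. indicator {0..1} t * ennreal (norm (D ((1 - t) *\<^sub>R y + t *\<^sub>R z)) * norm (z - y)) \<partial>lborel)"
proof -
  let ?p = "\<lambda>t. (1 - t) *\<^sub>R y + t *\<^sub>R z"
  have cont: "continuous_on {0..1} (\<lambda>t. (z - y) \<bullet> D (?p t))"
    by (intro continuous_intros continuous_on_compose2[OF D]) auto
  have "(\<integral>t. indicator {0..1} t *\<^sub>R ((z - y) \<bullet> D (?p t)) \<partial>lborel) = h (?p 1) - h (?p 0)"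
  proof (rule integral_FTC_Icc)
    fix t :: real
    have "(?p has_derivative (\<lambda>s. s *\<^sub>R (z - y))) (at t within {0..1})"
      by (auto intro!: derivative_eq_intros simp: algebra_simps)
    from diff_chain_within[OF this, of h "\<lambda>v. v \<bullet> D (?p t)"] h[of "?p t"]
    show "((\<lambda>t. h (?p t)) has_vector_derivative ((z - y) \<bullet> D (?p t))) (at t within {0..1})"
      by (auto simp: has_vector_derivative_def gderiv_def o_def intro: has_derivative_at_withinI)
  qed (use cont in auto)
  then have "ennreal \<bar>h z - h y\<bar> = ennreal (norm (\<integral>t. indicator {0..1} t *\<^sub>R ((z - y) \<bullet> D (?p t)) \<partial>lborel))"
    by simp
  also have "\<dots> \<le> (\<integral>\<^sup>+t. ennreal (norm (indicator {0..1} t *\<^sub>R ((z - y) \<bullet> D (?p t)))) \<partial>lborel)"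
    using borel_integrable_compact[OF _ cont] by (intro integral_norm_bound_ennreal) auto
  also have "\<dots> \<le> (\<integral>\<^sup>+t. indicator {0..1} t * ennreal (norm (D (?p t)) * norm (z - y)) \<partial>lborel)"
  proof (intro nn_integral_mono)
    fix t
    show "ennreal (norm (indicator {0..1} t *\<^sub>R ((z - y) \<bullet> D (?p t)))) \<le> indicator {0..1} t * ennreal (norm (D (?p t)) * norm (z - y))"
      using Cauchy_Schwarz_ineq2[of "z - y" "D (?p t)"] by (auto simp: indicator_def mult.commute intro!: ennreal_leI)
  qed
  finally show ?thesis .
qed

subsection \<open>The unit annulus\<close>

text \<open>The oscillation is bounded by the integral over the segment and the integral over
  \<open>t\<close> is moved outside. The factor 4 is the diameter of \<open>ball 0 2\<close>, and
  \<open>DIM('a)\<close> is the integral of \<open>t powr (1 / n - 1)\<close> over (0, 1).\<close>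

lemma nn_integral_kernel_oscillation_le:
  fixes H :: "'a::euclidean_space \<Rightarrow> real" and h :: "'a \<Rightarrow> real" and \<rho> p :: real
  assumes [measurable]: "H \<in> borel_measurable borel"
    and nonneg: "\<And>y. 0 \<le> H y"
    and hom: "\<And>c y. 0 < c \<Longrightarrow> H (c *\<^sub>R y) = H y"
    and h: "\<And>x. GDERIV h x :> D x" and D: "continuous_on UNIV D"
    and \<rho>: "1 < \<rho>" and p: "1 < p" and exps: "1 / \<rho> + 1 / p = 1 + 1 / DIM('a)"
    and X: "0 < X" "(\<integral>\<^sup>+y. indicator (ball 0 2) y * ennreal (H y powr \<rho>) \<partial>lborel) \<le> ennreal X"
    and Y: "0 < Y" "(\<integral>\<^sup>+y. indicator (ball 0 2) y * ennreal (norm (D y) powr p) \<partial>lborel) \<le> ennreal Y"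
  shows "(\<integral>\<^sup>+y. indicator {y. 1 \<le> norm y \<and> norm y < 2} y *
      (\<integral>\<^sup>+z. indicator (ball 0 2) z * ennreal (H y * \<bar>h z - h y\<bar>) \<partial>lborel) \<partial>lborel)
    \<le> ennreal (4 * real DIM('a) * (32 * 2 ^ DIM('a) + (1 + 2 ^ DIM('a)) * measure lborel (ball 0 2 :: 'a set))
        * (X powr (1 / \<rho>) * Y powr (1 / p)))"
proof -
  define c where "c = (32 * 2 ^ DIM('a) + (1 + 2 ^ DIM('a)) * measure lborel (ball 0 2 :: 'a set))"
  have c: "0 \<le> c" unfolding c_def by simp
  define A where "A = {y :: 'a. 1 \<le> norm y \<and> norm y < 2}"
  have [measurable]: "A \<in> sets borel" unfolding A_def by measurable
  \<comment> \<open>The cutoff loses nothing, since segments between points of the ball stay in it,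
    and it allows the fixed-\<open>t\<close> bound to integrate over the whole space.\<close>
  define g where "g w = indicator (ball 0 2) w * norm (D w)" for w
  have [measurable]: "D \<in> borel_measurable borel"
    by (rule borel_measurable_continuous_onI[OF D])
  have [measurable]: "g \<in> borel_measurable borel" unfolding g_def by measurable
  let ?w = "\<lambda>t y z. (1 - t) *\<^sub>R y + t *\<^sub>R z"
  have "continuous_on UNIV h"
    using h unfolding gderiv_def
    by (meson continuous_at_imp_continuous_on has_derivative_continuous)
  then have [measurable]: "h \<in> borel_measurable borel"
    by (rule borel_measurable_continuous_onI)
  have le: "ennreal (H y * \<bar>h z - h y\<bar>) \<le> (\<integral>\<^sup>+t. indicator {0..1} t * ennreal (4 * (H y * g (?w t y z))) \<partial>lborel)"
    if y: "y \<in> ball 0 2" and z: "z \<in> ball 0 2" for y z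
  proof -
    have "ennreal (H y * \<bar>h z - h y\<bar>) = ennreal (H y) * ennreal \<bar>h z - h y\<bar>"
      using nonneg by (simp add: ennreal_mult)
    also have "\<dots> \<le> ennreal (H y) * (\<integral>\<^sup>+t. indicator {0..1} t * ennreal (norm (D (?w t y z)) * norm (z - y)) \<partial>lborel)"
      by (intro mult_left_mono ennreal_diff_le_segment_integral h D) auto
    also have "\<dots> \<le> ennreal (H y) * (\<integral>\<^sup>+t. indicator {0..1} t * ennreal (4 * g (?w t y z)) \<partial>lborel)"
    proof (rule mult_left_mono[OF nn_integral_mono])
      fix t :: real
      have "norm (D (?w t y z)) * norm (z - y) \<le> 4 * g (?w t y z)" if t: "t \<in> {0..1}"
      proof -
        have "?w t y z \<in> ball 0 2"
          using convexD_alt[OF convex_ball y z] t by simp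
        moreover have "norm (z - y) \<le> 4"
          using y z norm_triangle_ineq4[of z y] by simp
        ultimately show ?thesis
          by (simp add: g_def mult.commute mult_right_mono)
      qed
      then show "indicator {0..1} t * ennreal (norm (D (?w t y z)) * norm (z - y)) \<le> indicator {0..1} t * ennreal (4 * g (?w t y z))"
        by (auto simp: indicator_def intro: ennreal_leI)
    qed auto
    also have "\<dots> = (\<integral>\<^sup>+t. ennreal (H y) * (indicator {0..1} t * ennreal (4 * g (?w t y z))) \<partial>lborel)"
      by (intro nn_integral_cmult[symmetric]) auto
    also have "\<dots> = (\<integral>\<^sup>+t. indicator {0..1} t * ennreal (4 * (H y * g (?w t y z))) \<partial>lborel)"
      using nonneg by (simp add: ennreal_mult' mult_ac g_def)
    finally show ?thesis .
  qed
  let ?J = "\<lambda>t. \<integral>\<^sup>+y. indicator A y * (\<integral>\<^sup>+z. indicator (ball 0 2) z * ennreal (H y * g (?w t y z)) \<partial>lborel) \<partial>lborel"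
  have "(\<integral>\<^sup>+y. indicator A y * (\<integral>\<^sup>+z. indicator (ball 0 2) z * ennreal (H y * \<bar>h z - h y\<bar>) \<partial>lborel) \<partial>lborel)
    \<le> (\<integral>\<^sup>+y. indicator A y * (\<integral>\<^sup>+z. indicator (ball 0 2) z * (\<integral>\<^sup>+t. indicator {0..1} t * ennreal (4 * (H y * g (?w t y z))) \<partial>lborel) \<partial>lborel) \<partial>lborel)"
    using le by (intro nn_integral_mono) (auto simp: indicator_def A_def intro!: nn_integral_mono)
  also have "\<dots> = (\<integral>\<^sup>+y. (\<integral>\<^sup>+z. (\<integral>\<^sup>+t. indicator A y * (indicator (ball 0 2) z * (indicator {0..1} t * ennreal (4 * (H y * g (?w t y z))))) \<partial>lborel) \<partial>lborel) \<partial>lborel)"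
    by (simp add: nn_integral_cmult)
  also have "\<dots> = (\<integral>\<^sup>+y. (\<integral>\<^sup>+t. (\<integral>\<^sup>+z. indicator A y * (indicator (ball 0 2) z * (indicator {0..1} t * ennreal (4 * (H y * g (?w t y z))))) \<partial>lborel) \<partial>lborel) \<partial>lborel)"
    by (intro nn_integral_cong lborel_pair.Fubini') measurable
  also have "\<dots> = (\<integral>\<^sup>+t. (\<integral>\<^sup>+y. (\<integral>\<^sup>+z. indicator A y * (indicator (ball 0 2) z * (indicator {0..1} t * ennreal (4 * (H y * g (?w t y z))))) \<partial>lborel) \<partial>lborel) \<partial>lborel)"
    by (intro lborel_pair.Fubini') measurable
  also have "\<dots> = (\<integral>\<^sup>+t. indicator {0..1} t * (4 * ?J t) \<partial>lborel)"
  proof (intro nn_integral_cong)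
    fix t :: real
    have "(\<integral>\<^sup>+y. (\<integral>\<^sup>+z. indicator A y * (indicator (ball 0 2) z * (indicator {0..1} t * ennreal (4 * (H y * g (?w t y z))))) \<partial>lborel) \<partial>lborel)
      = (\<integral>\<^sup>+y. (\<integral>\<^sup>+z. (indicator {0..1} t * 4) * (indicator A y * (indicator (ball 0 2) z * ennreal (H y * g (?w t y z)))) \<partial>lborel) \<partial>lborel)"
    proof -
      have 4: "ennreal (4 * r) = 4 * ennreal r" for r :: real
        by (simp add: ennreal_mult')
      show ?thesis unfolding 4 by (simp add: mult_ac)
    qed
    also have "\<dots> = indicator {0..1} t * (4 * ?J t)"
      by (simp add: nn_integral_cmult mult.assoc)
    finally show "(\<integral>\<^sup>+y. (\<integral>\<^sup>+z. indicator A y * (indicator (ball 0 2) z * (indicator {0..1} t * ennreal (4 * (H y * g (?w t y z))))) \<partial>lborel) \<partial>lborel) = \<dots>" .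
  qed
  also have "\<dots> \<le> (\<integral>\<^sup>+t. indicator {0..1} t * ennreal (4 * (c * (t powr (1 / DIM('a) - 1) * X powr (1 / \<rho>) * Y powr (1 / p)))) \<partial>lborel)"
  proof (intro nn_integral_mono_AE)
    have "AE t in lborel. t \<noteq> 0 \<and> t \<noteq> (1::real)"
      using AE_lborel_singleton[of 0] AE_lborel_singleton[of 1] by eventually_elim auto
    then show "AE t in lborel. indicator {0..1} t * (4 * ?J t) \<le> indicator {0..1} t * ennreal (4 * (c * (t powr (1 / DIM('a) - 1) * X powr (1 / \<rho>) * Y powr (1 / p))))"
    proof eventually_elim
      case (elim t)
      have "?J t \<le> ennreal (c * (t powr (1 / DIM('a) - 1) * X powr (1 / \<rho>) * Y powr (1 / p)))" if t: "t \<in> {0..1}"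
        unfolding A_def c_def
      proof (intro nn_integral_kernel_le hom \<rho> p exps X Y)
        have "(\<integral>\<^sup>+w. ennreal (g w powr p) \<partial>lborel) = (\<integral>\<^sup>+y. indicator (ball 0 2) y * ennreal (norm (D y) powr p) \<partial>lborel)"
          by (intro nn_integral_cong) (auto simp: g_def indicator_def)
        then show "(\<integral>\<^sup>+w. ennreal (g w powr p) \<partial>lborel) \<le> ennreal Y" using Y by simp
      qed (use t elim nonneg in \<open>auto simp: g_def\<close>)
      then have "indicator {0..1} t * (4 * ?J t) \<le> indicator {0..1} t * (4 * ennreal (c * (t powr (1 / DIM('a) - 1) * X powr (1 / \<rho>) * Y powr (1 / p))))"
        by (auto simp: indicator_def intro: mult_left_mono)
      then show ?case by (simp add: ennreal_mult')
    qed
  qed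
  also have "\<dots> = (\<integral>\<^sup>+t. ennreal (4 * (c * (X powr (1 / \<rho>) * Y powr (1 / p)))) * (indicator {0..1} t * ennreal (t powr (1 / DIM('a) - 1))) \<partial>lborel)"
    using c by (intro nn_integral_cong) (simp add: ennreal_mult'[symmetric] mult_ac ennreal_mult''[symmetric] indicator_def)
  also have "\<dots> = ennreal (4 * (c * (X powr (1 / \<rho>) * Y powr (1 / p)))) * ennreal (1 / (1 / DIM('a) - 1 + 1))"
    by (subst nn_integral_cmult, simp, subst nn_integral_powr_0_1) auto
  also have "\<dots> = ennreal (4 * real DIM('a) * c * (X powr (1 / \<rho>) * Y powr (1 / p)))"
    using c by (simp add: ennreal_mult[symmetric] mult_ac)
  finally show ?thesis unfolding A_def c_def .
qed

text \<open>The kernel has mean zero on the annulus, so the mean \<open>m\<close> of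
  \<open>h\<close> over \<open>ball 0 2\<close> may be subtracted; \<open>|h y - m|\<close> is at
  most the average of \<open>|h z - h y|\<close> over \<open>z\<close>, whence the division by the
  volume of the ball. The outer radius \<open>b\<close> is left free up to 2 in order to cover an
  annulus cut off by the outer truncation.\<close>

lemma unit_annulus_estimate:
  fixes \<Omega> h :: "'a::euclidean_space \<Rightarrow> real" and \<rho> p :: real
  assumes [measurable]: "\<Omega> \<in> borel_measurable borel"
    and hom: "\<And>c y. 0 < c \<Longrightarrow> \<Omega> (c *\<^sub>R y) = \<Omega> y"
    and h: "\<And>x. GDERIV h x :> D x" and D: "continuous_on UNIV D"
    and \<rho>: "1 < \<rho>" and p: "1 < p" and exps: "1 / \<rho> + 1 / p = 1 + 1 / DIM('a)"
    and X: "0 < X" "(\<integral>\<^sup>+y. indicator (ball 0 2) y * ennreal (\<bar>\<Omega> y\<bar> powr \<rho>) \<partial>lborel) \<le> ennreal X"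
    and Y: "0 < Y" "(\<integral>\<^sup>+y. indicator (ball 0 2) y * ennreal (norm (D y) powr p) \<partial>lborel) \<le> ennreal Y"
    and b: "b \<le> 2"
    and int: "integrable lborel (\<lambda>y. indicator {y. 1 \<le> norm y \<and> norm y < b} y * (\<Omega> y / norm y ^ DIM('a)))"
    and zero: "(\<integral>y. indicator {y. 1 \<le> norm y \<and> norm y < b} y * (\<Omega> y / norm y ^ DIM('a)) \<partial>lborel) = 0"
  shows "\<bar>\<integral>y. indicator {y. 1 \<le> norm y \<and> norm y < b} y * (\<Omega> y / norm y ^ DIM('a) * h y) \<partial>lborel\<bar>
    \<le> 4 * real DIM('a) * (32 * 2 ^ DIM('a) / measure lborel (ball 0 2 :: 'a set) + (1 + 2 ^ DIM('a)))
        * (X powr (1 / \<rho>) * Y powr (1 / p))"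
proof -
  define A where "A = {y :: 'a. 1 \<le> norm y \<and> norm y < b}"
  have [measurable]: "A \<in> sets borel" unfolding A_def by measurable
  have AB: "A \<subseteq> {y. 1 \<le> norm y \<and> norm y < 2}" using b by (auto simp: A_def)
  define B where "B = measure lborel (ball 0 2 :: 'a set)"
  have Bpos: "0 < B" unfolding B_def using content_ball_pos[of 2 "0::'a"] by simp
  have B: "emeasure lborel (ball 0 2 :: 'a set) = ennreal B"
    using emeasure_bounded_finite[OF bounded_ball, of "0::'a" 2] unfolding B_def by (auto intro!: emeasure_eq_ennreal_measure)
  define K where "K y = \<Omega> y / norm y ^ DIM('a)" for y
  have [measurable]: "K \<in> borel_measurable borel" unfolding K_def by measurable
  have cont_h: "continuous_on UNIV h"
    using h unfolding gderiv_def
    by (meson continuous_at_imp_continuous_on has_derivative_continuous)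
  then have [measurable]: "h \<in> borel_measurable borel"
    by (rule borel_measurable_continuous_onI)
  \<comment> \<open>This bound serves integrability only and does not enter the estimate.\<close>
  obtain M where M: "\<And>y. y \<in> cball 0 2 \<Longrightarrow> \<bar>h y\<bar> \<le> M" "0 \<le> M"
  proof -
    have "bounded (h ` cball 0 2)"
      by (intro compact_imp_bounded compact_continuous_image continuous_on_subset[OF cont_h]) auto
    then obtain M where "\<forall>y\<in>cball 0 2. norm (h y) \<le> M" by (auto simp: bounded_iff)
    with that[of M] show ?thesis using order_trans[OF norm_ge_zero, of "h 0" M] by auto
  qed
  have intK: "integrable lborel (\<lambda>y. indicator A y * K y)"
    using int unfolding A_def K_def .
  have inth: "integrable lborel (\<lambda>y. indicator A y * (K y * h y))"
  proof (rule Bochner_Integration.integrable_bound)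
    show "integrable lborel (\<lambda>y. M * (indicator A y * K y))"
      by (intro integrable_mult_right intK)
    show "AE y in lborel. norm (indicator A y * (K y * h y)) \<le> norm (M * (indicator A y * K y))"
    proof (intro AE_I2)
      fix y :: 'a
      have "\<bar>K y\<bar> * \<bar>h y\<bar> \<le> \<bar>K y\<bar> * \<bar>M\<bar>" if "y \<in> A"
        using that AB M(1)[of y] by (intro mult_left_mono) auto
      then show "norm (indicator A y * (K y * h y)) \<le> norm (M * (indicator A y * K y))"
        by (auto simp: indicator_def abs_mult mult.commute)
    qed
  qed measurable
  have inth_ball: "integrable lborel (\<lambda>z. indicator (ball 0 2) z *\<^sub>R h z)"
  proof (rule Bochner_Integration.integrable_bound)
    show "integrable lborel (\<lambda>z::'a. indicator (ball 0 2) z * M)"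
      using emeasure_bounded_finite[OF bounded_ball, of "0::'a" 2] by (intro integrable_mult_left) auto
  qed (use M in \<open>auto simp: indicator_def\<close>)
  have int_ball: "integrable lborel (\<lambda>z::'a. indicator (ball 0 2) z *\<^sub>R (1::real))"
    using emeasure_bounded_finite[OF bounded_ball, of "0::'a" 2] by auto
  define m where "m = (\<integral>z. indicator (ball 0 2) z *\<^sub>R h z \<partial>lborel) / B"
  have osc: "ennreal \<bar>h y - m\<bar> \<le> ennreal (1 / B) * (\<integral>\<^sup>+z. indicator (ball 0 2) z * ennreal \<bar>h z - h y\<bar> \<partial>lborel)" for y
  proof -
    have int': "integrable lborel (\<lambda>z. indicator (ball 0 2) z *\<^sub>R h z - h y * (indicator (ball 0 2) z *\<^sub>R 1))"
      using inth_ball int_ball by (intro Bochner_Integration.integrable_diff integrable_mult_right) auto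
    have "(\<integral>z. indicator (ball 0 2) z *\<^sub>R h z - h y * (indicator (ball 0 2) z *\<^sub>R 1) \<partial>lborel) = B * m - h y * B"
      using inth_ball int_ball Bpos by (subst Bochner_Integration.integral_diff) (auto simp: m_def B_def)
    also have "\<dots> = B * (m - h y)" by (simp add: algebra_simps)
    finally have eq: "m - h y = (1 / B) * (\<integral>z. indicator (ball 0 2) z *\<^sub>R h z - h y * (indicator (ball 0 2) z *\<^sub>R 1) \<partial>lborel)"
      using Bpos by simp
    have "ennreal \<bar>h y - m\<bar> = ennreal \<bar>m - h y\<bar>" by (simp add: abs_minus_commute)
    also have "\<dots> = ennreal (1 / B) * ennreal (norm (\<integral>z. indicator (ball 0 2) z *\<^sub>R h z - h y * (indicator (ball 0 2) z *\<^sub>R 1) \<partial>lborel))"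
      unfolding eq using Bpos by (simp add: ennreal_mult[symmetric] abs_mult)
    also have "\<dots> \<le> ennreal (1 / B) * (\<integral>\<^sup>+z. ennreal (norm (indicator (ball 0 2) z *\<^sub>R h z - h y * (indicator (ball 0 2) z *\<^sub>R 1))) \<partial>lborel)"
      by (intro mult_left_mono integral_norm_bound_ennreal int') auto
    also have "(\<integral>\<^sup>+z. ennreal (norm (indicator (ball 0 2) z *\<^sub>R h z - h y * (indicator (ball 0 2) z *\<^sub>R 1))) \<partial>lborel)
       = (\<integral>\<^sup>+z. indicator (ball 0 2) z * ennreal \<bar>h z - h y\<bar> \<partial>lborel)"
      by (intro nn_integral_cong) (auto simp: indicator_def)
    finally show ?thesis .
  qed
  have "(\<integral>y. indicator A y * (K y * h y) \<partial>lborel) = (\<integral>y. indicator A y * (K y * h y) \<partial>lborel) - m * (\<integral>y. indicator A y * K y \<partial>lborel)"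
    using zero unfolding A_def K_def by simp
  also have "\<dots> = (\<integral>y. indicator A y * (K y * h y) - m * (indicator A y * K y) \<partial>lborel)"
    using inth intK by (subst Bochner_Integration.integral_diff) auto
  also have "\<dots> = (\<integral>y. indicator A y * (K y * (h y - m)) \<partial>lborel)"
    by (intro Bochner_Integration.integral_cong) (auto simp: algebra_simps)
  finally have eq: "(\<integral>y. indicator A y * (K y * h y) \<partial>lborel) = (\<integral>y. indicator A y * (K y * (h y - m)) \<partial>lborel)"
    and "integrable lborel (\<lambda>y. indicator A y * (K y * h y) - m * (indicator A y * K y))"
    using inth intK by (auto intro!: Bochner_Integration.integrable_diff integrable_mult_right)
  then have int': "integrable lborel (\<lambda>y. indicator A y * (K y * (h y - m)))"
    by (simp add: algebra_simps)
  have "ennreal \<bar>\<integral>y. indicator A y * (K y * h y) \<partial>lborel\<bar> \<le> (\<integral>\<^sup>+y. ennreal (norm (indicator A y * (K y * (h y - m)))) \<partial>lborel)"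
    unfolding eq using integral_norm_bound_ennreal[OF int'] by simp
  also have "\<dots> \<le> (\<integral>\<^sup>+y. ennreal (1 / B) * (indicator {y. 1 \<le> norm y \<and> norm y < 2} y *
      (\<integral>\<^sup>+z. indicator (ball 0 2) z * ennreal (\<bar>\<Omega> y\<bar> * \<bar>h z - h y\<bar>) \<partial>lborel)) \<partial>lborel)"
  proof (intro nn_integral_mono)
    fix y
    show "ennreal (norm (indicator A y * (K y * (h y - m)))) \<le> ennreal (1 / B) * (indicator {y. 1 \<le> norm y \<and> norm y < 2} y *
      (\<integral>\<^sup>+z. indicator (ball 0 2) z * ennreal (\<bar>\<Omega> y\<bar> * \<bar>h z - h y\<bar>) \<partial>lborel))"
    proof (cases "y \<in> A")
      case True
      then have y: "1 \<le> norm y" "norm y < 2" using AB by auto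
      \<comment> \<open>Dropping the denominator leaves a kernel that is homogeneous of degree 0, as
        averaging over dilations requires.\<close>
      have "\<bar>K y\<bar> \<le> \<bar>\<Omega> y\<bar>"
        using y one_le_power[of "norm y" "DIM('a)"] unfolding K_def
        by (simp add: abs_divide divide_le_eq mult_le_cancel_left1 mult_left_le)
      then have "norm (indicator A y * (K y * (h y - m))) \<le> \<bar>\<Omega> y\<bar> * \<bar>h y - m\<bar>"
        using True by (simp add: abs_mult mult_right_mono)
      then have "ennreal (norm (indicator A y * (K y * (h y - m)))) \<le> ennreal \<bar>\<Omega> y\<bar> * ennreal \<bar>h y - m\<bar>"
        by (simp add: ennreal_mult[symmetric] ennreal_leI)
      also have "\<dots> \<le> ennreal \<bar>\<Omega> y\<bar> * (ennreal (1 / B) * (\<integral>\<^sup>+z. indicator (ball 0 2) z * ennreal \<bar>h z - h y\<bar> \<partial>lborel))"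
        by (intro mult_left_mono osc) auto
      also have "\<dots> = ennreal (1 / B) * (\<integral>\<^sup>+z. ennreal \<bar>\<Omega> y\<bar> * (indicator (ball 0 2) z * ennreal \<bar>h z - h y\<bar>) \<partial>lborel)"
        by (subst nn_integral_cmult) (auto simp: mult_ac)
      also have "\<dots> = ennreal (1 / B) * (\<integral>\<^sup>+z. indicator (ball 0 2) z * ennreal (\<bar>\<Omega> y\<bar> * \<bar>h z - h y\<bar>) \<partial>lborel)"
        by (simp add: ennreal_mult mult_ac)
      finally show ?thesis using y by simp
    qed simp
  qed
  also have "\<dots> = ennreal (1 / B) * (\<integral>\<^sup>+y. indicator {y. 1 \<le> norm y \<and> norm y < 2} y *
      (\<integral>\<^sup>+z. indicator (ball 0 2) z * ennreal (\<bar>\<Omega> y\<bar> * \<bar>h z - h y\<bar>) \<partial>lborel) \<partial>lborel)"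
    by (intro nn_integral_cmult) measurable
  also have "\<dots> \<le> ennreal (1 / B) * ennreal (4 * real DIM('a) * (32 * 2 ^ DIM('a) + (1 + 2 ^ DIM('a)) * B)
        * (X powr (1 / \<rho>) * Y powr (1 / p)))"
    unfolding B_def using hom
    by (intro mult_left_mono nn_integral_kernel_oscillation_le[OF _ _ _ h D \<rho> p exps X Y]) auto
  also have "\<dots> = ennreal (4 * real DIM('a) * (32 * 2 ^ DIM('a) / B + (1 + 2 ^ DIM('a)))
        * (X powr (1 / \<rho>) * Y powr (1 / p)))"
    using Bpos by (subst ennreal_mult[symmetric]) (auto simp: field_simps)
  finally show ?thesis
    using Bpos unfolding A_def K_def B_def by (subst (asm) ennreal_le_iff) auto
qed

subsection \<open>Polar coordinates and mean value zero\<close>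

text \<open>Dividing \<open>y\<close> by a large integer moves it into the unit ball without
  changing its direction. Away from 0 the exceptional set therefore lies in a countable union of
  dilates of one null set.\<close>

lemma AE_cone:
  fixes P :: "'a::euclidean_space \<Rightarrow> bool"
  assumes "AE y in lborel. y \<in> ball 0 1 - {0} \<longrightarrow> P (y /\<^sub>R norm y)"
  shows "AE y in lborel. y \<noteq> 0 \<longrightarrow> P (y /\<^sub>R norm y)"
proof -
  from assms obtain Z where Z: "Z \<in> null_sets lborel"
    and sub: "{y. \<not> (y \<in> ball 0 1 - {0} \<longrightarrow> P (y /\<^sub>R norm y))} \<subseteq> Z"
    unfolding eventually_ae_filter by auto
  have "AE y in lborel. (1 / real (Suc k)) *\<^sub>R y \<notin> Z" for k
  proof -
    have [measurable]: "Z \<in> sets borel" using Z by auto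
    have "(\<integral>\<^sup>+y. indicator Z (0 + (1 / real (Suc k)) *\<^sub>R y) \<partial>lborel) = 0"
      using Z by (subst nn_integral_lborel_affine') (auto simp: null_sets_def)
    then have "AE y in lborel. (indicator Z (0 + (1 / real (Suc k)) *\<^sub>R y) :: ennreal) = 0"
      by (subst (asm) nn_integral_0_iff_AE) auto
    then show ?thesis by eventually_elim (simp split: split_indicator_asm)
  qed
  then have "AE y in lborel. \<forall>k. (1 / real (Suc k)) *\<^sub>R y \<notin> Z"
    by (simp add: AE_all_countable)
  then show ?thesis
  proof eventually_elim
    case (elim y)
    show ?case
    proof
      assume y: "y \<noteq> 0"
      obtain k where k: "norm y < real (Suc k)"
      proof -
        obtain k where "norm y < real k" using reals_Archimedean2 by blast
        then have "norm y < real (Suc k)" by simp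
        then show ?thesis by (rule that)
      qed
      let ?y = "(1 / real (Suc k)) *\<^sub>R y"
      have "norm y / real (Suc k) < 1" using k by (subst divide_less_eq_1_pos) simp_all
      then have "?y \<in> ball 0 1 - {0}" using y by simp
      then have "P (?y /\<^sub>R norm ?y)" using elim[rule_format, of k] sub by blast
      moreover have "?y /\<^sub>R norm ?y = y /\<^sub>R norm y" by (simp add: divide_inverse)
      ultimately show "P (y /\<^sub>R norm y)" by (simp only:)
    qed
  qed
qed

text \<open>Provides the Borel representative that is constant along rays. The last claim is stated
  for arbitrary \<open>\<phi>\<close> so that the positive part, the negative part, the absolute
  value and the \<open>\<rho>\<close>-th power of \<open>\<Omega>\<close> are all transferred to the
  unit ball by the same representative.\<close>

lemma sphere_measure_homogeneous_extension:
  fixes \<Omega> :: "'a::euclidean_space \<Rightarrow> real"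
  assumes \<Omega>: "\<Omega> \<in> borel_measurable sphere_measure"
  obtains \<Omega>' where "\<Omega>' \<in> borel_measurable borel"
    "\<And>c y. 0 < c \<Longrightarrow> \<Omega>' (c *\<^sub>R y) = \<Omega>' y"
    "AE y in lebesgue. y \<noteq> 0 \<longrightarrow> \<Omega> (y /\<^sub>R norm y) = \<Omega>' y"
    "\<And>\<phi> :: real \<Rightarrow> ennreal. \<phi> \<in> borel_measurable borel \<Longrightarrow>
      (\<integral>\<^sup>+\<theta>. \<phi> (\<Omega> \<theta>) \<partial>sphere_measure) = of_nat DIM('a) * (\<integral>\<^sup>+y. indicator (ball 0 1) y * \<phi> (\<Omega>' y) \<partial>lborel)"
proof -
  let ?N = "restrict_space lborel (ball 0 1 - {0}) :: 'a measure"
  let ?M = "scale_measure (of_nat DIM('a)) ?N"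
  let ?S = "restrict_space borel (sphere 0 1) :: 'a measure"
  let ?dir = "\<lambda>y::'a. y /\<^sub>R norm y"
  have "?dir \<in> borel_measurable ?N"
    by (rule measurable_restrict_space1) measurable
  then have dir: "?dir \<in> measurable ?M ?S"
    by (intro measurable_restrict_space2) (auto simp: space_scale_measure space_restrict_space measurable_def)
  have sm: "sphere_measure = completion (distr ?M ?S ?dir)"
    by (simp add: sphere_measure_def)
  from completion_ex_borel_measurable_real[OF \<Omega>[unfolded sm]] obtain g where g: "g \<in> borel_measurable (distr ?M ?S ?dir)"
    and ae: "AE x in distr ?M ?S ?dir. \<Omega> x = g x"
    by blast
  have g': "g \<in> borel_measurable ?S" using g by simp
  then have [measurable]: "(\<lambda>x. indicator (sphere 0 1) x *\<^sub>R g x) \<in> borel_measurable borel"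
    by (subst (asm) borel_measurable_restrict_space_iff) auto
  \<comment> \<open>The indicator turns \<open>g\<close>, which is meaningful on the sphere only,
    into a total Borel function. At the origin, whose direction is 0 by convention, the value is
    0.\<close>
  define \<Omega>' where "\<Omega>' y = indicator (sphere 0 1) (?dir y) *\<^sub>R g (?dir y)" for y
  have \<Omega>'_eq: "\<Omega>' y = g (?dir y)" if "y \<noteq> 0" for y
    using that by (simp add: \<Omega>'_def)
  have m[measurable]: "\<Omega>' \<in> borel_measurable borel"
    unfolding \<Omega>'_def by measurable
  have "AE y in ?M. \<Omega> (?dir y) = g (?dir y)"
    by (rule AE_distrD[OF dir ae])
  then have "AE y in ?N. \<Omega> (?dir y) = g (?dir y)"
  proof -
    have "null_sets ?M = null_sets ?N" by (auto simp: null_sets_def)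
    then show ?thesis
      using \<open>AE y in ?M. \<Omega> (?dir y) = g (?dir y)\<close>
      unfolding eventually_ae_filter space_scale_measure by simp
  qed
  then have "AE y in lborel. y \<in> ball 0 1 - {0} \<longrightarrow> \<Omega> (?dir y) = g (?dir y)"
    by (subst (asm) AE_restrict_space_iff) auto
  from AE_cone[OF this] have "AE y in lebesgue. y \<noteq> 0 \<longrightarrow> \<Omega> (?dir y) = g (?dir y)"
    by (rule AE_completion)
  then have 3: "AE y in lebesgue. y \<noteq> 0 \<longrightarrow> \<Omega> (?dir y) = \<Omega>' y"
    by eventually_elim (simp add: \<Omega>'_eq)
  have 4: "(\<integral>\<^sup>+\<theta>. \<phi> (\<Omega> \<theta>) \<partial>sphere_measure) = of_nat DIM('a) * (\<integral>\<^sup>+y. indicator (ball 0 1) y * \<phi> (\<Omega>' y) \<partial>lborel)"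
    if [measurable]: "\<phi> \<in> borel_measurable borel" for \<phi> :: "real \<Rightarrow> ennreal"
  proof -
    have "(\<integral>\<^sup>+\<theta>. \<phi> (\<Omega> \<theta>) \<partial>sphere_measure) = (\<integral>\<^sup>+\<theta>. \<phi> (\<Omega> \<theta>) \<partial>distr ?M ?S ?dir)"
      unfolding sm by (rule nn_integral_completion)
    also have "\<dots> = (\<integral>\<^sup>+\<theta>. \<phi> (g \<theta>) \<partial>distr ?M ?S ?dir)"
    proof (intro nn_integral_cong_AE)
      show "AE \<theta> in distr ?M ?S ?dir. \<phi> (\<Omega> \<theta>) = \<phi> (g \<theta>)"
        using ae by eventually_elim simp
    qed
    also have "\<dots> = (\<integral>\<^sup>+y. \<phi> (g (?dir y)) \<partial>?M)"
      using g' by (intro nn_integral_distr dir) auto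
    also have "\<dots> = of_nat DIM('a) * (\<integral>\<^sup>+y. \<phi> (g (?dir y)) \<partial>?N)"
      using measurable_compose[OF dir g'] by (intro nn_integral_scale_measure) auto
    also have "(\<integral>\<^sup>+y. \<phi> (g (?dir y)) \<partial>?N) = (\<integral>\<^sup>+y. \<phi> (g (?dir y)) * indicator (ball 0 1 - {0}) y \<partial>lborel)"
      by (subst nn_integral_restrict_space) auto
    also have "\<dots> = (\<integral>\<^sup>+y. indicator (ball 0 1) y * \<phi> (\<Omega>' y) \<partial>lborel)"
    proof (intro nn_integral_cong_AE)
      show "AE y in lborel. \<phi> (g (?dir y)) * indicator (ball 0 1 - {0}) y = indicator (ball 0 1) y * \<phi> (\<Omega>' y)"
        using AE_lborel_singleton[of "0::'a"] by eventually_elim (auto simp: \<Omega>'_eq indicator_def)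
    qed
    finally show ?thesis .
  qed
  have "\<Omega>' (c *\<^sub>R y) = \<Omega>' y" if "0 < c" for c y
  proof -
    have "?dir (c *\<^sub>R y) = ?dir y" using that by (simp add: field_simps)
    then show ?thesis unfolding \<Omega>'_def by (simp only:)
  qed
  with m show ?thesis
    using 3 4 by (rule that)
qed

lemma nn_integral_homogeneous_ball:
  fixes W :: "'a::euclidean_space \<Rightarrow> ennreal"
  assumes [measurable]: "W \<in> borel_measurable borel"
    and hom: "\<And>c y. 0 < c \<Longrightarrow> W (c *\<^sub>R y) = W y" and r: "0 < r"
  shows "(\<integral>\<^sup>+y. indicator (ball 0 r) y * W y \<partial>lborel)
    = ennreal (r ^ DIM('a)) * (\<integral>\<^sup>+y. indicator (ball 0 1) y * W y \<partial>lborel)"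
proof -
  have "(\<integral>\<^sup>+y. indicator (ball 0 r) y * W y \<partial>lborel) = ennreal (\<bar>r\<bar> ^ DIM('a)) * (\<integral>\<^sup>+y. indicator (ball 0 r) (0 + r *\<^sub>R y) * W (0 + r *\<^sub>R y) \<partial>lborel)"
    using r by (intro nn_integral_lborel_affine) auto
  also have "(\<integral>\<^sup>+y. indicator (ball 0 r) (0 + r *\<^sub>R y) * W (0 + r *\<^sub>R y) \<partial>lborel) = (\<integral>\<^sup>+y. indicator (ball 0 1) y * W y \<partial>lborel)"
    using r hom by (intro nn_integral_cong) (auto simp: indicator_def)
  finally show ?thesis using r by simp
qed

text \<open>Layer cake: writing \<open>1 / |y|\<^sup>n\<close> as the integral of \<open>n / s\<^sup>n\<^sup>+\<^sup>1\<close> over \<open>s > |y|\<close> reduces the kernel weight to integrals over balls.\<close>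

lemma nn_integral_homogeneous_annulus_cong:
  fixes W W' :: "'a::euclidean_space \<Rightarrow> ennreal"
  assumes [measurable]: "W \<in> borel_measurable borel" "W' \<in> borel_measurable borel"
    and hom: "\<And>c y. 0 < c \<Longrightarrow> W (c *\<^sub>R y) = W y" "\<And>c y. 0 < c \<Longrightarrow> W' (c *\<^sub>R y) = W' y"
    and eq: "(\<integral>\<^sup>+y. indicator (ball 0 1) y * W y \<partial>lborel) = (\<integral>\<^sup>+y. indicator (ball 0 1) y * W' y \<partial>lborel)"
    and fin: "(\<integral>\<^sup>+y. indicator (ball 0 1) y * W y \<partial>lborel) < \<infinity>"
  shows "(\<integral>\<^sup>+y. indicator {y. 1 \<le> norm y \<and> norm y < b} y * W y * ennreal (1 / norm y ^ DIM('a)) \<partial>lborel)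
    = (\<integral>\<^sup>+y. indicator {y. 1 \<le> norm y \<and> norm y < b} y * W' y * ennreal (1 / norm y ^ DIM('a)) \<partial>lborel)"
proof -
  let ?I = "\<integral>\<^sup>+y. indicator (ball 0 1) y * W y \<partial>lborel"
  let ?n = "DIM('a)"
  have split: "(\<integral>\<^sup>+y. indicator {y. 1 \<le> norm y \<and> norm y < r} y * V y \<partial>lborel) + (\<integral>\<^sup>+y. indicator (ball 0 1) y * V y \<partial>lborel)
     = (\<integral>\<^sup>+y. indicator (ball 0 r) y * V y \<partial>lborel)"
    if "1 \<le> r" and [measurable]: "V \<in> borel_measurable borel" for r and V :: "'a \<Rightarrow> ennreal"
  proof -
    have "(\<integral>\<^sup>+y. indicator {y. 1 \<le> norm y \<and> norm y < r} y * V y \<partial>lborel) + (\<integral>\<^sup>+y. indicator (ball 0 1) y * V y \<partial>lborel)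
      = (\<integral>\<^sup>+y. indicator {y. 1 \<le> norm y \<and> norm y < r} y * V y + indicator (ball 0 1) y * V y \<partial>lborel)"
      by (intro nn_integral_add[symmetric]) measurable
    also have "\<dots> = (\<integral>\<^sup>+y. indicator (ball 0 r) y * V y \<partial>lborel)"
      using that by (intro nn_integral_cong) (auto simp: indicator_def)
    finally show ?thesis .
  qed
  \<comment> \<open>By homogeneity the integrals agree over all balls around 0; the unit ball may be
    subtracted because its integral is finite.\<close>
  have annulus: "(\<integral>\<^sup>+y. indicator {y. 1 \<le> norm y \<and> norm y < r} y * W y \<partial>lborel)
    = (\<integral>\<^sup>+y. indicator {y. 1 \<le> norm y \<and> norm y < r} y * W' y \<partial>lborel)" for r
  proof (cases "1 \<le> r")
    case True
    have "(\<integral>\<^sup>+y. indicator (ball 0 r) y * W y \<partial>lborel) = (\<integral>\<^sup>+y. indicator (ball 0 r) y * W' y \<partial>lborel)"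
      using True by (subst (1 2) nn_integral_homogeneous_ball) (simp_all add: hom eq)
    then have "(\<integral>\<^sup>+y. indicator {y. 1 \<le> norm y \<and> norm y < r} y * W y \<partial>lborel) + ?I
       = (\<integral>\<^sup>+y. indicator {y. 1 \<le> norm y \<and> norm y < r} y * W' y \<partial>lborel) + ?I"
      using True eq split[of r W] split[of r W'] by simp
    then show ?thesis using fin by (auto simp: add.commute[of _ ?I] ennreal_add_left_cancel)
  next
    case False
    then have "{y::'a. 1 \<le> norm y \<and> norm y < r} = {}" by auto
    then show ?thesis by simp
  qed
  define k where "k s = real ?n / s ^ Suc ?n" for s :: real
  have [measurable]: "k \<in> borel_measurable borel" unfolding k_def by measurable
  have layer: "ennreal (1 / a ^ ?n) = (\<integral>\<^sup>+s. ennreal (k s) * indicator {a<..} s \<partial>lborel)" if a: "0 < a" for a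
  proof -
    have "(\<integral>\<^sup>+s. ennreal (k s) * indicator {a..} s \<partial>lborel) = ennreal (0 - (- (1 / a ^ ?n)))"
    proof (rule nn_integral_FTC_atLeast)
      fix s assume s: "a \<le> s"
      then have "0 < s" using a by simp
      then show "DERIV (\<lambda>s. - (1 / s ^ ?n)) s :> k s"
      proof -
        obtain m where m: "?n = Suc m" using DIM_positive[where 'a='a] gr0_implies_Suc by blast
        have "((\<lambda>s. - (1 / s ^ ?n)) has_real_derivative (real ?n * s ^ m) / (s ^ ?n * s ^ ?n)) (at s)"
          using \<open>0 < s\<close> unfolding m by (auto intro!: derivative_eq_intros simp del: power_Suc)
        also have "(real ?n * s ^ m) / (s ^ ?n * s ^ ?n) = k s"
          using \<open>0 < s\<close> unfolding k_def m by simp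
        finally show ?thesis .
      qed
      show "0 \<le> k s" using \<open>0 < s\<close> by (simp add: k_def)
    next
      have "((\<lambda>s::real. inverse (s ^ ?n)) \<longlongrightarrow> 0) at_top"
        by (intro tendsto_inverse_0_at_top filterlim_pow_at_top filterlim_ident) auto
      from tendsto_minus[OF this] show "((\<lambda>s::real. - (1 / s ^ ?n)) \<longlongrightarrow> 0) at_top"
        by (simp add: divide_inverse)
    qed auto
    also have "(\<integral>\<^sup>+s. ennreal (k s) * indicator {a..} s \<partial>lborel) = (\<integral>\<^sup>+s. ennreal (k s) * indicator {a<..} s \<partial>lborel)"
    proof (intro nn_integral_cong_AE)
      show "AE s in lborel. ennreal (k s) * indicator {a..} s = ennreal (k s) * indicator {a<..} s"
        using AE_lborel_singleton[of a] by eventually_elim (auto simp: indicator_def)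
    qed
    finally show ?thesis by simp
  qed
  \<comment> \<open>After the interchange the condition \<open>norm y < s\<close> merges with
    \<open>norm y < b\<close>, so the inner integral is again one over an unweighted
    annulus.\<close>
  have "(\<integral>\<^sup>+y. indicator {y. 1 \<le> norm y \<and> norm y < b} y * V y * ennreal (1 / norm y ^ ?n) \<partial>lborel)
    = (\<integral>\<^sup>+s. ennreal (k s) * (\<integral>\<^sup>+y. indicator {y. 1 \<le> norm y \<and> norm y < min b s} y * V y \<partial>lborel) \<partial>lborel)"
    if [measurable]: "V \<in> borel_measurable borel" for V :: "'a \<Rightarrow> ennreal"
  proof -
    have "(\<integral>\<^sup>+y. indicator {y. 1 \<le> norm y \<and> norm y < b} y * V y * ennreal (1 / norm y ^ ?n) \<partial>lborel)
      = (\<integral>\<^sup>+y. (\<integral>\<^sup>+s. (indicator {y. 1 \<le> norm y \<and> norm y < b} y * V y) * (ennreal (k s) * indicator {y. norm y < s} y) \<partial>lborel) \<partial>lborel)"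
    proof (intro nn_integral_cong)
      fix y :: 'a
      have "(\<integral>\<^sup>+s. (indicator {y. 1 \<le> norm y \<and> norm y < b} y * V y) * (ennreal (k s) * indicator {y. norm y < s} y) \<partial>lborel)
        = (\<integral>\<^sup>+s. (indicator {y. 1 \<le> norm y \<and> norm y < b} y * V y) * (ennreal (k s) * indicator {norm y<..} s) \<partial>lborel)"
        by (simp add: indicator_def)
      also have "\<dots> = (indicator {y. 1 \<le> norm y \<and> norm y < b} y * V y) * (\<integral>\<^sup>+s. ennreal (k s) * indicator {norm y<..} s \<partial>lborel)"
        by (rule nn_integral_cmult) measurable
      also have "\<dots> = indicator {y. 1 \<le> norm y \<and> norm y < b} y * V y * ennreal (1 / norm y ^ ?n)"
        using layer[of "norm y"] by (cases "y = 0") (auto simp: indicator_def)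
      finally show "indicator {y. 1 \<le> norm y \<and> norm y < b} y * V y * ennreal (1 / norm y ^ ?n)
        = (\<integral>\<^sup>+s. (indicator {y. 1 \<le> norm y \<and> norm y < b} y * V y) * (ennreal (k s) * indicator {y. norm y < s} y) \<partial>lborel)" ..
    qed
    also have "\<dots> = (\<integral>\<^sup>+s. (\<integral>\<^sup>+y. (indicator {y. 1 \<le> norm y \<and> norm y < b} y * V y) * (ennreal (k s) * indicator {y. norm y < s} y) \<partial>lborel) \<partial>lborel)"
      unfolding indicator_def by (intro lborel_pair.Fubini') measurable
    also have "\<dots> = (\<integral>\<^sup>+s. ennreal (k s) * (\<integral>\<^sup>+y. indicator {y. 1 \<le> norm y \<and> norm y < min b s} y * V y \<partial>lborel) \<partial>lborel)"
    proof (intro nn_integral_cong)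
      fix s :: real
      have "(\<integral>\<^sup>+y. (indicator {y. 1 \<le> norm y \<and> norm y < b} y * V y) * (ennreal (k s) * indicator {y. norm y < s} y) \<partial>lborel)
        = (\<integral>\<^sup>+y. ennreal (k s) * (indicator {y. 1 \<le> norm y \<and> norm y < min b s} y * V y) \<partial>lborel)"
        by (intro nn_integral_cong) (auto simp: indicator_def mult.commute)
      also have "\<dots> = ennreal (k s) * (\<integral>\<^sup>+y. indicator {y. 1 \<le> norm y \<and> norm y < min b s} y * V y \<partial>lborel)"
        by (rule nn_integral_cmult) measurable
      finally show "(\<integral>\<^sup>+y. (indicator {y. 1 \<le> norm y \<and> norm y < b} y * V y) * (ennreal (k s) * indicator {y. norm y < s} y) \<partial>lborel) = \<dots>" .
    qed
    finally show ?thesis .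
  qed
  from this[OF assms(1)] this[OF assms(2)] show ?thesis by (simp only: annulus)
qed

text \<open>The positive and the negative part of \<open>\<Omega>\<close> are both homogeneous and
  have the same integral over the unit ball, hence also the same integral against
  \<open>1 / |y|^n\<close> over the annulus. The comparison is made with extended integrals; their
  finiteness then yields integrability.\<close>

lemma annulus_kernel_mean_zero:
  fixes \<Omega> :: "'a::euclidean_space \<Rightarrow> real"
  assumes [measurable]: "\<Omega> \<in> borel_measurable borel"
    and hom: "\<And>c y. 0 < c \<Longrightarrow> \<Omega> (c *\<^sub>R y) = \<Omega> y"
    and eq: "(\<integral>\<^sup>+y. indicator (ball 0 1) y * ennreal (\<Omega> y) \<partial>lborel) = (\<integral>\<^sup>+y. indicator (ball 0 1) y * ennreal (- \<Omega> y) \<partial>lborel)"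
    and fin: "(\<integral>\<^sup>+y. indicator (ball 0 1) y * ennreal (\<Omega> y) \<partial>lborel) < \<infinity>"
  shows "integrable lborel (\<lambda>y. indicator {y. 1 \<le> norm y \<and> norm y < b} y * (\<Omega> y / norm y ^ DIM('a)))"
    and "(\<integral>y. indicator {y. 1 \<le> norm y \<and> norm y < b} y * (\<Omega> y / norm y ^ DIM('a)) \<partial>lborel) = 0"
proof -
  let ?n = "DIM('a)"
  let ?f = "\<lambda>y. indicator {y. 1 \<le> norm y \<and> norm y < b} y * (\<Omega> y / norm y ^ ?n)"
  have pos: "(\<integral>\<^sup>+y. ennreal (?f y) \<partial>lborel) = (\<integral>\<^sup>+y. indicator {y. 1 \<le> norm y \<and> norm y < b} y * ennreal (\<Omega> y) * ennreal (1 / norm y ^ ?n) \<partial>lborel)"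
    and neg: "(\<integral>\<^sup>+y. ennreal (- ?f y) \<partial>lborel) = (\<integral>\<^sup>+y. indicator {y. 1 \<le> norm y \<and> norm y < b} y * ennreal (- \<Omega> y) * ennreal (1 / norm y ^ ?n) \<partial>lborel)"
    by (auto intro!: nn_integral_cong simp: indicator_def ennreal_mult''[symmetric])
  have eq': "(\<integral>\<^sup>+y. ennreal (?f y) \<partial>lborel) = (\<integral>\<^sup>+y. ennreal (- ?f y) \<partial>lborel)"
    unfolding pos neg by (intro nn_integral_homogeneous_annulus_cong eq fin) (auto simp: hom)
  have "(\<integral>\<^sup>+y. ennreal (?f y) \<partial>lborel) \<le> (\<integral>\<^sup>+y. indicator (ball 0 (max 1 b)) y * ennreal (\<Omega> y) \<partial>lborel)"
    unfolding pos
  proof (intro nn_integral_mono)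
    fix y :: 'a
    have "ennreal (\<Omega> y) * ennreal (1 / norm y ^ ?n) \<le> ennreal (\<Omega> y) * ennreal 1" if "1 \<le> norm y"
      using that one_le_power[OF that, of ?n] by (intro mult_left_mono ennreal_leI) (auto simp: divide_le_eq)
    then show "indicator {y. 1 \<le> norm y \<and> norm y < b} y * ennreal (\<Omega> y) * ennreal (1 / norm y ^ ?n) \<le> indicator (ball 0 (max 1 b)) y * ennreal (\<Omega> y)"
      by (auto simp: indicator_def)
  qed
  also have "\<dots> < \<infinity>"
    using fin by (subst nn_integral_homogeneous_ball) (auto simp: hom ennreal_mult_less_top)
  finally have fin': "(\<integral>\<^sup>+y. ennreal (?f y) \<partial>lborel) < \<infinity>" .
  then show "integrable lborel ?f"
    using eq' unfolding real_integrable_def by auto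
  then show "(\<integral>y. ?f y \<partial>lborel) = 0"
    using eq' by (simp add: real_lebesgue_integral_def)
qed

subsection \<open>Dyadic annuli\<close>

lemma integral_lborel_affine:
  fixes f :: "'a::euclidean_space \<Rightarrow> real"
  assumes [measurable]: "f \<in> borel_measurable borel" and c: "c \<noteq> 0"
  shows "(\<integral>x. f x \<partial>lborel) = \<bar>c\<bar> ^ DIM('a) * (\<integral>x. f (t + c *\<^sub>R x) \<partial>lborel)"
  by (subst lborel_affine[OF c, of t]) (simp add: integral_density integral_distr)

text \<open>Rescaling to the unit annulus: the kernel is homogeneous of degree \<open>-n\<close> and
  absorbs the Jacobian, while the gradient of \<open>h y = f (x - a y)\<close> supplies the factor
  \<open>a\<close>. Because of the factor \<open>a ^ n\<close> in its hypothesis, \<open>Y\<close>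
  bounds, up to a dimensional constant, the average of the \<open>p\<close>-th power of the gradient
  over the ball.\<close>

lemma annulus_estimate:
  fixes \<Omega> f :: "'a::euclidean_space \<Rightarrow> real" and \<rho> p :: real
  assumes [measurable]: "\<Omega> \<in> borel_measurable borel"
    and hom: "\<And>c y. 0 < c \<Longrightarrow> \<Omega> (c *\<^sub>R y) = \<Omega> y"
    and f: "C1_function f"
    and \<rho>: "1 < \<rho>" and p: "1 < p" and exps: "1 / \<rho> + 1 / p = 1 + 1 / DIM('a)"
    and X: "0 < X" "(\<integral>\<^sup>+y. indicator (ball 0 2) y * ennreal (\<bar>\<Omega> y\<bar> powr \<rho>) \<partial>lborel) \<le> ennreal X"
    and Y: "0 < Y" "(\<integral>\<^sup>+y. indicator (ball x (2 * a)) y * ennreal (norm (gradient f y) powr p) \<partial>lborel) \<le> ennreal (a ^ DIM('a) * Y)"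
    and b: "0 < a" "b \<le> 2 * a"
    and eq: "(\<integral>\<^sup>+y. indicator (ball 0 1) y * ennreal (\<Omega> y) \<partial>lborel) = (\<integral>\<^sup>+y. indicator (ball 0 1) y * ennreal (- \<Omega> y) \<partial>lborel)"
    and fin: "(\<integral>\<^sup>+y. indicator (ball 0 1) y * ennreal (\<Omega> y) \<partial>lborel) < \<infinity>"
  shows "\<bar>\<integral>y. indicator {y. a \<le> norm y \<and> norm y < b} y * (\<Omega> y / norm y ^ DIM('a) * f (x - y)) \<partial>lborel\<bar>
    \<le> 4 * real DIM('a) * (32 * 2 ^ DIM('a) / measure lborel (ball 0 2 :: 'a set) + (1 + 2 ^ DIM('a)))
        * (X powr (1 / \<rho>) * (a * Y powr (1 / p)))"
proof -
  let ?n = "DIM('a)"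
  define h where "h y = f (x + (- a) *\<^sub>R y)" for y
  define D where "D y = (- a) *\<^sub>R gradient f (x + (- a) *\<^sub>R y)" for y
  have grad: "GDERIV f z :> gradient f z" for z
    using f GDERIV_gradient unfolding C1_function_def by blast
  have contg: "continuous_on UNIV (gradient f)"
    using f unfolding C1_function_def by blast
  then have [measurable]: "gradient f \<in> borel_measurable borel"
    by (rule borel_measurable_continuous_onI)
  have "continuous_on UNIV f"
    using grad unfolding gderiv_def
    by (meson continuous_at_imp_continuous_on has_derivative_continuous)
  then have [measurable]: "f \<in> borel_measurable borel"
    by (rule borel_measurable_continuous_onI)
  have hD: "GDERIV h y :> D y" for y
  proof -
    have "((\<lambda>y. x + (- a) *\<^sub>R y) has_derivative (\<lambda>v. (- a) *\<^sub>R v)) (at y)"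
      by (auto intro!: derivative_eq_intros)
    from diff_chain_at[OF this grad[unfolded gderiv_def]]
    show ?thesis unfolding gderiv_def h_def D_def by (simp add: o_def)
  qed
  have D: "continuous_on UNIV D"
    unfolding D_def by (intro continuous_intros continuous_on_compose2[OF contg]) auto
  have "(\<integral>y. indicator {y. a \<le> norm y \<and> norm y < b} y * (\<Omega> y / norm y ^ ?n * f (x - y)) \<partial>lborel)
    = \<bar>a\<bar> ^ ?n * (\<integral>y. indicator {y. a \<le> norm y \<and> norm y < b} (0 + a *\<^sub>R y) * (\<Omega> (0 + a *\<^sub>R y) / norm (0 + a *\<^sub>R y) ^ ?n * f (x - (0 + a *\<^sub>R y))) \<partial>lborel)"
    using b by (intro integral_lborel_affine) auto
  also have "\<dots> = (\<integral>y. \<bar>a\<bar> ^ ?n * (indicator {y. a \<le> norm y \<and> norm y < b} (0 + a *\<^sub>R y) * (\<Omega> (0 + a *\<^sub>R y) / norm (0 + a *\<^sub>R y) ^ ?n * f (x - (0 + a *\<^sub>R y)))) \<partial>lborel)"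
    by (rule integral_mult_right_zero[symmetric])
  also have "\<dots> = (\<integral>y. indicator {y. 1 \<le> norm y \<and> norm y < b / a} y * (\<Omega> y / norm y ^ ?n * h y) \<partial>lborel)"
  proof (intro Bochner_Integration.integral_cong refl)
    fix y :: 'a
    have "indicator {y. a \<le> norm y \<and> norm y < b} (0 + a *\<^sub>R y) = (indicator {y. 1 \<le> norm y \<and> norm y < b / a} y :: real)"
      using b by (auto simp: indicator_def field_simps)
    then show "\<bar>a\<bar> ^ ?n * (indicator {y. a \<le> norm y \<and> norm y < b} (0 + a *\<^sub>R y) * (\<Omega> (0 + a *\<^sub>R y) / norm (0 + a *\<^sub>R y) ^ ?n * f (x - (0 + a *\<^sub>R y))))
      = indicator {y. 1 \<le> norm y \<and> norm y < b / a} y * (\<Omega> y / norm y ^ ?n * h y)"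
      using b by (simp add: hom h_def power_mult_distrib)
  qed
  also have "\<bar>\<dots>\<bar> \<le> 4 * real ?n * (32 * 2 ^ ?n / measure lborel (ball 0 2 :: 'a set) + (1 + 2 ^ ?n))
        * (X powr (1 / \<rho>) * (a powr p * Y) powr (1 / p))"
  proof (rule unit_annulus_estimate[OF _ hom hD D \<rho> p exps X])
    show "0 < a powr p * Y" using b Y by simp
    have "(\<integral>\<^sup>+y. indicator (ball x (2 * a)) y * ennreal (norm (gradient f y) powr p) \<partial>lborel)
      = ennreal (\<bar>- a\<bar> ^ ?n) * (\<integral>\<^sup>+y. indicator (ball x (2 * a)) (x + (- a) *\<^sub>R y) * ennreal (norm (gradient f (x + (- a) *\<^sub>R y)) powr p) \<partial>lborel)"
      using b by (intro nn_integral_lborel_affine) auto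
    also have "(\<integral>\<^sup>+y. indicator (ball x (2 * a)) (x + (- a) *\<^sub>R y) * ennreal (norm (gradient f (x + (- a) *\<^sub>R y)) powr p) \<partial>lborel)
      = (\<integral>\<^sup>+y. indicator (ball 0 2) y * ennreal (norm (gradient f (x + (- a) *\<^sub>R y)) powr p) \<partial>lborel)"
      using b by (intro nn_integral_cong) (auto simp: indicator_def dist_norm)
    finally have "ennreal (a ^ ?n) * (\<integral>\<^sup>+y. indicator (ball 0 2) y * ennreal (norm (gradient f (x + (- a) *\<^sub>R y)) powr p) \<partial>lborel) \<le> ennreal (a ^ ?n) * ennreal Y"
      using Y b by (simp add: ennreal_mult[symmetric])
    then have le: "(\<integral>\<^sup>+y. indicator (ball 0 2) y * ennreal (norm (gradient f (x + (- a) *\<^sub>R y)) powr p) \<partial>lborel) \<le> ennreal Y"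
      using b by (subst (asm) ennreal_mult_le_mult_iff) auto
    have "(\<integral>\<^sup>+y. indicator (ball 0 2) y * ennreal (norm (D y) powr p) \<partial>lborel)
      = (\<integral>\<^sup>+y. ennreal (a powr p) * (indicator (ball 0 2) y * ennreal (norm (gradient f (x + (- a) *\<^sub>R y)) powr p)) \<partial>lborel)"
      using b by (intro nn_integral_cong) (auto simp: D_def powr_mult ennreal_mult indicator_def)
    also have "\<dots> = ennreal (a powr p) * (\<integral>\<^sup>+y. indicator (ball 0 2) y * ennreal (norm (gradient f (x + (- a) *\<^sub>R y)) powr p) \<partial>lborel)"
      by (intro nn_integral_cmult) measurable
    also have "\<dots> \<le> ennreal (a powr p) * ennreal Y"
      by (intro mult_left_mono le) auto
    finally show "(\<integral>\<^sup>+y. indicator (ball 0 2) y * ennreal (norm (D y) powr p) \<partial>lborel) \<le> ennreal (a powr p * Y)"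
      using b Y by (simp add: ennreal_mult)
    show "b / a \<le> 2" using b by (simp add: field_simps)
  qed (use annulus_kernel_mean_zero[OF _ hom eq fin] in auto)
  also have "(a powr p * Y) powr (1 / p) = a * Y powr (1 / p)"
    using b Y p by (simp add: powr_mult powr_powr)
  finally show ?thesis .
qed

text \<open>The entries double as long as \<open>2 ^ k * u\<close> is below 1 and then decay with
  ratio \<open>2 powr (- \<gamma>)\<close>. The summand \<open>max 0 (2 - u)\<close> is the
  induction invariant: for \<open>u < 1\<close> the first term costs at most \<open>u\<close>, the
  remaining sum starts at \<open>2 * u\<close>, and \<open>u + (2 - 2 * u) = 2 - u\<close>.\<close>

lemma sum_min_geometric_normalized:
  fixes \<gamma> u :: real
  assumes \<gamma>: "0 < \<gamma>" and u: "0 < u"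
  shows "(\<Sum>k<K. min (2 ^ k * u) ((2 ^ k * u) powr (- \<gamma>))) \<le> 1 / (1 - 2 powr (- \<gamma>)) + max 0 (2 - u)"
  using u
proof (induction K arbitrary: u)
  case 0
  have "2 powr (- \<gamma>) < 1" using \<gamma> by (simp add: powr_less_one)
  then show ?case by simp
next
  case (Suc K)
  define q where "q = 2 powr (- \<gamma>)"
  have q: "0 < q" "q < 1" using \<gamma> by (auto simp: q_def powr_less_one)
  show ?case
  proof (cases "1 \<le> u")
    case True
    have le: "min (2 ^ k * u) ((2 ^ k * u) powr (- \<gamma>)) \<le> q ^ k" for k :: nat
    proof -
      have "(2 ^ k * u) powr (- \<gamma>) \<le> (2 ^ k) powr (- \<gamma>)"
        using \<gamma> True by (intro powr_mono2') auto
      also have "\<dots> = q ^ k"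
        by (simp add: q_def powr_realpow[symmetric] powr_powr mult.commute)
      finally show ?thesis by simp
    qed
    have "(\<Sum>k<Suc K. min (2 ^ k * u) ((2 ^ k * u) powr (- \<gamma>))) \<le> (\<Sum>k<Suc K. q ^ k)"
      by (intro sum_mono le)
    also have "\<dots> = (1 - q ^ Suc K) / (1 - q)"
      using q by (subst sum_gp_strict) auto
    also have "\<dots> \<le> 1 / (1 - q)"
      using q by (intro divide_right_mono) auto
    finally show ?thesis unfolding q_def by simp
  next
    case False
    have "(\<Sum>k<Suc K. min (2 ^ k * u) ((2 ^ k * u) powr (- \<gamma>)))
      = min u (u powr (- \<gamma>)) + (\<Sum>k<K. min (2 ^ k * (2 * u)) ((2 ^ k * (2 * u)) powr (- \<gamma>)))"
      by (simp add: sum.lessThan_Suc_shift mult_ac del: sum.lessThan_Suc)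
    also have "\<dots> \<le> u + (1 / (1 - 2 powr (- \<gamma>)) + max 0 (2 - 2 * u))"
      using Suc.prems by (intro add_mono Suc.IH) auto
    also have "\<dots> \<le> 1 / (1 - 2 powr (- \<gamma>)) + max 0 (2 - u)"
      using False by auto
    finally show ?thesis .
  qed
qed

text \<open>The two entries cross at the scale \<open>r\<close> with
  \<open>r * m = r powr (- \<gamma>) * N\<close>. Measured in units of \<open>r\<close> and of the
  common value \<open>m * r\<close>, the sum is the normalised one, and \<open>m * r\<close> is the
  interpolated product on the right. The constant depends neither on the starting scale
  \<open>a\<close> nor on the number of terms.\<close>

lemma sum_min_geometric:
  fixes \<gamma> a m N :: real
  assumes \<gamma>: "0 < \<gamma>" and a: "0 < a" and m: "0 \<le> m" and N: "0 \<le> N"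
  shows "(\<Sum>k<K. min (2 ^ k * a * m) ((2 ^ k * a) powr (- \<gamma>) * N))
    \<le> (2 + 1 / (1 - 2 powr (- \<gamma>))) * (m powr (1 - 1 / (1 + \<gamma>)) * N powr (1 / (1 + \<gamma>)))"
proof (cases "m = 0 \<or> N = 0")
  case True
  then have "(\<Sum>k<K. min (2 ^ k * a * m) ((2 ^ k * a) powr (- \<gamma>) * N)) \<le> (\<Sum>k<K. 0)"
    by (intro sum_mono) (auto simp: min_le_iff_disj)
  with True show ?thesis by auto
next
  case False
  with m N have m: "0 < m" and N: "0 < N" by auto
  define \<theta> where "\<theta> = 1 / (1 + \<gamma>)"
  have \<theta>: "\<theta> * (1 + \<gamma>) = 1" using \<gamma> by (simp add: \<theta>_def)
  define r where "r = (N / m) powr \<theta>"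
  have r: "0 < r" using m N by (simp add: r_def)
  have "r * r powr \<gamma> = r powr (1 + \<gamma>)" using r by (simp add: powr_add)
  also have "\<dots> = N / m" unfolding r_def powr_powr \<theta> using m N by simp
  finally have "r powr (- \<gamma>) * N = m * r"
    using m r by (simp add: powr_minus field_simps)
  then have N_eq: "(2 ^ k * a) powr (- \<gamma>) * N = m * r * (2 ^ k * (a / r)) powr (- \<gamma>)" for k :: nat
    using a r by (simp add: powr_mult powr_divide powr_minus field_simps)
  have mr: "m * r = m powr (1 - \<theta>) * N powr \<theta>"
    using m N unfolding r_def by (simp add: powr_divide powr_diff)
  have "(\<Sum>k<K. min (2 ^ k * a * m) ((2 ^ k * a) powr (- \<gamma>) * N))
    = (\<Sum>k<K. m * r * min (2 ^ k * (a / r)) ((2 ^ k * (a / r)) powr (- \<gamma>)))"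
  proof (intro sum.cong refl)
    fix k
    show "min (2 ^ k * a * m) ((2 ^ k * a) powr (- \<gamma>) * N) = m * r * min (2 ^ k * (a / r)) ((2 ^ k * (a / r)) powr (- \<gamma>))"
      unfolding N_eq using m r by (subst min_mult_distrib_left) (auto simp: field_simps)
  qed
  also have "\<dots> = m * r * (\<Sum>k<K. min (2 ^ k * (a / r)) ((2 ^ k * (a / r)) powr (- \<gamma>)))"
    by (simp add: sum_distrib_left)
  also have "\<dots> \<le> m * r * (1 / (1 - 2 powr (- \<gamma>)) + max 0 (2 - a / r))"
    using m r a \<gamma> by (intro mult_left_mono sum_min_geometric_normalized) auto
  also have "\<dots> \<le> m * r * (2 + 1 / (1 - 2 powr (- \<gamma>)))"
    using m r a by (intro mult_left_mono) auto
  finally show ?thesis unfolding mr \<theta>_def by (simp add: mult.commute)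
qed

subsection \<open>Muckenhoupt weights\<close>

lemma nn_integral_ball_eq_0_iff:
  fixes g :: "'a::euclidean_space \<Rightarrow> real"
  assumes "g \<in> borel_measurable lebesgue"
  shows "(\<integral>\<^sup>+y\<in>ball z r. ennreal (g y) \<partial>lebesgue) = 0 \<longleftrightarrow> (AE y in lebesgue. y \<in> ball z r \<longrightarrow> g y \<le> 0)"
proof -
  have "(\<lambda>y. ennreal (g y) * indicator (ball z r) y) \<in> borel_measurable lebesgue"
    using assms by (intro borel_measurable_times_ennreal borel_measurable_indicator) auto
  then have "(\<integral>\<^sup>+y\<in>ball z r. ennreal (g y) \<partial>lebesgue) = 0 \<longleftrightarrow> (AE y in lebesgue. ennreal (g y) * indicator (ball z r) y = 0)"
    by (rule nn_integral_0_iff_AE)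
  also have "\<dots> \<longleftrightarrow> (AE y in lebesgue. y \<in> ball z r \<longrightarrow> g y \<le> 0)"
    by (intro AE_cong) (auto simp: indicator_def ennreal_eq_0_iff)
  finally show ?thesis .
qed

text \<open>Allows weighted averages over balls to be computed with real numbers. Finiteness comes
  from the compact closed ball.\<close>

lemma wmeasure_ball:
  fixes \<omega> :: "'a::euclidean_space \<Rightarrow> real"
  assumes \<omega>: "weight \<omega>" and r: "0 < r"
  shows "0 < wmeasure \<omega> (ball z r)" "wmeasure \<omega> (ball z r) < \<infinity>"
proof -
  have [measurable]: "\<omega> \<in> borel_measurable lebesgue" and pos: "\<And>x. 0 < \<omega> x"
    using \<omega> by (auto simp: weight_def)
  have "set_integrable lebesgue (cball z r) \<omega>"
    using \<omega> by (auto simp: weight_def)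
  then have "(\<integral>\<^sup>+y. ennreal (norm (indicator (cball z r) y *\<^sub>R \<omega> y)) \<partial>lebesgue) < \<infinity>"
    unfolding set_integrable_def integrable_iff_bounded by simp
  moreover have "wmeasure \<omega> (ball z r) \<le> (\<integral>\<^sup>+y. ennreal (norm (indicator (cball z r) y *\<^sub>R \<omega> y)) \<partial>lebesgue)"
    unfolding wmeasure_def by (intro nn_integral_mono) (auto simp: indicator_def pos less_imp_le intro!: ennreal_leI)
  ultimately show "wmeasure \<omega> (ball z r) < \<infinity>" by simp
  have "wmeasure \<omega> (ball z r) \<noteq> 0"
  proof
    assume "wmeasure \<omega> (ball z r) = 0"
    then have "AE y in lebesgue. y \<in> ball z r \<longrightarrow> \<omega> y \<le> 0"
      unfolding wmeasure_def by (subst (asm) nn_integral_ball_eq_0_iff) auto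
    then have "AE y in lebesgue. y \<notin> ball z r"
      by eventually_elim (use pos in \<open>auto simp: not_le[symmetric]\<close>)
    then have "emeasure lebesgue (ball z r) = 0"
      by (subst (asm) AE_iff_measurable[of "ball z r"]) auto
    then have "measure lebesgue (ball z r) = 0" by (simp add: measure_def)
    then show False using content_ball_pos[OF r, of z] by simp
  qed
  then show "0 < wmeasure \<omega> (ball z r)" by (simp add: zero_less_iff_neq_zero)
qed

lemma emeasure_lebesgue_ball:
  fixes z :: "'a::euclidean_space"
  shows "emeasure lebesgue (ball z r) = ennreal (measure lborel (ball z r))"
  using emeasure_bounded_finite[OF bounded_ball, of z r] by (simp add: emeasure_eq_ennreal_measure)

text \<open>Treats \<open>\<delta> = 1\<close> and \<open>\<delta> > 1\<close> uniformly: \<open>v\<close> is the dual weight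
  \<open>\<omega>\<^sup>-\<^sup>1\<^sup>/\<^sup>(\<^sup>\<delta>\<^sup>-\<^sup>1\<^sup>)\<close> divided by its average, and \<open>v = 1\<close> if \<open>\<delta> = 1\<close>.\<close>

lemma Muckenhoupt_dual_weight:
  fixes \<omega> :: "'a::euclidean_space \<Rightarrow> real"
  assumes \<omega>: "\<omega> \<in> Muckenhoupt \<delta>" and \<delta>: "1 \<le> \<delta>" and r: "0 < r"
  obtains E v where "0 \<le> E" "\<And>y. 0 \<le> v y" "v \<in> borel_measurable lebesgue"
    "AE y in lebesgue. y \<in> ball z r \<longrightarrow> 1 / \<omega> y \<le> E * (if \<delta> = 1 then 1 else v y powr (\<delta> - 1))"
    "(\<integral>\<^sup>+y\<in>ball z r. ennreal (v y) \<partial>lebesgue) \<le> ennreal (measure lborel (ball z r))"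
    "E * enn2real (wmeasure \<omega> (ball z r)) \<le> enn2real (Muckenhoupt_const \<delta> \<omega>) * measure lborel (ball z r)"
proof -
  have w: "weight \<omega>" and W: "Muckenhoupt_const \<delta> \<omega> < \<infinity>" using \<omega> by (auto simp: Muckenhoupt_def)
  have [measurable]: "\<omega> \<in> borel_measurable lebesgue" and pos: "\<And>x. 0 < \<omega> x"
    using w by (auto simp: weight_def)
  define V where "V = measure lborel (ball z r)"
  have V: "0 < V" "emeasure lebesgue (ball z r) = ennreal V"
    using content_ball_pos[OF r, of z] emeasure_lebesgue_ball[of z r] by (auto simp: V_def)
  define wB where "wB = enn2real (wmeasure \<omega> (ball z r))"
  have wB: "wmeasure \<omega> (ball z r) = ennreal wB" "0 < wB"
    using wmeasure_ball[OF w r, of z] by (auto simp: wB_def enn2real_positive_iff)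
  have avg: "ball_average \<omega> z r = ennreal (wB / V)"
    unfolding ball_average_def wmeasure_def[symmetric] wB V using wB V by (simp add: divide_ennreal)
  define A where "A = (if \<delta> = 1 then esssup (lebesgue_on (ball z r)) (\<lambda>y. ennreal (inverse (\<omega> y)))
      else ball_average (\<lambda>y. \<omega> y powr (- 1 / (\<delta> - 1))) z r epowr (\<delta> - 1))"
  have le: "ennreal (wB / V) * A \<le> Muckenhoupt_const \<delta> \<omega>"
    unfolding Muckenhoupt_const_def A_def avg[symmetric] using r
    by (intro SUP_upper2[of "(z, r)"]) auto
  \<comment> \<open>As the average of \<open>\<omega>\<close> is positive, finiteness of the product
    passes to the dual factor.\<close>
  have "ennreal (wB / V) * A < \<infinity>" using le W by simp
  then have "A < \<infinity>" using wB V by (auto simp: ennreal_mult_less_top)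
  then have A: "A = ennreal (enn2real A)" by simp
  have "ennreal (wB / V * enn2real A) \<le> ennreal (enn2real (Muckenhoupt_const \<delta> \<omega>))"
    using le W wB V by (subst ennreal_mult) (simp_all add: A[symmetric])
  then have "wB / V * enn2real A \<le> enn2real (Muckenhoupt_const \<delta> \<omega>)"
    by (subst (asm) ennreal_le_iff) auto
  then have last: "enn2real A * wB \<le> enn2real (Muckenhoupt_const \<delta> \<omega>) * V"
    using V by (simp add: field_simps)
  show ?thesis
  proof (cases "\<delta> = 1")
    case True
    have "AE y in lebesgue_on (ball z r). ennreal (inverse (\<omega> y)) \<le> A"
      unfolding A_def using True esssup_AE by simp
    then have "AE y in lebesgue. y \<in> ball z r \<longrightarrow> ennreal (inverse (\<omega> y)) \<le> ennreal (enn2real A)"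
      by (subst (asm) AE_restrict_space_iff) (auto simp: A[symmetric])
    then have ae: "AE y in lebesgue. y \<in> ball z r \<longrightarrow> 1 / \<omega> y \<le> enn2real A * (if \<delta> = 1 then 1 else 1 powr (\<delta> - 1))"
      by eventually_elim (auto simp: divide_inverse)
    show ?thesis
      by (rule that[of "enn2real A" "\<lambda>_. 1", OF _ _ _ ae])
         (use last V in \<open>auto simp: wB_def V_def\<close>)
  next
    case False
    define e where "e = - 1 / (\<delta> - 1)"
    define a where "a = (\<integral>\<^sup>+y\<in>ball z r. ennreal (\<omega> y powr e) \<partial>lebesgue)"
    have A_eq: "A = (a / ennreal V) epowr (\<delta> - 1)"
      unfolding A_def a_def e_def ball_average_def V using False by simp
    have "a / ennreal V \<noteq> \<infinity>" using \<open>A < \<infinity>\<close> unfolding A_eq by (auto simp: ennpowr_def)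
    then have "a < \<infinity>" using V by (auto simp: ennreal_divide_eq_top_iff less_top[symmetric])
    \<comment> \<open>The dual weight will be divided by its average, which therefore has to be
      positive.\<close>
    have "a \<noteq> 0"
    proof
      assume "a = 0"
      then have "AE y in lebesgue. y \<in> ball z r \<longrightarrow> \<omega> y powr e \<le> 0"
        unfolding a_def by (subst (asm) nn_integral_ball_eq_0_iff) auto
      then have "AE y in lebesgue. y \<in> ball z r \<longrightarrow> \<omega> y \<le> 0"
        by eventually_elim simp
      then have "wmeasure \<omega> (ball z r) = 0"
        unfolding wmeasure_def by (subst nn_integral_ball_eq_0_iff) auto
      then show False using wmeasure_ball[OF w r, of z] by simp
    qed
    define \<alpha> where "\<alpha> = enn2real a / V"
    have a: "a = ennreal (\<alpha> * V)" and \<alpha>: "0 < \<alpha>"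
      using \<open>a < \<infinity>\<close> \<open>a \<noteq> 0\<close> V by (auto simp: \<alpha>_def enn2real_positive_iff zero_less_iff_neq_zero)
    have A': "enn2real A = \<alpha> powr (\<delta> - 1)"
      unfolding A_eq a ennpowr_def using \<alpha> V by (simp add: divide_ennreal)
    define v where "v y = \<omega> y powr e / \<alpha>" for y
    \<comment> \<open>\<open>1 / \<omega>\<close> is the power \<open>\<delta> - 1\<close> of the
      dual weight; normalising by \<open>\<alpha>\<close> brings out
      \<open>\<alpha> powr (\<delta> - 1)\<close>, which is exactly \<open>A\<close>.\<close>
    have v: "1 / \<omega> y = \<alpha> powr (\<delta> - 1) * v y powr (\<delta> - 1)" for y
    proof -
      have "e * (\<delta> - 1) = - 1" using False by (simp add: e_def)
      note e = this
      have "v y powr (\<delta> - 1) = (1 / \<omega> y) / \<alpha> powr (\<delta> - 1)"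
      proof -
        have "v y powr (\<delta> - 1) = (\<omega> y powr e) powr (\<delta> - 1) / \<alpha> powr (\<delta> - 1)"
          unfolding v_def by (rule powr_divide)
        also have "(\<omega> y powr e) powr (\<delta> - 1) = 1 / \<omega> y"
          unfolding powr_powr e using pos[of y] by (simp add: powr_minus_divide)
        finally show ?thesis .
      qed
      then show ?thesis using \<alpha> by simp
    qed
    have "(\<integral>\<^sup>+y\<in>ball z r. ennreal (v y) \<partial>lebesgue) = (\<integral>\<^sup>+y. ennreal (1 / \<alpha>) * (ennreal (\<omega> y powr e) * indicator (ball z r) y) \<partial>lebesgue)"
      using \<alpha> unfolding v_def by (intro nn_integral_cong) (simp add: ennreal_mult[symmetric] mult.assoc[symmetric])
    also have "\<dots> = ennreal (1 / \<alpha>) * a"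
      unfolding a_def by (intro nn_integral_cmult borel_measurable_times_ennreal borel_measurable_indicator) auto
    also have "\<dots> = ennreal V"
      using \<alpha> V unfolding a by (simp add: ennreal_mult[symmetric])
    finally have int: "(\<integral>\<^sup>+y\<in>ball z r. ennreal (v y) \<partial>lebesgue) = ennreal V" .
    show ?thesis
    proof (rule that[of "enn2real A" v])
      show "v \<in> borel_measurable lebesgue" unfolding v_def by measurable
    qed (use False \<alpha> last int v in \<open>auto simp: A' wB_def V_def v_def\<close>)
  qed
qed

text \<open>A pointwise substitute for Hoelder: \<open>g powr p\<close> is a power of
  \<open>T' * u / \<omega>\<close>, where \<open>u\<close> is
  \<open>g powr (s * \<delta>) * \<omega>\<close> normalised to average at most 1, and
  \<open>1 / \<omega>\<close> is at most \<open>E * v powr (\<delta> - 1)\<close>. The exponents of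
  \<open>u\<close> and \<open>v\<close> add up to \<open>p / s \<le> 1\<close>, so the product is at
  most \<open>u + v + 1\<close>. Each summand has average at most 1, whence the factor 3.\<close>

lemma Muckenhoupt_average_le:
  fixes \<omega> g :: "'a::euclidean_space \<Rightarrow> real"
  assumes \<omega>: "\<omega> \<in> Muckenhoupt \<delta>" and \<delta>: "1 \<le> \<delta>" and r: "0 < r" and p: "0 < p" "p \<le> s"
    and [measurable]: "g \<in> borel_measurable lebesgue" and g: "\<And>y. 0 \<le> g y"
    and T: "0 < T" "(\<integral>\<^sup>+y\<in>ball z r. ennreal (g y powr (s * \<delta>) * \<omega> y) \<partial>lebesgue) \<le> ennreal T * wmeasure \<omega> (ball z r)"
  shows "(\<integral>\<^sup>+y\<in>ball z r. ennreal (g y powr p) \<partial>lebesgue)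
    \<le> ennreal (3 * (enn2real (Muckenhoupt_const \<delta> \<omega>) * T) powr (p / (s * \<delta>)) * measure lborel (ball z r))"
proof -
  have w: "weight \<omega>" using \<omega> by (auto simp: Muckenhoupt_def)
  have [measurable]: "\<omega> \<in> borel_measurable lebesgue" and pos: "\<And>x. 0 < \<omega> x"
    using w by (auto simp: weight_def)
  define W where "W = enn2real (Muckenhoupt_const \<delta> \<omega>)"
  define V where "V = measure lborel (ball z r)"
  have V: "0 < V" "emeasure lebesgue (ball z r) = ennreal V"
    using content_ball_pos[OF r, of z] emeasure_lebesgue_ball[of z r] by (auto simp: V_def)
  define wB where "wB = enn2real (wmeasure \<omega> (ball z r))"
  have wB: "wmeasure \<omega> (ball z r) = ennreal wB" "0 < wB"
    using wmeasure_ball[OF w r, of z] by (auto simp: wB_def enn2real_positive_iff)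
  obtain E v where E: "0 \<le> E" and v: "\<And>y. 0 \<le> v y" and [measurable]: "v \<in> borel_measurable lebesgue"
    and ae: "AE y in lebesgue. y \<in> ball z r \<longrightarrow> 1 / \<omega> y \<le> E * (if \<delta> = 1 then 1 else v y powr (\<delta> - 1))"
    and int_v: "(\<integral>\<^sup>+y\<in>ball z r. ennreal (v y) \<partial>lebesgue) \<le> ennreal V"
    and EW: "E * wB \<le> W * V"
    by (rule Muckenhoupt_dual_weight[OF \<omega> \<delta> r, where z = z, folded V_def W_def wB_def]) (rule that, assumption+)
  define P where "P = s * \<delta>"
  have P: "0 < P" "p \<le> P" using p \<delta> mult_left_mono[of 1 \<delta> s] unfolding P_def by (simp_all, linarith)
  define T' where "T' = T * wB / V"
  have T': "0 < T'" using T wB V by (simp add: T'_def)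
  define u where "u y = g y powr P * \<omega> y / T'" for y
  have u: "0 \<le> u y" for y using g pos[of y] T' by (simp add: u_def)
  have [measurable]: "u \<in> borel_measurable lebesgue" unfolding u_def by measurable
  define c where "c = (E * T') powr (p / P)"
  have c: "0 \<le> c" by (simp add: c_def)
  have ptw: "g y powr p \<le> c * (u y + v y + 1)"
    if le: "1 / \<omega> y \<le> E * (if \<delta> = 1 then 1 else v y powr (\<delta> - 1))" for y
  proof -
    define v' where "v' = (if \<delta> = 1 then 1 else v y powr (\<delta> - 1))"
    have v': "0 \<le> v'" by (simp add: v'_def)
    have "g y powr p = (g y powr P) powr (p / P)"
      using P by (simp add: powr_powr)
    also have "g y powr P = (g y powr P * \<omega> y) * (1 / \<omega> y)" using pos[of y] by simp
    also have "\<dots> = T' * u y * (1 / \<omega> y)" using T' by (simp add: u_def)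
    also have "(T' * u y * (1 / \<omega> y)) powr (p / P) \<le> (T' * u y * (E * v')) powr (p / P)"
      using le T' u[of y] p P pos[of y] unfolding v'_def by (intro powr_mono2 mult_left_mono) auto
    also have "\<dots> = c * (u y powr (p / P) * v' powr (p / P))"
      using T' u[of y] E v' unfolding c_def by (simp add: powr_mult mult_ac)
    also have "\<dots> \<le> c * (u y + v y + 1)"
    \<comment> \<open>For \<open>\<delta> = 1\<close> the factor \<open>v'\<close> is 1 by
      definition, whereas \<open>v y powr 0\<close> would be 0 where \<open>v y = 0\<close>; so this
      case is not an instance of the other.\<close>
    proof (cases "\<delta> = 1")
      case True
      have "u y powr (p / P) \<le> u y + 1"
      proof (cases "u y \<le> 1")
        case True
        then have "u y powr (p / P) \<le> 1" using u[of y] p P by (intro powr_le1) auto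
        then show ?thesis using u[of y] by linarith
      next
        case False
        then have "u y powr (p / P) \<le> u y powr 1" using p P by (intro powr_mono) auto
        then show ?thesis using False by simp
      qed
      then have "u y powr (p / P) * v' powr (p / P) \<le> u y + v y + 1"
        using True v[of y] by (simp add: v'_def)
      then show ?thesis using c by (rule mult_left_mono)
    next
      case False
      \<comment> \<open>The total exponent is \<open>\<delta> * (p / P)\<close> with
        \<open>P = s * \<delta>\<close>. The rest \<open>1 - p / s\<close> is given to the constant
        1 and is nonnegative because \<open>p \<le> s\<close>.\<close>
      have "(\<delta> - 1) * (p / P) + p / P = p / s"
        using p \<delta> by (simp add: P_def field_simps)
      moreover have "p / s \<le> 1" using p by simp
      ultimately have "u y powr (p / P) * v y powr ((\<delta> - 1) * (p / P)) * 1 powr (1 - p / s) \<le> u y + v y + 1"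
        using u[of y] v[of y] p P \<delta> by (intro powr_product_le_add3) auto
      then have "u y powr (p / P) * v' powr (p / P) \<le> u y + v y + 1"
        using False by (simp add: v'_def powr_powr)
      then show ?thesis using c by (rule mult_left_mono)
    qed
    finally show ?thesis .
  qed
  have "(\<integral>\<^sup>+y\<in>ball z r. ennreal (g y powr p) \<partial>lebesgue) \<le> (\<integral>\<^sup>+y. ennreal c *
      (ennreal (u y) * indicator (ball z r) y + (ennreal (v y) * indicator (ball z r) y + indicator (ball z r) y)) \<partial>lebesgue)"
  proof (intro nn_integral_mono_AE)
    show "AE y in lebesgue. ennreal (g y powr p) * indicator (ball z r) y \<le> ennreal c *
      (ennreal (u y) * indicator (ball z r) y + (ennreal (v y) * indicator (ball z r) y + indicator (ball z r) y))"
      using ae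
    proof eventually_elim
      case (elim y)
      show ?case
      proof (cases "y \<in> ball z r")
        case True
        have "ennreal (g y powr p) \<le> ennreal (c * (u y + (v y + 1)))"
          using ptw[of y] elim True by (intro ennreal_leI) (simp add: add.assoc)
        also have "\<dots> = ennreal c * (ennreal (u y) + (ennreal (v y) + 1))"
          using c u[of y] v[of y] by (simp add: ennreal_mult ennreal_plus)
        finally show ?thesis using True by simp
      qed simp
    qed
  qed
  also have "\<dots> = ennreal c * ((\<integral>\<^sup>+y\<in>ball z r. ennreal (u y) \<partial>lebesgue) + ((\<integral>\<^sup>+y\<in>ball z r. ennreal (v y) \<partial>lebesgue) + ennreal V))"
  proof -
    have m: "(\<lambda>y. ennreal (u y) * indicator (ball z r) y) \<in> borel_measurable lebesgue"
      "(\<lambda>y. ennreal (v y) * indicator (ball z r) y) \<in> borel_measurable lebesgue"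
      "indicator (ball z r) \<in> borel_measurable lebesgue"
      by (intro borel_measurable_times_ennreal borel_measurable_indicator; simp)+
    note m' = borel_measurable_add[OF m(2,3)] borel_measurable_add[OF m(1) borel_measurable_add[OF m(2,3)]]
    show ?thesis
      using m m' by (simp add: nn_integral_cmult nn_integral_add[OF m(1) m'(1)] nn_integral_add[OF m(2,3)] V)
  qed
  also have "\<dots> \<le> ennreal c * (ennreal V + (ennreal V + ennreal V))"
  proof (intro mult_left_mono add_mono int_v order_refl)
    have "(\<integral>\<^sup>+y\<in>ball z r. ennreal (u y) \<partial>lebesgue) = (\<integral>\<^sup>+y. ennreal (1 / T') * (ennreal (g y powr (s * \<delta>) * \<omega> y) * indicator (ball z r) y) \<partial>lebesgue)"
      using T' pos unfolding u_def P_def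
      by (intro nn_integral_cong) (simp add: ennreal_mult'[symmetric] mult.assoc[symmetric])
    also have "\<dots> = ennreal (1 / T') * (\<integral>\<^sup>+y\<in>ball z r. ennreal (g y powr (s * \<delta>) * \<omega> y) \<partial>lebesgue)"
      by (intro nn_integral_cmult borel_measurable_times_ennreal borel_measurable_indicator) auto
    also have "\<dots> \<le> ennreal (1 / T') * (ennreal T * ennreal wB)"
      using T wB by (intro mult_left_mono) auto
    also have "\<dots> = ennreal V"
      using T' T wB V by (simp add: ennreal_mult[symmetric] T'_def)
    finally show "(\<integral>\<^sup>+y\<in>ball z r. ennreal (u y) \<partial>lebesgue) \<le> ennreal V" .
  qed auto
  also have "\<dots> = ennreal (3 * c * V)"
    using c V by (simp add: ennreal_mult[symmetric] ennreal_plus[symmetric] del: ennreal_plus)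
  also have "\<dots> \<le> ennreal (3 * (W * T) powr (p / P) * V)"
  proof (intro ennreal_leI mult_right_mono mult_left_mono)
    \<comment> \<open>The average of \<open>\<omega>\<close> contained in \<open>T'\<close> pairs
      with \<open>E\<close> to form the Muckenhoupt constant.\<close>
    have "E * T' = (E * wB) * T / V" by (simp add: T'_def)
    also have "\<dots> \<le> (W * V) * T / V" using EW T V by (intro divide_right_mono mult_right_mono) auto
    finally have "E * T' \<le> W * T" using V by simp
    then show "c \<le> (W * T) powr (p / P)"
      unfolding c_def using E T' p P by (intro powr_mono2) auto
  qed (use V in auto)
  finally show ?thesis unfolding W_def V_def P_def .
qed

text \<open>If the constant were 0, the preceding estimate for the function 1 would make the unit
  ball a null set. Positivity keeps the final right-hand side infinite when the maximal function is
  infinite and the other factors are positive.\<close>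

lemma Muckenhoupt_const_pos:
  fixes \<omega> :: "'a::euclidean_space \<Rightarrow> real"
  assumes \<omega>: "\<omega> \<in> Muckenhoupt \<delta>" and \<delta>: "1 \<le> \<delta>"
  shows "0 < enn2real (Muckenhoupt_const \<delta> \<omega>)"
proof (rule ccontr)
  assume "\<not> 0 < enn2real (Muckenhoupt_const \<delta> \<omega>)"
  then have 0: "enn2real (Muckenhoupt_const \<delta> \<omega>) = 0"
    using enn2real_nonneg[of "Muckenhoupt_const \<delta> \<omega>"] by linarith
  have "(\<integral>\<^sup>+y\<in>ball (0::'a) 1. ennreal (1 powr 1) \<partial>lebesgue)
    \<le> ennreal (3 * (enn2real (Muckenhoupt_const \<delta> \<omega>) * 1) powr (1 / (1 * \<delta>)) * measure lborel (ball (0::'a) 1))"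
    using \<omega> \<delta> by (intro Muckenhoupt_average_le) (auto simp: wmeasure_def)
  then have "emeasure lebesgue (ball (0::'a) 1) = 0" using 0 by simp
  then show False using content_ball_pos[of 1 "0::'a"] by (simp add: emeasure_lebesgue_ball)
qed

subsection \<open>The pointwise estimate\<close>

text \<open>Removes the strict positivity demanded by the normalisations. Positive exponents make
  \<open>powr\<close> continuous at 0 from the right.\<close>

lemma le_powr_product_limit:
  fixes L C \<alpha> \<beta> x y :: real
  assumes le: "\<And>x' y'. x < x' \<Longrightarrow> y < y' \<Longrightarrow> L \<le> C * (x' powr \<alpha> * y' powr \<beta>)"
    and "0 \<le> x" "0 \<le> y" "0 < \<alpha>" "0 < \<beta>"
  shows "L \<le> C * (x powr \<alpha> * y powr \<beta>)"
proof (rule tendsto_lowerbound)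
  have lim: "((\<lambda>e. z + e) \<longlongrightarrow> z) (at_right 0)" for z :: real
    by (rule tendsto_eq_intros refl tendsto_ident_at)+ simp
  have ev: "\<forall>\<^sub>F e in at_right 0. 0 \<le> z + e" if "0 \<le> z" for z :: real
    using eventually_at_right_less[of 0] by eventually_elim (use that in auto)
  show "((\<lambda>e. C * ((x + e) powr \<alpha> * (y + e) powr \<beta>)) \<longlongrightarrow> C * (x powr \<alpha> * y powr \<beta>)) (at_right 0)"
    using assms by (intro tendsto_mult tendsto_const tendsto_powr' lim disjI2 conjI ev)
  show "\<forall>\<^sub>F e in at_right 0. L \<le> C * ((x + e) powr \<alpha> * (y + e) powr \<beta>)"
    using eventually_at_right_less[of 0] by eventually_elim (auto intro!: le)
qed simp

text \<open>Induction over the number of doublings, peeling off the innermost annulus and restarting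
  at \<open>2 * t\<close>. Since \<open>le\<close> also covers annuli cut short, the outermost piece
  ending at \<open>R\<close> needs no separate bound.\<close>

lemma dyadic_decomposition_le:
  fixes I :: "real \<Rightarrow> real \<Rightarrow> real" and B :: "real \<Rightarrow> real"
  assumes split: "\<And>a b c. 0 < a \<Longrightarrow> a \<le> b \<Longrightarrow> b \<le> c \<Longrightarrow> I a c = I a b + I b c"
    and empty: "\<And>a b. b \<le> a \<Longrightarrow> I a b = 0"
    and le: "\<And>a b. 0 < a \<Longrightarrow> b \<le> 2 * a \<Longrightarrow> \<bar>I a b\<bar> \<le> B a"
    and t: "0 < t" and R: "R \<le> 2 ^ K * t"
  shows "\<bar>I t R\<bar> \<le> (\<Sum>k<K. B (2 ^ k * t))"
  using t R
proof (induction K arbitrary: t)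
  case 0
  then show ?case by (simp add: empty)
next
  case (Suc K)
  \<comment> \<open>The empty annulus from \<open>a\<close> to \<open>a\<close> is an instance of
    \<open>le\<close>.\<close>
  have B: "0 \<le> B a" if "0 < a" for a
    using le[of a a] that by (simp add: empty)
  have sum: "(\<Sum>k<Suc K. B (2 ^ k * t)) = B t + (\<Sum>k<K. B (2 ^ k * (2 * t)))"
    by (simp add: sum.lessThan_Suc_shift mult_ac del: sum.lessThan_Suc)
  show ?case
  proof (cases "R \<le> 2 * t")
    case True
    have "0 \<le> (\<Sum>k<K. B (2 ^ k * (2 * t)))"
      using Suc.prems by (intro sum_nonneg B) auto
    with le[OF Suc.prems(1) True] show ?thesis unfolding sum by linarith
  next
    case False
    have "I t R = I t (2 * t) + I (2 * t) R"
      using False Suc.prems by (intro split) auto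
    moreover have "\<bar>I t (2 * t)\<bar> \<le> B t" using Suc.prems by (intro le) auto
    moreover have "\<bar>I (2 * t) R\<bar> \<le> (\<Sum>k<K. B (2 ^ k * (2 * t)))"
      using Suc.prems by (intro Suc.IH) (auto simp: mult_ac)
    ultimately show ?thesis unfolding sum by linarith
  qed
qed

text \<open>The bound involves neither \<open>t\<close> nor \<open>R\<close>, so it survives the
  upper limit in \<open>R\<close> and the supremum over \<open>t\<close>.\<close>

lemma dyadic_min_bound:
  fixes I :: "real \<Rightarrow> real \<Rightarrow> real" and \<gamma> D m N :: real
  assumes split: "\<And>a b c. 0 < a \<Longrightarrow> a \<le> b \<Longrightarrow> b \<le> c \<Longrightarrow> I a c = I a b + I b c"
    and empty: "\<And>a b. b \<le> a \<Longrightarrow> I a b = 0"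
    and le: "\<And>a b. 0 < a \<Longrightarrow> b \<le> 2 * a \<Longrightarrow> \<bar>I a b\<bar> \<le> D * min (a * m) (a powr (- \<gamma>) * N)"
    and "0 < t" "0 < \<gamma>" "0 \<le> m" "0 \<le> N" "0 \<le> D"
  shows "\<bar>I t R\<bar> \<le> D * ((2 + 1 / (1 - 2 powr (- \<gamma>))) * (m powr (1 - 1 / (1 + \<gamma>)) * N powr (1 / (1 + \<gamma>))))"
proof -
  obtain K where "R / t < 2 ^ K" using real_arch_pow[of 2 "R / t"] by auto
  then have "R \<le> 2 ^ K * t" using \<open>0 < t\<close> by (simp add: field_simps)
  with split empty le \<open>0 < t\<close> have "\<bar>I t R\<bar> \<le> (\<Sum>k<K. D * min (2 ^ k * t * m) ((2 ^ k * t) powr (- \<gamma>) * N))"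
    by (rule dyadic_decomposition_le)
  also have "\<dots> = D * (\<Sum>k<K. min (2 ^ k * t * m) ((2 ^ k * t) powr (- \<gamma>) * N))"
    by (simp add: sum_distrib_left)
  also have "\<dots> \<le> D * ((2 + 1 / (1 - 2 powr (- \<gamma>))) * (m powr (1 - 1 / (1 + \<gamma>)) * N powr (1 / (1 + \<gamma>))))"
    using assms by (intro mult_left_mono sum_min_geometric) auto
  finally show ?thesis .
qed

text \<open>Needed for additivity over adjacent annuli. The denominator is bounded below there and
  \<open>f\<close> is bounded, while homogeneity makes \<open>\<Omega>\<close> integrable over every
  ball.\<close>

lemma integrable_annulus_kernel:
  fixes \<Omega> f :: "'a::euclidean_space \<Rightarrow> real"
  assumes [measurable]: "\<Omega> \<in> borel_measurable borel"
    and hom: "\<And>c y. 0 < c \<Longrightarrow> \<Omega> (c *\<^sub>R y) = \<Omega> y"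
    and f: "continuous_on UNIV f" and a: "0 < a"
    and fin: "(\<integral>\<^sup>+y. indicator (ball 0 1) y * ennreal \<bar>\<Omega> y\<bar> \<partial>lborel) < \<infinity>"
  shows "integrable lborel (\<lambda>y. indicator {y. a \<le> norm y \<and> norm y < b} y * (\<Omega> y / norm y ^ DIM('a) * f (x - y)))"
proof (cases "0 < b")
  case b: True
  have [measurable]: "f \<in> borel_measurable borel"
    by (rule borel_measurable_continuous_onI[OF f])
  obtain M where M: "\<And>y. y \<in> cball x b \<Longrightarrow> \<bar>f y\<bar> \<le> M"
  proof -
    have "bounded (f ` cball x b)"
      by (intro compact_imp_bounded compact_continuous_image continuous_on_subset[OF f]) auto
    then obtain M where "\<forall>y\<in>cball x b. norm (f y) \<le> M" by (auto simp: bounded_iff)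
    then show ?thesis by (intro that[of M]) auto
  qed
  have "integrable lborel (\<lambda>y. indicator (ball 0 b) y * \<bar>\<Omega> y\<bar>)"
  proof (rule integrableI_bounded)
    have "(\<integral>\<^sup>+y. ennreal (norm (indicator (ball 0 b) y * \<bar>\<Omega> y\<bar>)) \<partial>lborel) = (\<integral>\<^sup>+y. indicator (ball 0 b) y * ennreal \<bar>\<Omega> y\<bar> \<partial>lborel)"
      by (intro nn_integral_cong) (auto simp: indicator_def)
    also have "\<dots> < \<infinity>"
      using fin b by (subst nn_integral_homogeneous_ball) (auto simp: hom ennreal_mult_less_top)
    finally show "(\<integral>\<^sup>+y. ennreal (norm (indicator (ball 0 b) y * \<bar>\<Omega> y\<bar>)) \<partial>lborel) < \<infinity>" .
  qed measurable
  then have "integrable lborel (\<lambda>y. (\<bar>M\<bar> / a ^ DIM('a)) * (indicator (ball 0 b) y * \<bar>\<Omega> y\<bar>))"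
    by (rule integrable_mult_right)
  then show ?thesis
  proof (rule Bochner_Integration.integrable_bound)
    show "AE y in lborel. norm (indicator {y. a \<le> norm y \<and> norm y < b} y * (\<Omega> y / norm y ^ DIM('a) * f (x - y)))
      \<le> norm ((\<bar>M\<bar> / a ^ DIM('a)) * (indicator (ball 0 b) y * \<bar>\<Omega> y\<bar>))"
    proof (intro AE_I2)
      fix y :: 'a
      have "\<bar>\<Omega> y\<bar> / norm y ^ DIM('a) * \<bar>f (x - y)\<bar> \<le> \<bar>\<Omega> y\<bar> / a ^ DIM('a) * \<bar>M\<bar>" if "a \<le> norm y" "norm y < b"
      proof (intro mult_mono divide_left_mono power_mono)
        show "0 < norm y ^ DIM('a) * a ^ DIM('a)"
          using that a by (intro mult_pos_pos zero_less_power) auto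
        show "\<bar>f (x - y)\<bar> \<le> \<bar>M\<bar>" using M[of "x - y"] that by (simp add: dist_norm)
      qed (use that a in auto)
      then show "norm (indicator {y. a \<le> norm y \<and> norm y < b} y * (\<Omega> y / norm y ^ DIM('a) * f (x - y)))
        \<le> norm ((\<bar>M\<bar> / a ^ DIM('a)) * (indicator (ball 0 b) y * \<bar>\<Omega> y\<bar>))"
        using a by (auto simp: indicator_def abs_mult mult_ac)
    qed
  qed measurable
next
  case False
  then have empty: "{y :: 'a. a \<le> norm y \<and> norm y < b} = {}"
    using order_trans[OF _ norm_ge_zero] by (auto simp: not_less)
  show ?thesis unfolding empty by simp
qed

section \<open>Weighted bounds at a single scale, and the truncated operator\<close>

lemma ennpowr_ennreal: "0 \<le> u \<Longrightarrow> ennreal u epowr p = ennreal (u powr p)"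
  by (simp add: ennpowr_def)

text \<open>One ball is tested in both suprema. \<open>\<tau>\<close> is the weighted average over
  it, so the maximal function bounds \<open>\<tau>\<close>. With \<open>wB\<close> the weighted
  measure of the ball, the Morrey quotient is \<open>\<tau> * wB powr (P / q)\<close>, which bounds
  \<open>\<tau> powr (1 / P)\<close> by the Morrey norm times \<open>wB powr (- 1 / q)\<close>; the
  Ahlfors condition turns this into decay in \<open>r\<close>.\<close>

lemma maximal_Morrey_average:
  fixes \<omega> :: "'a::euclidean_space \<Rightarrow> real" and g :: "'a \<Rightarrow> 'b::real_normed_vector"
  assumes w: "weight \<omega>" and r: "0 < r" and c\<^sub>0: "0 < c\<^sub>0"
    and Ahlfors: "ennreal (c\<^sub>0 * r powr d) \<le> wmeasure \<omega> (ball x r)"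
    and P: "0 < P" "P \<le> q" and fin: "Morrey_norm P q \<omega> g < \<infinity>"
  obtains \<tau> where "0 \<le> \<tau>"
    "(\<integral>\<^sup>+y\<in>ball x r. ennreal (norm (g y) powr P * \<omega> y) \<partial>lebesgue) = ennreal \<tau> * wmeasure \<omega> (ball x r)"
    "ennreal \<tau> \<le> weighted_maximal \<omega> (\<lambda>y. norm (g y) powr P) x"
    "\<tau> powr (1 / P) \<le> (c\<^sub>0 * r powr d) powr (- 1 / q) * enn2real (Morrey_norm P q \<omega> g)"
proof -
  define J where "J = (\<integral>\<^sup>+y\<in>ball x r. ennreal (norm (g y) powr P * \<omega> y) \<partial>lebesgue)"
  define N where "N = enn2real (Morrey_norm P q \<omega> g)"
  have N: "Morrey_norm P q \<omega> g = ennreal N" using fin by (simp add: N_def)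
  define wB where "wB = enn2real (wmeasure \<omega> (ball x r))"
  have wB: "wmeasure \<omega> (ball x r) = ennreal wB" "0 < wB"
    using wmeasure_ball[OF w r, of x] by (auto simp: wB_def enn2real_positive_iff)
  have "(J / wmeasure \<omega> (ball x r) epowr (1 - P / q)) epowr (1 / P) \<le> Morrey_norm P q \<omega> g"
    unfolding J_def Morrey_norm_def using r by (intro SUP_upper2[of "(x, r)"]) auto
  then have le: "(J / ennreal (wB powr (1 - P / q))) epowr (1 / P) \<le> ennreal N"
    unfolding N wB using wB by (simp add: ennpowr_ennreal)
  \<comment> \<open>The finite Morrey norm makes \<open>\<tau>\<close> a real number even where the
    maximal function is infinite.\<close>
  have "J / ennreal (wB powr (1 - P / q)) \<noteq> \<infinity>"
  proof
    assume "J / ennreal (wB powr (1 - P / q)) = \<infinity>"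
    then show False using le by (simp add: ennpowr_def top_unique)
  qed
  then have "J < \<infinity>" using wB by (auto simp: ennreal_divide_eq_top_iff less_top[symmetric])
  define \<tau> where "\<tau> = enn2real J / wB"
  have \<tau>: "0 \<le> \<tau>" "J = ennreal (\<tau> * wB)" using \<open>J < \<infinity>\<close> wB by (auto simp: \<tau>_def)
  have "J / ennreal (wB powr (1 - P / q)) = ennreal (\<tau> * wB powr (P / q))"
    unfolding \<tau>(2) using \<tau> wB by (simp add: divide_ennreal powr_diff)
  with le have "ennreal ((\<tau> * wB powr (P / q)) powr (1 / P)) \<le> ennreal N"
    using \<tau> by (simp add: ennpowr_ennreal)
  then have "(\<tau> * wB powr (P / q)) powr (1 / P) \<le> N"
    by (subst (asm) ennreal_le_iff) (auto simp: N_def)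
  then have "\<tau> powr (1 / P) * wB powr (1 / q) \<le> N"
    using \<tau> P by (simp add: powr_mult powr_powr)
  then have "\<tau> powr (1 / P) \<le> N * wB powr (- 1 / q)"
    using wB by (simp add: powr_minus_divide field_simps)
  also have "\<dots> \<le> N * (c\<^sub>0 * r powr d) powr (- 1 / q)"
  proof (intro mult_left_mono powr_mono2')
    show "c\<^sub>0 * r powr d \<le> wB" using Ahlfors wB by (simp add: ennreal_le_iff2)
  qed (use P c\<^sub>0 r in \<open>auto simp: N_def\<close>)
  finally have 4: "\<tau> powr (1 / P) \<le> (c\<^sub>0 * r powr d) powr (- 1 / q) * N" by (simp add: mult.commute)
  have "J / wmeasure \<omega> (ball x r) \<le> weighted_maximal \<omega> (\<lambda>y. norm (g y) powr P) x"
    unfolding J_def weighted_maximal_def using r by (intro SUP_upper2[of "(x, r)"]) auto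
  moreover have "J / wmeasure \<omega> (ball x r) = ennreal \<tau>"
    unfolding wB \<tau>(2) using \<tau> wB by (simp add: divide_ennreal)
  ultimately have 3: "ennreal \<tau> \<le> weighted_maximal \<omega> (\<lambda>y. norm (g y) powr P) x" by simp
  have 2: "J = ennreal \<tau> * wmeasure \<omega> (ball x r)"
    unfolding wB \<tau>(2) using \<tau> wB by (simp add: ennreal_mult)
  show ?thesis
    by (rule that[OF \<tau>(1) 2[unfolded J_def] 3 4[unfolded N_def]])
qed

text \<open>\<open>Muckenhoupt_average_le\<close> on the ball of radius \<open>2 * a\<close>
  supplies the unweighted \<open>p\<close>-average for \<open>annulus_estimate\<close>; its exponent
  \<open>p / (s * \<delta>)\<close> becomes \<open>1 / (s * \<delta>)\<close> under the
  \<open>p\<close>-th root. \<open>L\<close> and \<open>\<tau>\<close> may be 0, so the bound is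
  first proved for strictly larger numbers.\<close>

lemma weighted_annulus_estimate:
  fixes \<Omega> f \<omega> :: "'a::euclidean_space \<Rightarrow> real" and \<rho> p s \<delta> :: real
  defines "C\<^sub>1 \<equiv> 4 * real DIM('a) * (32 * 2 ^ DIM('a) / measure lborel (ball 0 2 :: 'a set) + (1 + 2 ^ DIM('a)))
    * ((2 ^ DIM('a)) powr (1 / \<rho>) * (3 * (2 ^ DIM('a) * measure lborel (ball 0 1 :: 'a set))) powr (1 / p))"
  assumes [measurable]: "\<Omega> \<in> borel_measurable borel"
    and hom: "\<And>c y. 0 < c \<Longrightarrow> \<Omega> (c *\<^sub>R y) = \<Omega> y"
    and f: "C1_function f"
    and \<rho>: "1 < \<rho>" and p: "1 < p" and exps: "1 / \<rho> + 1 / p = 1 + 1 / DIM('a)"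
    and \<omega>: "\<omega> \<in> Muckenhoupt \<delta>" and \<delta>: "1 \<le> \<delta>" and s: "p \<le> s"
    and L: "0 \<le> L" "(\<integral>\<^sup>+y. indicator (ball 0 1) y * ennreal (\<bar>\<Omega> y\<bar> powr \<rho>) \<partial>lborel) \<le> ennreal L"
    and \<tau>: "0 \<le> \<tau>" "(\<integral>\<^sup>+y\<in>ball x (2 * a). ennreal (norm (gradient f y) powr (s * \<delta>) * \<omega> y) \<partial>lebesgue)
        \<le> ennreal \<tau> * wmeasure \<omega> (ball x (2 * a))"
    and b: "0 < a" "b \<le> 2 * a"
    and eq: "(\<integral>\<^sup>+y. indicator (ball 0 1) y * ennreal (\<Omega> y) \<partial>lborel) = (\<integral>\<^sup>+y. indicator (ball 0 1) y * ennreal (- \<Omega> y) \<partial>lborel)"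
    and fin: "(\<integral>\<^sup>+y. indicator (ball 0 1) y * ennreal (\<Omega> y) \<partial>lborel) < \<infinity>"
  shows "\<bar>\<integral>y. indicator {y. a \<le> norm y \<and> norm y < b} y * (\<Omega> y / norm y ^ DIM('a) * f (x - y)) \<partial>lborel\<bar>
    \<le> C\<^sub>1 * a * enn2real (Muckenhoupt_const \<delta> \<omega>) powr (1 / (s * \<delta>)) * (L powr (1 / \<rho>) * \<tau> powr (1 / (s * \<delta>)))"
proof (rule le_powr_product_limit)
  let ?n = "DIM('a)"
  define W where "W = enn2real (Muckenhoupt_const \<delta> \<omega>)"
  have W: "0 < W" unfolding W_def by (rule Muckenhoupt_const_pos[OF \<omega> \<delta>])
  define V where "V = measure lborel (ball 0 1 :: 'a set)"
  have V: "0 < V" using content_ball_pos[of 1 "0::'a"] by (simp add: V_def)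
  have P: "0 < s * \<delta>" using p s \<delta> by simp
  fix L' T :: real
  assume L': "L < L'" and T: "\<tau> < T"
  \<comment> \<open>\<open>2 ^ n * V\<close> is the volume of the ball of radius
    \<open>2 * a\<close> divided by \<open>a ^ n\<close>, the normalisation of
    \<open>annulus_estimate\<close>.\<close>
  define Y where "Y = 3 * (2 ^ ?n * V) * (W * T) powr (p / (s * \<delta>))"
  have Y: "0 < Y" using V W T \<tau> by (simp add: Y_def)
  have "\<bar>\<integral>y. indicator {y. a \<le> norm y \<and> norm y < b} y * (\<Omega> y / norm y ^ ?n * f (x - y)) \<partial>lborel\<bar>
    \<le> 4 * real ?n * (32 * 2 ^ ?n / measure lborel (ball 0 2 :: 'a set) + (1 + 2 ^ ?n))
        * ((2 ^ ?n * L') powr (1 / \<rho>) * (a * Y powr (1 / p)))"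
  proof (rule annulus_estimate[OF _ hom f \<rho> p exps _ _ Y _ b eq fin])
    show "0 < 2 ^ ?n * L'" using L L' by simp
    have "(\<integral>\<^sup>+y. indicator (ball 0 2) y * ennreal (\<bar>\<Omega> y\<bar> powr \<rho>) \<partial>lborel)
      = ennreal (2 ^ ?n) * (\<integral>\<^sup>+y. indicator (ball 0 1) y * ennreal (\<bar>\<Omega> y\<bar> powr \<rho>) \<partial>lborel)"
      by (intro nn_integral_homogeneous_ball) (auto simp: hom)
    also have "\<dots> \<le> ennreal (2 ^ ?n) * ennreal L'"
      using L L' by (intro mult_left_mono order_trans[OF L(2)] ennreal_leI) auto
    finally show "(\<integral>\<^sup>+y. indicator (ball 0 2) y * ennreal (\<bar>\<Omega> y\<bar> powr \<rho>) \<partial>lborel) \<le> ennreal (2 ^ ?n * L')"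
      using L L' by (simp add: ennreal_mult)
    have "gradient f \<in> borel_measurable borel"
      using f unfolding C1_function_def by (intro borel_measurable_continuous_onI) auto
    then have "gradient f \<in> borel_measurable lebesgue"
      by (intro measurable_completion) simp
    then have "(\<integral>\<^sup>+y\<in>ball x (2 * a). ennreal (norm (gradient f y) powr p) \<partial>lebesgue)
      \<le> ennreal (3 * (W * T) powr (p / (s * \<delta>)) * measure lborel (ball x (2 * a)))"
      unfolding W_def using p s b T \<tau> \<omega> \<delta>
      by (intro Muckenhoupt_average_le) (auto intro!: order_trans[OF \<tau>(2)] mult_right_mono ennreal_leI)
    also have "3 * (W * T) powr (p / (s * \<delta>)) * measure lborel (ball x (2 * a)) = a ^ ?n * Y"
      using b content_ball_conv_unit_ball[of "2 * a" x] unfolding Y_def V_def by (simp add: power_mult_distrib)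
    finally show "(\<integral>\<^sup>+y. indicator (ball x (2 * a)) y * ennreal (norm (gradient f y) powr p) \<partial>lborel) \<le> ennreal (a ^ ?n * Y)"
      by (simp add: nn_integral_completion mult.commute)
  qed simp
  also have "\<dots> = C\<^sub>1 * a * W powr (1 / (s * \<delta>)) * (L' powr (1 / \<rho>) * T powr (1 / (s * \<delta>)))"
  proof -
    have "Y powr (1 / p) = (3 * (2 ^ ?n * V)) powr (1 / p) * (W powr (1 / (s * \<delta>)) * T powr (1 / (s * \<delta>)))"
      unfolding Y_def using p V W T \<tau> by (simp add: powr_mult powr_powr)
    moreover have "(2 ^ ?n * L') powr (1 / \<rho>) = (2 ^ ?n) powr (1 / \<rho>) * L' powr (1 / \<rho>)"
      using L L' by (simp add: powr_mult)
    ultimately show ?thesis unfolding C\<^sub>1_def V_def by (simp only: mult_ac)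
  qed
  finally show "\<bar>\<integral>y. indicator {y. a \<le> norm y \<and> norm y < b} y * (\<Omega> y / norm y ^ ?n * f (x - y)) \<partial>lborel\<bar>
    \<le> C\<^sub>1 * a * enn2real (Muckenhoupt_const \<delta> \<omega>) powr (1 / (s * \<delta>)) * (L' powr (1 / \<rho>) * T powr (1 / (s * \<delta>)))"
    unfolding W_def .
qed (use L \<tau> \<rho> p s \<delta> in auto)

text \<open>Including the null sphere \<open>norm y = t\<close> yields half-open annuli, which fit
  together without overlap, and replacing \<open>\<Omega>\<close> by its representative gives a
  Borel integrand.\<close>

lemma truncated_integral_eq:
  fixes \<Omega> \<Omega>' f :: "'a::euclidean_space \<Rightarrow> real"
  assumes [measurable]: "\<Omega>' \<in> borel_measurable borel" and f: "continuous_on UNIV f"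
    and ae: "AE y in lebesgue. y \<noteq> 0 \<longrightarrow> \<Omega> (y /\<^sub>R norm y) = \<Omega>' y" and t: "0 < t"
  shows "(LINT y:{y. t < norm y \<and> norm y < R}|lebesgue. rough_kernel \<Omega> y * f (x - y))
    = (\<integral>y. indicator {y. t \<le> norm y \<and> norm y < R} y * (\<Omega>' y / norm y ^ DIM('a) * f (x - y)) \<partial>lborel)"
proof -
  have [measurable]: "f \<in> borel_measurable borel"
    by (rule borel_measurable_continuous_onI[OF f])
  let ?F = "\<lambda>y. indicator {y. t \<le> norm y \<and> norm y < R} y * (\<Omega>' y / norm y ^ DIM('a) * f (x - y))"
  let ?G = "\<lambda>y. indicator {y. t < norm y \<and> norm y < R} y *\<^sub>R (rough_kernel \<Omega> y * f (x - y))"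
  have F: "?F \<in> borel_measurable lborel" by measurable
  then have F': "?F \<in> borel_measurable lebesgue" by (rule measurable_completion)
  have "sphere 0 t \<in> null_sets lebesgue"
    using negligible_sphere negligible_iff_null_sets by blast
  then have "AE y in lebesgue. y \<notin> sphere (0::'a) t" by (rule AE_not_in)
  with ae have eq: "AE y in lebesgue. ?F y = ?G y"
    by eventually_elim (use t in \<open>auto simp: indicator_def rough_kernel_def\<close>)
  have "(LINT y|lebesgue. ?G y) = (LINT y|lebesgue. ?F y)"
    using eq F' borel_measurable_AE[OF F' eq] by (intro integral_cong_AE) auto
  also have "\<dots> = (LINT y|lborel. ?F y)"
    by (rule integral_completion[OF F])
  finally show ?thesis by (simp add: set_lebesgue_integral_def)
qed

theorem theorem1:
  fixes \<omega> :: "'a::euclidean_space \<Rightarrow> real"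
    and \<rho> \<rho>bar s \<delta> c\<^sub>0 d q :: real
  assumes "DIM('a) \<ge> 2"
    and "1 < \<rho>" and "\<rho> < real DIM('a)"
    and "\<rho>bar = \<rho> * real DIM('a) / (\<rho> * real DIM('a) + \<rho> - real DIM('a))"
    and "1 < \<rho>bar" and "\<rho>bar \<le> s" and "s < real DIM('a)"
    and "1 \<le> \<delta>" and "\<omega> \<in> Muckenhoupt \<delta>"
    and "0 < c\<^sub>0" and "1 < d" and "s * \<delta> < d"
    and "\<And>x r. 0 < r \<Longrightarrow> ennreal (c\<^sub>0 * r powr d) \<le> wmeasure \<omega> (ball x r)"
    and "1 < s * \<delta>" and "s * \<delta> \<le> q" and "q < d"
  shows "\<exists>C::real. 0 < C \<and>
    (\<forall>\<Omega> f x. integrable sphere_measure \<Omega> \<longrightarrow> (LINT \<theta>|sphere_measure. \<Omega> \<theta>) = 0 \<longrightarrow>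
       \<Omega> \<in> Lp_space sphere_measure \<rho> \<longrightarrow>
       C1_function f \<longrightarrow> gradient f \<in> Morrey_space (s * \<delta>) q \<omega> \<longrightarrow>
       maximal_rough \<Omega> f x \<le>
         ennreal C * ennreal (Lp_norm sphere_measure \<rho> \<Omega>)
           * Muckenhoupt_const \<delta> \<omega> epowr (1 / (s * \<delta>))
           * weighted_maximal \<omega> (\<lambda>y. norm (gradient f y) powr (s * \<delta>)) x
               epowr (1 / (s * \<delta>) * (1 - q / d))
           * Morrey_norm (s * \<delta>) q \<omega> (gradient f) epowr (q / d))"
proof -
  let ?n = "DIM('a)"
  define P where "P = s * \<delta>"
  have P: "1 < P" "P \<le> q" "P < d" using assms unfolding P_def by auto
  \<comment> \<open>The roots of the weighted averages decay like \<open>a powr (- d / q)\<close>;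
    times the scale \<open>a\<close> this is \<open>a powr (- \<gamma>)\<close>. Here
    \<open>q < d\<close> gives \<open>\<gamma> > 0\<close>, and the interpolation exponent
    \<open>1 / (1 + \<gamma>)\<close> is \<open>q / d\<close>.\<close>
  define \<gamma> where "\<gamma> = d / q - 1"
  have \<gamma>: "0 < \<gamma>" using P assms by (simp add: \<gamma>_def)
  have \<theta>: "1 / (1 + \<gamma>) = q / d" using P assms by (simp add: \<gamma>_def)
  define W where "W = enn2real (Muckenhoupt_const \<delta> \<omega>)"
  have W: "0 < W" unfolding W_def using assms by (intro Muckenhoupt_const_pos) auto
  have W': "Muckenhoupt_const \<delta> \<omega> = ennreal W"
    using assms by (simp add: W_def Muckenhoupt_def)
  \<comment> \<open>\<open>\<rho>bar\<close> is designed to satisfy this relation; it takes the part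
    of \<open>p\<close> in the lemmas above.\<close>
  have exps: "1 / \<rho> + 1 / \<rho>bar = 1 + 1 / real ?n"
  proof -
    have "\<rho> * real ?n + \<rho> - real ?n \<noteq> 0" using assms by auto
    then have "1 / \<rho>bar = (\<rho> * real ?n + \<rho> - real ?n) / (\<rho> * real ?n)"
      using assms by simp
    also have "\<dots> = 1 + 1 / real ?n - 1 / \<rho>" using assms by (simp add: field_simps)
    finally show ?thesis by simp
  qed
  define C\<^sub>1 where "C\<^sub>1 = 4 * real ?n * (32 * 2 ^ ?n / measure lborel (ball 0 2 :: 'a set) + (1 + 2 ^ ?n))
    * ((2 ^ ?n) powr (1 / \<rho>) * (3 * (2 ^ ?n * measure lborel (ball 0 1 :: 'a set))) powr (1 / \<rho>bar))"
  have C1: "0 < C\<^sub>1"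
  proof -
    have "0 < measure lborel (ball 0 1 :: 'a set)" "0 < measure lborel (ball 0 2 :: 'a set)"
      using content_ball_pos[of 1 "0::'a"] content_ball_pos[of 2 "0::'a"] by auto
    then show ?thesis unfolding C\<^sub>1_def by (intro mult_pos_pos add_nonneg_pos) auto
  qed
  define C\<^sub>\<gamma> where "C\<^sub>\<gamma> = 2 + 1 / (1 - 2 powr (- \<gamma>))"
  have C\<gamma>: "0 < C\<^sub>\<gamma>"
    unfolding C\<^sub>\<gamma>_def using \<gamma> by (intro add_pos_pos) (auto simp: powr_less_one)
  define \<kappa> where "\<kappa> = (c\<^sub>0 * 2 powr d) powr (- 1 / q)"
  have \<kappa>: "0 < \<kappa>" using assms by (simp add: \<kappa>_def)
  \<comment> \<open>The factor \<open>(1 / n) powr (1 / \<rho>)\<close> stems from passing from the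
    sphere to the unit ball, where integrals of homogeneous functions are smaller by the factor
    \<open>n\<close>.\<close>
  define C where "C = C\<^sub>1 * (1 / real ?n) powr (1 / \<rho>) * C\<^sub>\<gamma> * \<kappa> powr (q / d)"
  have C: "0 < C" using C1 C\<gamma> \<kappa> by (simp add: C_def)
  show ?thesis unfolding P_def[symmetric]
  proof (intro exI[of _ C] conjI C allI impI)
    fix \<Omega> f :: "'a \<Rightarrow> real" and x :: 'a
    assume int: "integrable sphere_measure \<Omega>" and zero: "(LINT \<theta>|sphere_measure. \<Omega> \<theta>) = 0"
      and Lp: "\<Omega> \<in> Lp_space sphere_measure \<rho>" and f: "C1_function f"
      and "gradient f \<in> Morrey_space P q \<omega>"
    then have Nfin: "Morrey_norm P q \<omega> (gradient f) < \<infinity>" by (simp add: Morrey_space_def)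
    define N where "N = enn2real (Morrey_norm P q \<omega> (gradient f))"
    have N: "0 \<le> N" "Morrey_norm P q \<omega> (gradient f) = ennreal N" using Nfin by (auto simp: N_def)
    define M where "M = weighted_maximal \<omega> (\<lambda>y. norm (gradient f y) powr P) x"
    have cont_f: "continuous_on UNIV f"
      using f unfolding C1_function_def
      by (meson continuous_at_imp_continuous_on differentiable_imp_continuous_within)
    obtain \<Omega>' where \<Omega>'[measurable]: "\<Omega>' \<in> borel_measurable borel"
      and hom: "\<And>c y. 0 < c \<Longrightarrow> \<Omega>' (c *\<^sub>R y) = \<Omega>' y"
      and ae: "AE y in lebesgue. y \<noteq> 0 \<longrightarrow> \<Omega> (y /\<^sub>R norm y) = \<Omega>' y"
      and polar: "\<And>\<phi> :: real \<Rightarrow> ennreal. \<phi> \<in> borel_measurable borel \<Longrightarrow>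
        (\<integral>\<^sup>+\<theta>. \<phi> (\<Omega> \<theta>) \<partial>sphere_measure) = of_nat ?n * (\<integral>\<^sup>+y. indicator (ball 0 1) y * \<phi> (\<Omega>' y) \<partial>lborel)"
      by (rule sphere_measure_homogeneous_extension[OF borel_measurable_integrable[OF int]]) (rule that, assumption+)
    have n: "(of_nat ?n :: ennreal) \<noteq> 0" "(of_nat ?n :: ennreal) \<noteq> \<infinity>" by auto
    have fin_cancel: "b < \<infinity>" if "of_nat ?n * b < \<infinity>" for b :: ennreal
      using that n by (auto simp: ennreal_mult_less_top)
    have finpm: "(\<integral>\<^sup>+\<theta>. ennreal (\<Omega> \<theta>) \<partial>sphere_measure) < \<infinity>" "(\<integral>\<^sup>+\<theta>. ennreal (- \<Omega> \<theta>) \<partial>sphere_measure) < \<infinity>"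
      "(\<integral>\<^sup>+\<theta>. ennreal \<bar>\<Omega> \<theta>\<bar> \<partial>sphere_measure) < \<infinity>"
    proof -
      show "(\<integral>\<^sup>+\<theta>. ennreal (\<Omega> \<theta>) \<partial>sphere_measure) < \<infinity>" "(\<integral>\<^sup>+\<theta>. ennreal (- \<Omega> \<theta>) \<partial>sphere_measure) < \<infinity>"
        using int unfolding real_integrable_def by (simp_all add: less_top)
      show "(\<integral>\<^sup>+\<theta>. ennreal \<bar>\<Omega> \<theta>\<bar> \<partial>sphere_measure) < \<infinity>"
        using int unfolding integrable_iff_bounded by simp
    qed
    have fin: "(\<integral>\<^sup>+y. indicator (ball 0 1) y * ennreal (\<Omega>' y) \<partial>lborel) < \<infinity>"
      using finpm(1) polar[of ennreal] by - (rule fin_cancel, simp)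
    have fin_abs: "(\<integral>\<^sup>+y. indicator (ball 0 1) y * ennreal \<bar>\<Omega>' y\<bar> \<partial>lborel) < \<infinity>"
      using finpm(3) polar[of "\<lambda>u. ennreal \<bar>u\<bar>"] by - (rule fin_cancel, simp)
    \<comment> \<open>The vanishing mean on the sphere, in the form of equal positive and negative
      parts over the ball, since the polar formula is available for nonnegative integrands.\<close>
    have eq: "(\<integral>\<^sup>+y. indicator (ball 0 1) y * ennreal (\<Omega>' y) \<partial>lborel) = (\<integral>\<^sup>+y. indicator (ball 0 1) y * ennreal (- \<Omega>' y) \<partial>lborel)"
    proof -
      have "enn2real (\<integral>\<^sup>+\<theta>. ennreal (\<Omega> \<theta>) \<partial>sphere_measure) = enn2real (\<integral>\<^sup>+\<theta>. ennreal (- \<Omega> \<theta>) \<partial>sphere_measure)"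
        using zero real_lebesgue_integral_def[OF int] by simp
      then have "ennreal (enn2real (\<integral>\<^sup>+\<theta>. ennreal (\<Omega> \<theta>) \<partial>sphere_measure)) = ennreal (enn2real (\<integral>\<^sup>+\<theta>. ennreal (- \<Omega> \<theta>) \<partial>sphere_measure))"
        by (rule arg_cong)
      then have "(\<integral>\<^sup>+\<theta>. ennreal (\<Omega> \<theta>) \<partial>sphere_measure) = (\<integral>\<^sup>+\<theta>. ennreal (- \<Omega> \<theta>) \<partial>sphere_measure)"
        using finpm(1,2) by (simp only: ennreal_enn2real infinity_ennreal_def)
      then have "of_nat ?n * (\<integral>\<^sup>+y. indicator (ball 0 1) y * ennreal (\<Omega>' y) \<partial>lborel) = of_nat ?n * (\<integral>\<^sup>+y. indicator (ball 0 1) y * ennreal (- \<Omega>' y) \<partial>lborel)"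
        using polar[of ennreal] polar[of "\<lambda>u. ennreal (- u)"] by simp
      then show ?thesis using n by (simp add: ennreal_mult_cancel_left)
    qed
    define l where "l = (LINT \<theta>|sphere_measure. \<bar>\<Omega> \<theta>\<bar> powr \<rho>)"
    have l: "0 \<le> l" unfolding l_def by simp
    have norm_eq: "Lp_norm sphere_measure \<rho> \<Omega> = l powr (1 / \<rho>)" by (simp add: Lp_norm_def l_def)
    have "(\<integral>\<^sup>+\<theta>. ennreal (\<bar>\<Omega> \<theta>\<bar> powr \<rho>) \<partial>sphere_measure) = ennreal l"
      using Lp unfolding l_def Lp_space_def by (intro nn_integral_eq_integral) auto
    then have "of_nat ?n * (\<integral>\<^sup>+y. indicator (ball 0 1) y * ennreal (\<bar>\<Omega>' y\<bar> powr \<rho>) \<partial>lborel) = of_nat ?n * ennreal (l / ?n)"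
      using polar[of "\<lambda>u. ennreal (\<bar>u\<bar> powr \<rho>)"] l
      by (simp add: ennreal_of_nat_eq_real_of_nat ennreal_mult[symmetric])
    then have L: "(\<integral>\<^sup>+y. indicator (ball 0 1) y * ennreal (\<bar>\<Omega>' y\<bar> powr \<rho>) \<partial>lborel) \<le> ennreal (l / ?n)"
      using n by (simp add: ennreal_mult_cancel_left)
    define I where "I a b = (\<integral>y. indicator {y. a \<le> norm y \<and> norm y < b} y * (\<Omega>' y / norm y ^ ?n * f (x - y)) \<partial>lborel)" for a b
    define D where "D = C\<^sub>1 * W powr (1 / P) * (l / ?n) powr (1 / \<rho>)"
    have D: "0 \<le> D" using C1 by (simp add: D_def)
    have split: "I a c = I a b + I b c" if "0 < a" "a \<le> b" "b \<le> c" for a b c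
    proof -
      have "I a b + I b c = (\<integral>y. indicator {y. a \<le> norm y \<and> norm y < b} y * (\<Omega>' y / norm y ^ ?n * f (x - y))
          + indicator {y. b \<le> norm y \<and> norm y < c} y * (\<Omega>' y / norm y ^ ?n * f (x - y)) \<partial>lborel)"
        unfolding I_def using that cont_f
        by (intro Bochner_Integration.integral_add[symmetric] integrable_annulus_kernel \<Omega>' hom fin_abs) auto
      also have "\<dots> = I a c"
        unfolding I_def using that by (intro Bochner_Integration.integral_cong) (auto simp: indicator_def)
      finally show ?thesis ..
    qed
    have empty: "I a b = 0" if "b \<le> a" for a b
    proof -
      have "{y::'a. a \<le> norm y \<and> norm y < b} = {}" using that by auto
      then show ?thesis unfolding I_def by simp
    qed
    \<comment> \<open>The same \<open>\<tau>\<close> obeys both bounds, which is what permits the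
      minimum. Its comparison with \<open>M\<close> stays in \<open>ennreal\<close> because
      \<open>M\<close> may be infinite.\<close>
    have annulus: "\<exists>\<tau>\<ge>0. \<bar>I a b\<bar> \<le> D * (a * \<tau> powr (1 / P)) \<and> ennreal \<tau> \<le> M \<and> a * \<tau> powr (1 / P) \<le> a powr (- \<gamma>) * (\<kappa> * N)"
      if a: "0 < a" "b \<le> 2 * a" for a b
    proof -
      have r: "0 < 2 * a" using a by simp
      have w: "weight \<omega>" using assms by (simp add: Muckenhoupt_def)
      obtain \<tau> where \<tau>: "0 \<le> \<tau>"
        "(\<integral>\<^sup>+y\<in>ball x (2 * a). ennreal (norm (gradient f y) powr P * \<omega> y) \<partial>lebesgue) = ennreal \<tau> * wmeasure \<omega> (ball x (2 * a))"
        "ennreal \<tau> \<le> M" "\<tau> powr (1 / P) \<le> (c\<^sub>0 * (2 * a) powr d) powr (- 1 / q) * N"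
        unfolding M_def N_def
        by (rule maximal_Morrey_average[OF w r \<open>0 < c\<^sub>0\<close> assms(13)[OF r] _ P(2) Nfin])
           (use P in auto)
      have "\<bar>I a b\<bar> \<le> C\<^sub>1 * a * W powr (1 / P) * ((l / ?n) powr (1 / \<rho>) * \<tau> powr (1 / P))"
        unfolding I_def C\<^sub>1_def W_def P_def
        using assms l L \<tau>(1,2) a P
        by (intro weighted_annulus_estimate[OF \<Omega>' hom f _ _ exps _ _ _ _ _ _ _ _ _ eq fin]) (auto simp: P_def)
      then have 1: "\<bar>I a b\<bar> \<le> D * (a * \<tau> powr (1 / P))" unfolding D_def by (simp add: mult_ac)
      have "(c\<^sub>0 * (2 * a) powr d) powr (- 1 / q) = \<kappa> * a powr (- d / q)"
        unfolding \<kappa>_def using a assms by (simp add: powr_mult powr_powr)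
      moreover have "a * a powr (- d / q) = a powr (- \<gamma>)"
        using a by (simp add: \<gamma>_def powr_diff powr_minus_divide)
      ultimately have "a * ((c\<^sub>0 * (2 * a) powr d) powr (- 1 / q) * N) = a powr (- \<gamma>) * (\<kappa> * N)"
        by (simp add: mult_ac)
      moreover have "a * \<tau> powr (1 / P) \<le> a * ((c\<^sub>0 * (2 * a) powr d) powr (- 1 / q) * N)"
        using a \<tau>(4) by (intro mult_left_mono) auto
      ultimately have "a * \<tau> powr (1 / P) \<le> a powr (- \<gamma>) * (\<kappa> * N)" by (simp only:)
      with 1 \<tau>(1,3) show ?thesis by blast
    qed
    have max_le: "maximal_rough \<Omega> f x \<le> ennreal B" if "\<And>t R. 0 < t \<Longrightarrow> \<bar>I t R\<bar> \<le> B" for B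
      unfolding maximal_rough_def truncated_abs_def
    proof (intro SUP_least Limsup_bounded always_eventually allI ennreal_leI)
      fix t R :: real assume "t \<in> {0<..}"
      then show "\<bar>LINT y:{y. t < norm y \<and> norm y < R}|lebesgue. rough_kernel \<Omega> y * f (x - y)\<bar> \<le> B"
        using truncated_integral_eq[OF \<Omega>' cont_f ae, of t R x] that[of t R] unfolding I_def by simp
    qed
    have min_bound: "\<bar>I t R\<bar> \<le> D * (C\<^sub>\<gamma> * (m powr (1 - q / d) * (\<kappa> * N) powr (q / d)))"
      if "0 < t" "0 \<le> m" and le: "\<And>a b. 0 < a \<Longrightarrow> b \<le> 2 * a \<Longrightarrow> \<bar>I a b\<bar> \<le> D * min (a * m) (a powr (- \<gamma>) * (\<kappa> * N))" for t R m
      using dyadic_min_bound[of I D m \<gamma> "\<kappa> * N" t R, OF split empty le] that \<gamma> \<kappa> N D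
      unfolding C\<^sub>\<gamma>_def \<theta> by simp
    show "maximal_rough \<Omega> f x \<le> ennreal C * ennreal (Lp_norm sphere_measure \<rho> \<Omega>)
      * Muckenhoupt_const \<delta> \<omega> epowr (1 / P)
      * weighted_maximal \<omega> (\<lambda>y. norm (gradient f y) powr P) x epowr (1 / P * (1 - q / d))
      * Morrey_norm P q \<omega> (gradient f) epowr (q / d)"
    \<comment> \<open>When all other factors are positive, \<open>M = \<infinity>\<close> makes the
      right-hand side infinite. If \<open>l\<close> or \<open>N\<close> is 0, then
      \<open>0 * \<infinity> = 0\<close> in \<open>ennreal\<close>, and the left-hand side has to be
      shown to vanish.\<close>
    proof (cases "M = \<infinity> \<and> l \<noteq> 0 \<and> N \<noteq> 0")
      case True
      then show ?thesis
        using C l N W unfolding M_def[symmetric] norm_eq W' N(2)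
        by (simp add: ennpowr_ennreal ennreal_mult_top ennreal_top_mult ennpowr_def)
    next
      case False
      show ?thesis
      proof (cases "l = 0 \<or> N = 0")
        case True
        have "\<bar>I a b\<bar> \<le> 0" if a: "0 < a" "b \<le> 2 * a" for a b
        proof -
          obtain \<tau> where \<tau>: "\<bar>I a b\<bar> \<le> D * (a * \<tau> powr (1 / P))" "a * \<tau> powr (1 / P) \<le> a powr (- \<gamma>) * (\<kappa> * N)"
            using annulus[OF a] by blast
          from True show ?thesis
          proof
            assume "l = 0"
            then have "D = 0" by (simp add: D_def)
            then show ?thesis using \<tau> by simp
          next
            assume "N = 0"
            then have "D * (a * \<tau> powr (1 / P)) \<le> D * 0" using \<tau>(2) D by (intro mult_left_mono) auto
            then show ?thesis using \<tau>(1) by simp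
          qed
        qed
        \<comment> \<open>\<open>m = 0\<close> is admissible because the integrals over single
          dyadic annuli have just been shown to vanish.\<close>
        then have "\<bar>I t R\<bar> \<le> 0" if "0 < t" for t R
          using min_bound[of t 0 R] that \<kappa> N D by (auto simp: min_def)
        from max_le[of 0, OF this] show ?thesis by simp
      next
        case F: False
        then have "M < \<infinity>" using False by (auto simp: less_top)
        define m where "m = enn2real M"
        have m: "0 \<le> m" "M = ennreal m" using \<open>M < \<infinity>\<close> by (auto simp: m_def)
        \<comment> \<open>The interpolation is applied to \<open>m powr (1 / P)\<close>, which
          produces the exponent \<open>1 / P * (1 - q / d)\<close> of the maximal function.\<close>
        have "\<bar>I a b\<bar> \<le> D * min (a * m powr (1 / P)) (a powr (- \<gamma>) * (\<kappa> * N))" if a: "0 < a" "b \<le> 2 * a" for a b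
        proof -
          obtain \<tau> where \<tau>: "0 \<le> \<tau>" "\<bar>I a b\<bar> \<le> D * (a * \<tau> powr (1 / P))" "ennreal \<tau> \<le> M"
            "a * \<tau> powr (1 / P) \<le> a powr (- \<gamma>) * (\<kappa> * N)"
            using annulus[OF a] by blast
          have "\<tau> \<le> m" using \<tau> m by simp
          then have "a * \<tau> powr (1 / P) \<le> a * m powr (1 / P)"
            using a P \<tau> by (intro mult_left_mono powr_mono2) auto
          with \<tau>(4) D have "D * (a * \<tau> powr (1 / P)) \<le> D * min (a * m powr (1 / P)) (a powr (- \<gamma>) * (\<kappa> * N))"
            by (intro mult_left_mono) auto
          with \<tau>(2) show ?thesis by linarith
        qed
        then have "maximal_rough \<Omega> f x \<le> ennreal (D * (C\<^sub>\<gamma> * ((m powr (1 / P)) powr (1 - q / d) * (\<kappa> * N) powr (q / d))))"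
          by (intro max_le min_bound) auto
        also have "D * (C\<^sub>\<gamma> * ((m powr (1 / P)) powr (1 - q / d) * (\<kappa> * N) powr (q / d)))
          = C * l powr (1 / \<rho>) * W powr (1 / P) * m powr (1 / P * (1 - q / d)) * N powr (q / d)"
        proof -
          have "(l / real ?n) powr (1 / \<rho>) = (1 / real ?n) powr (1 / \<rho>) * l powr (1 / \<rho>)"
            using powr_mult[of "1 / real ?n" l "1 / \<rho>"] l by simp
          moreover have "(\<kappa> * N) powr (q / d) = \<kappa> powr (q / d) * N powr (q / d)"
            using \<kappa> N by (simp add: powr_mult)
          ultimately show ?thesis unfolding D_def C_def powr_powr by (simp only: mult_ac)
        qed
        also have "ennreal \<dots> = ennreal C * ennreal (Lp_norm sphere_measure \<rho> \<Omega>)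
          * Muckenhoupt_const \<delta> \<omega> epowr (1 / P) * M epowr (1 / P * (1 - q / d))
          * Morrey_norm P q \<omega> (gradient f) epowr (q / d)"
          using C W m(1) N(1) unfolding norm_eq W' m(2) N(2) by (simp add: ennpowr_ennreal ennreal_mult)
        finally show ?thesis unfolding M_def .
      qed
    qed
  qed
qed

end
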